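(* Assume the decay of correlations assumption (DC) and the moment assumption (M), both stated in the context, where $r\ge0$, $\int r\,d\mu=1$, $r$ lies in the $L^{s_1}(\mu)$-closure of $B\cap L^{s_1}(\mu)$ for some $s_1\ge1$, and $d\nu=r\,d\mu$. If the continuous time process $V_n(\cdot)=(L_n(\cdot),R_n(\cdot))$ (defined in the context) converges in distribution in the Skorokhod space with respect to the measure $\mu$ as $n\to\infty$, then it also converges in distribution in the Skorokhod space with respect to the measure $\nu$, and to the same limit. If moreover $r>0$ $\mu$-a.s., then conversely convergence in distribution of $V_n(\cdot)$ in the Skorokhod space with respect to $\nu$ implies its convergence in distribution with respect to $\mu$ to the same limit.
   Context: $(\mathcal E,\mathcal F,\mu)$ is a probability space, $\mathcal X_0,\mathcal X_1,\dots$ are measurable spaces, and $X_j:\mathcal E\to\mathcal X_j$, $j\ge0$, are measurable maps. Set $\mathcal Y_n=\mathcal X_n\times\mathcal X_{n+1}\times\cdots$ and $\overline X_n(x)=(X_n(x),X_{n+1}(x),X_{n+2}(x),\dots)\in\mathcal Y_n$. $[a]$ denotes the integer part of $a$, and empty sums are $0$. Assumption (DC): there is a sequence $(\delta_n)$ converging to $0$ and a set $B$ of real-valued $\mu$-integrable functions on $\mathcal E$ equipped with a "norm" $\|\cdot\|$ (a function $B\to[0,\infty)$) such that for all $n$, all $s\in B$ and all bounded measurable complex-valued functions $f=f(x_n,x_{n+1},\dots)$ on $\mathcal Y_n$, $$\left|\int s\cdot (f\circ\overline X_n)\,d\mu-\int s\,d\mu\cdot\int f\circ\overline X_n\,d\mu\right|\le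 \|s\|\,\|f\circ\overline X_n\|_{\infty}\,\delta_n,$$ where $\|f\circ\overline X_n\|_\infty$ is the essential supremum with respect to $\mu$. The processes: let $d,m\in\mathbb N$. For each $1\le i\le d$ let $g^{(i)}_j:\mathcal Y_j\to\mathbb R^{d_i}$, $j\ge0$, be measurable functions ($d_i\ge1$), and set $S_ng^{(i)}=\sum_{j=0}^{n-1}g^{(i)}_j\circ\overline X_j$. For each $d+1\le k\le d+m$ let $p_k,q_k\in\mathbb N$, and let $f^{k,u}_j$ ($1\le u\le p_k$) and $h^{k,v}_j$ ($1\le v\le q_k$), $j\ge0$, be measurable real-valued functions on $\mathcal Y_j$. Set $S_nh^{k,v}=\sum_{j=0}^{n-1}h^{k,v}_j\circ\overline X_j$, and let $A_nf_k$ be the matrix, regarded as an $\mathbb R^{p_kq_k}$-valued function on $\mathcal E$, with entries $$(A_nf_k)_{u,v}=\sum_{i=0}^{n-1}\sum_{j=i+1}^{n-1}\big(f^{k,u}_i\circ\overline X_i\big)\big(h^{k,v}_j\circ\overline X_j\big).$$ For $t\ge0$ and $n\ge1$ set $L_n(t)=n^{-1/2}(S_{[nt]}g^{(1)},\dots,S_{[nt]}g^{(d)})$, $R_n(t)=n^{-1}(A_{[nt]}f_{d+1},\dots,A_{[nt]}f_{d+m})$ and $V_n(t)=(L_n(t),R_n(t))$. "The Skorokhod space" is the space $D([0,\infty),\mathbb R^N)$, with $\mathbb R^N$ the range of $V_n(t)$; convergence with respect to $\mu$ (resp. $\nu$) means that $x\in\mathcal E$ is distributed according to $\mu$ (resp.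 $\nu$). Assumption (M): there are $p_1\ge1$ with $s_1\ge p_1/(p_1-1)$ (with $p_1/(p_1-1):=\infty$ for $p_1=1$), $\varepsilon\in(0,1)$ and a constant $C$ such that for every $d+1\le k\le d+m$, $1\le v\le q_k$ and $n\ge1$, $\|S_nh^{k,v}\|_{L^{p_1}(\mu)}\le Cn^{1-\varepsilon}$. Moreover, $f^{k,u}_i\circ\overline X_i\in L^{s_3}(\mu)$ for every $i\ge0$, $d+1\le k\le d+m$ and $1\le u\le p_k$, where $\frac1{s_3}=1-\frac1{s_1}-\frac1{p_1}$ (with the conventions $\frac1\infty=0$, $\frac10=\infty$). *)

theory Defs
  imports "HOL-Probability.Probability" "HOL-Probability.Essential_Supremum"
begin

section \<open>The Skorokhod space\<close>

text \<open>
  For a finite index set \<open>I\<close> the vector space \<open>\<real>\<^sup>I\<close> is rendered by the functions in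
  \<open>extensional I\<close> with the Euclidean norm \<open>L2_set _ I\<close>. Paths are extensional outside \<open>[0,\<infinity>)\<close>, so
  that equality of paths is equality on \<open>[0,\<infinity>)\<close>.
\<close>

definition skorokhod_space :: "'i set \<Rightarrow> (real \<Rightarrow> 'i \<Rightarrow> real) set" where
  "skorokhod_space I =
    {x \<in> {0..} \<rightarrow>\<^sub>E extensional I.
       \<forall>i\<in>I. (\<forall>t\<ge>0. ((\<lambda>s. x s i) \<longlongrightarrow> x t i) (at_right t)) \<and>
             (\<forall>t>0. \<exists>l. ((\<lambda>s. x s i) \<longlongrightarrow> l) (at_left t))}"

text \<open>Increasing bijections of \<open>[0,m]\<close>, which are automatically homeomorphisms.\<close>

definition time_changes :: "nat \<Rightarrow> (real \<Rightarrow> real) set" where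
  "time_changes m = {l. strict_mono_on {0..real m} l \<and> l ` {0..real m} = {0..real m}}"

definition cutoff :: "nat \<Rightarrow> real \<Rightarrow> real" where
  "cutoff m t = max 0 (min 1 (real m - t))"

text \<open>
  The \<open>J\<^sub>1\<close> distance on \<open>[0,m]\<close> of the paths \<open>cutoff m \<cdot> x\<close> and \<open>cutoff m \<cdot> y\<close>, which are continuous
  at the end point \<open>m\<close>.
\<close>

definition skorokhod_dist_upto ::
  "'i set \<Rightarrow> nat \<Rightarrow> (real \<Rightarrow> 'i \<Rightarrow> real) \<Rightarrow> (real \<Rightarrow> 'i \<Rightarrow> real) \<Rightarrow> real" where
  "skorokhod_dist_upto I m x y =
    (INF l\<in>time_changes m.
       max (SUP t\<in>{0..real m}. \<bar>l t - t\<bar>)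
           (SUP t\<in>{0..real m}. L2_set (\<lambda>i. cutoff m t * x t i - cutoff m (l t) * y (l t) i) I))"

text \<open>
  The metric of Billingsley (Convergence of Probability Measures, Section 16) on \<open>D([0,\<infinity>),\<real>\<^sup>I)\<close>;
  it induces the usual Skorokhod \<open>J\<^sub>1\<close> topology. The default value \<open>0\<close> off the space only serves
  the locale \<open>Metric_space\<close>, which demands symmetry and nonnegativity on the whole type.
\<close>

definition skorokhod_dist ::
  "'i set \<Rightarrow> (real \<Rightarrow> 'i \<Rightarrow> real) \<Rightarrow> (real \<Rightarrow> 'i \<Rightarrow> real) \<Rightarrow> real" where
  "skorokhod_dist I x y =
    (if x \<in> skorokhod_space I \<and> y \<in> skorokhod_space I
     then \<Sum>n. (1/2) ^ Suc n * min 1 (skorokhod_dist_upto I (Suc n) x y) else 0)"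

definition skorokhod_topology :: "'i set \<Rightarrow> (real \<Rightarrow> 'i \<Rightarrow> real) topology" where
  "skorokhod_topology I = Metric_space.mtopology (skorokhod_space I) (skorokhod_dist I)"

lemma cutoff_bounds: "0 \<le> cutoff m t" "cutoff m t \<le> 1"
  by (auto simp: cutoff_def)

lemma skorokhod_space_bounded:
  assumes x: "x \<in> skorokhod_space I" and i: "i \<in> I"
  shows "\<exists>K. \<forall>t\<in>{0..real m}. \<bar>x t i\<bar> \<le> K"
proof -
  have loc: "\<exists>U K. open U \<and> t \<in> U \<and> (\<forall>s\<in>U \<inter> {0..real m}. \<bar>x s i\<bar> \<le> K)" if t: "t \<in> {0..real m}" for t
  proof -
    have bdd: "\<exists>K. eventually (\<lambda>s. \<bar>x s i\<bar> \<le> K) F"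
      if "((\<lambda>s. x s i) \<longlongrightarrow> l) F" for l F
    proof -
      have "((\<lambda>s. \<bar>x s i\<bar>) \<longlongrightarrow> \<bar>l\<bar>) F" using that by (rule tendsto_rabs)
      then have "eventually (\<lambda>s. \<bar>x s i\<bar> < \<bar>l\<bar> + 1) F" by (rule order_tendstoD) simp
      then show ?thesis by (intro exI[of _ "\<bar>l\<bar> + 1"]) (auto elim: eventually_mono)
    qed
    have "\<exists>K. eventually (\<lambda>s. \<bar>x s i\<bar> \<le> K) (at_right t)"
      using x i t by (intro bdd[of "x t i"]) (auto simp: skorokhod_space_def)
    then obtain K1 where K1: "eventually (\<lambda>s. \<bar>x s i\<bar> \<le> K1) (at_right t)" by blast
    have "\<exists>K. eventually (\<lambda>s. s \<in> {0..real m} \<longrightarrow> \<bar>x s i\<bar> \<le> K) (at_left t)"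
    proof (cases "t = 0")
      case True
      have "eventually (\<lambda>s. s \<in> {0..real m} \<longrightarrow> \<bar>x s i\<bar> \<le> 0) (at_left t)"
        unfolding True eventually_at_filter by auto
      then show ?thesis by blast
    next
      case False
      then have "t > 0" using t by simp
      then obtain l where "((\<lambda>s. x s i) \<longlongrightarrow> l) (at_left t)"
        using x i unfolding skorokhod_space_def by blast
      from bdd[OF this] show ?thesis by (auto elim: eventually_mono)
    qed
    then obtain K2 where K2: "eventually (\<lambda>s. s \<in> {0..real m} \<longrightarrow> \<bar>x s i\<bar> \<le> K2) (at_left t)" by blast
    define K where "K = max (max K1 K2) \<bar>x t i\<bar>"
    have "eventually (\<lambda>s. s \<in> {0..real m} \<longrightarrow> \<bar>x s i\<bar> \<le> K) (at t)"
      unfolding eventually_at_split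
    proof
      show "eventually (\<lambda>s. s \<in> {0..real m} \<longrightarrow> \<bar>x s i\<bar> \<le> K) (at_left t)"
        using K2 by (rule eventually_mono) (auto simp: K_def)
      show "eventually (\<lambda>s. s \<in> {0..real m} \<longrightarrow> \<bar>x s i\<bar> \<le> K) (at_right t)"
        using K1 by (rule eventually_mono) (auto simp: K_def)
    qed
    then obtain U where U: "open U" "t \<in> U" "\<forall>s\<in>U. s \<noteq> t \<longrightarrow> s \<in> {0..real m} \<longrightarrow> \<bar>x s i\<bar> \<le> K"
      unfolding eventually_at_topological by auto
    have "\<bar>x t i\<bar> \<le> K" by (simp add: K_def)
    then have "\<forall>s\<in>U \<inter> {0..real m}. \<bar>x s i\<bar> \<le> K" using U(3) by (metis IntE)
    then show ?thesis using U(1,2) by blast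
  qed
  then have "\<forall>t\<in>{0..real m}. \<exists>U K. open U \<and> t \<in> U \<and> (\<forall>s\<in>U \<inter> {0..real m}. \<bar>x s i\<bar> \<le> K)"
    by blast
  then obtain U K where "\<forall>t\<in>{0..real m}. open (U t) \<and> t \<in> U t \<and>
      (\<forall>s\<in>U t \<inter> {0..real m}. \<bar>x s i\<bar> \<le> K t)"
    unfolding bchoice_iff by blast
  then have UK: "\<And>t. t \<in> {0..real m} \<Longrightarrow> open (U t) \<and> t \<in> U t"
    "\<And>t s. t \<in> {0..real m} \<Longrightarrow> s \<in> U t \<inter> {0..real m} \<Longrightarrow> \<bar>x s i\<bar> \<le> K t"
    by blast+
  obtain C where C: "C \<subseteq> {0..real m}" "finite C" "{0..real m} \<subseteq> (\<Union>c\<in>C. U c)"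
    by (rule compactE_image[of "{0..real m}" "{0..real m}" U]) (use UK(1) in auto)
  have "\<bar>x t i\<bar> \<le> Max (K ` C)" if t: "t \<in> {0..real m}" for t
  proof -
    obtain c where c: "c \<in> C" "t \<in> U c" using C(3) t by blast
    then have "\<bar>x t i\<bar> \<le> K c" using UK(2)[of c t] C(1) t by blast
    also have "K c \<le> Max (K ` C)" using c C(2) by simp
    finally show ?thesis .
  qed
  then show ?thesis by blast
qed

lemma L2_set_bdd_aux:
  assumes "x \<in> skorokhod_space I" "y \<in> skorokhod_space I" "l \<in> time_changes m"
  shows "bdd_above ((\<lambda>t. L2_set (\<lambda>i. cutoff m t * x t i - cutoff m (l t) * y (l t) i) I) ` {0..real m})"
proof -
  have "\<forall>i\<in>I. \<exists>K. \<forall>t\<in>{0..real m}. \<bar>x t i\<bar> \<le> K"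
    using skorokhod_space_bounded[OF assms(1)] by blast
  then obtain K where K: "\<And>i t. i \<in> I \<Longrightarrow> t \<in> {0..real m} \<Longrightarrow> \<bar>x t i\<bar> \<le> K i"
    unfolding bchoice_iff by blast
  have "\<forall>i\<in>I. \<exists>K. \<forall>t\<in>{0..real m}. \<bar>y t i\<bar> \<le> K"
    using skorokhod_space_bounded[OF assms(2)] by blast
  then obtain L where L: "\<And>i t. i \<in> I \<Longrightarrow> t \<in> {0..real m} \<Longrightarrow> \<bar>y t i\<bar> \<le> L i"
    unfolding bchoice_iff by blast
  have "L2_set (\<lambda>i. cutoff m t * x t i - cutoff m (l t) * y (l t) i) I \<le> (\<Sum>i\<in>I. K i + L i)"
    if t: "t \<in> {0..real m}" for t
  proof -
    have lt: "l t \<in> {0..real m}" using assms(3) t by (auto simp: time_changes_def)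
    have "L2_set (\<lambda>i. cutoff m t * x t i - cutoff m (l t) * y (l t) i) I
        \<le> (\<Sum>i\<in>I. \<bar>cutoff m t * x t i - cutoff m (l t) * y (l t) i\<bar>)"
      by (rule L2_set_le_sum_abs)
    also have "\<dots> \<le> (\<Sum>i\<in>I. K i + L i)"
    proof (rule sum_mono)
      fix i assume i: "i \<in> I"
      have "\<bar>cutoff m t * x t i\<bar> \<le> 1 * K i"
        unfolding abs_mult using K[OF i t] cutoff_bounds[of m t] by (intro mult_mono) auto
      moreover have "\<bar>cutoff m (l t) * y (l t) i\<bar> \<le> 1 * L i"
        unfolding abs_mult using L[OF i lt] cutoff_bounds[of m "l t"] by (intro mult_mono) auto
      ultimately show "\<bar>cutoff m t * x t i - cutoff m (l t) * y (l t) i\<bar> \<le> K i + L i" by linarith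
    qed
    finally show ?thesis .
  qed
  then show ?thesis by (intro bdd_aboveI2) auto
qed

lemma time_change_bdd_aux:
  assumes "l \<in> time_changes m"
  shows "bdd_above ((\<lambda>t. \<bar>l t - t\<bar>) ` {0..real m})"
proof -
  have "\<bar>l t - t\<bar> \<le> real m" if "t \<in> {0..real m}" for t
  proof -
    have "l t \<in> {0..real m}" using assms that by (auto simp: time_changes_def)
    then show ?thesis using that by auto
  qed
  then show ?thesis by (intro bdd_aboveI2) auto
qed

lemma id_time_change: "(\<lambda>t. t) \<in> time_changes m"
  by (auto simp: time_changes_def strict_mono_on_def)

lemma skorokhod_sup_nonneg:
  assumes "l \<in> time_changes m"
  shows "0 \<le> max (SUP t\<in>{0..real m}. \<bar>l t - t\<bar>) (B :: real)"
proof -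
  have "\<bar>l 0 - 0\<bar> \<le> (SUP t\<in>{0..real m}. \<bar>l t - t\<bar>)"
    by (rule cSUP_upper[OF _ time_change_bdd_aux[OF assms]]) auto
  then show ?thesis by linarith
qed

lemma skorokhod_dist_upto_nonneg: "0 \<le> skorokhod_dist_upto I m x y"
  unfolding skorokhod_dist_upto_def
  by (rule cINF_greatest) (use id_time_change[of m] in \<open>auto intro!: skorokhod_sup_nonneg\<close>)

lemma skorokhod_dist_upto_leI:
  assumes l: "l \<in> time_changes m"
    and 1: "\<And>t. t \<in> {0..real m} \<Longrightarrow> \<bar>l t - t\<bar> \<le> e"
    and 2: "\<And>t. t \<in> {0..real m} \<Longrightarrow>
        L2_set (\<lambda>i. cutoff m t * x t i - cutoff m (l t) * y (l t) i) I \<le> e"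
  shows "skorokhod_dist_upto I m x y \<le> e"
proof -
  have "skorokhod_dist_upto I m x y \<le>
      max (SUP t\<in>{0..real m}. \<bar>l t - t\<bar>)
           (SUP t\<in>{0..real m}. L2_set (\<lambda>i. cutoff m t * x t i - cutoff m (l t) * y (l t) i) I)"
    unfolding skorokhod_dist_upto_def
    by (rule cINF_lower[OF _ l]) (auto intro!: bdd_belowI[of _ 0] skorokhod_sup_nonneg)
  also have "\<dots> \<le> e"
    using 1 2 by (intro max.boundedI cSUP_least) auto
  finally show ?thesis .
qed

lemma skorokhod_dist_upto_lessD:
  assumes x: "x \<in> skorokhod_space I" and y: "y \<in> skorokhod_space I"
    and less: "skorokhod_dist_upto I m x y < e"
  obtains l where "l \<in> time_changes m"
    "\<And>t. t \<in> {0..real m} \<Longrightarrow> \<bar>l t - t\<bar> < e"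
    "\<And>t. t \<in> {0..real m} \<Longrightarrow>
        L2_set (\<lambda>i. cutoff m t * x t i - cutoff m (l t) * y (l t) i) I < e"
proof -
  obtain l where l: "l \<in> time_changes m" and m:
    "max (SUP t\<in>{0..real m}. \<bar>l t - t\<bar>)
       (SUP t\<in>{0..real m}. L2_set (\<lambda>i. cutoff m t * x t i - cutoff m (l t) * y (l t) i) I) < e"
    using less unfolding skorokhod_dist_upto_def
    by (subst (asm) cINF_less_iff)
      (use id_time_change in \<open>auto intro!: bdd_belowI[of _ 0] skorokhod_sup_nonneg\<close>)
  show ?thesis
  proof (rule that[OF l])
    fix t assume t: "t \<in> {0..real m}"
    show "\<bar>l t - t\<bar> < e"
      using cSUP_upper[OF t time_change_bdd_aux[OF l]] m by linarith
    show "L2_set (\<lambda>i. cutoff m t * x t i - cutoff m (l t) * y (l t) i) I < e"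
      using cSUP_upper[OF t L2_set_bdd_aux[OF x y l]] m by linarith
  qed
qed

lemma skorokhod_dist_upto_sym_le:
  assumes x: "x \<in> skorokhod_space I" and y: "y \<in> skorokhod_space I"
  shows "skorokhod_dist_upto I m y x \<le> skorokhod_dist_upto I m x y"
proof (rule dense_ge)
  fix e assume e: "skorokhod_dist_upto I m x y < e"
  obtain l where l: "l \<in> time_changes m"
    and 1: "\<And>t. t \<in> {0..real m} \<Longrightarrow> \<bar>l t - t\<bar> < e"
    and 2: "\<And>t. t \<in> {0..real m} \<Longrightarrow>
        L2_set (\<lambda>i. cutoff m t * x t i - cutoff m (l t) * y (l t) i) I < e"
    using skorokhod_dist_upto_lessD[OF x y e] by blast
  define k where "k = inv_into {0..real m} l"
  have im: "l ` {0..real m} = {0..real m}" and sm: "strict_mono_on {0..real m} l"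
    using l by (auto simp: time_changes_def)
  have inj: "inj_on l {0..real m}" using sm by (rule strict_mono_on_imp_inj_on)
  have k1: "k t \<in> {0..real m}" if "t \<in> {0..real m}" for t
    unfolding k_def using that im by (metis inv_into_into)
  have k2: "l (k t) = t" if "t \<in> {0..real m}" for t
    unfolding k_def using that im by (metis f_inv_into_f)
  have k3: "k (l t) = t" if "t \<in> {0..real m}" for t
    unfolding k_def using that inj by simp
  have "k ` {0..real m} = {0..real m}"
  proof
    show "{0..real m} \<subseteq> k ` {0..real m}"
    proof
      fix t assume t: "t \<in> {0..real m}"
      then have "l t \<in> {0..real m}" using im by blast
      then show "t \<in> k ` {0..real m}" using k3[OF t] by (metis image_eqI)
    qed
  qed (use k1 in blast)
  moreover have "strict_mono_on {0..real m} k"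
  proof (rule strict_mono_onI)
    fix r s assume rs: "r \<in> {0..real m}" "s \<in> {0..real m}" "r < s"
    show "k r < k s"
    proof (rule ccontr)
      assume "\<not> k r < k s"
      then have "l (k s) \<le> l (k r)"
        using strict_mono_onD[OF sm, of "k s" "k r"] k1 rs by (cases "k s = k r") auto
      then show False using k2 rs by simp
    qed
  qed
  ultimately have k: "k \<in> time_changes m" by (simp add: time_changes_def)
  show "skorokhod_dist_upto I m y x \<le> e"
  proof (rule skorokhod_dist_upto_leI[OF k])
    fix t assume t: "t \<in> {0..real m}"
    show "\<bar>k t - t\<bar> \<le> e" using 1[OF k1[OF t]] k2[OF t] by linarith
    have "L2_set (\<lambda>i. cutoff m t * y t i - cutoff m (k t) * x (k t) i) I
        = L2_set (\<lambda>i. cutoff m (k t) * x (k t) i - cutoff m (l (k t)) * y (l (k t)) i) I"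
      unfolding k2[OF t] L2_set_def by (simp add: power2_commute)
    also have "\<dots> < e" by (rule 2[OF k1[OF t]])
    finally show "L2_set (\<lambda>i. cutoff m t * y t i - cutoff m (k t) * x (k t) i) I \<le> e" by simp
  qed
qed

lemma skorokhod_dist_upto_triangle:
  assumes x: "x \<in> skorokhod_space I" and y: "y \<in> skorokhod_space I" and z: "z \<in> skorokhod_space I"
  shows "skorokhod_dist_upto I m x z \<le> skorokhod_dist_upto I m x y + skorokhod_dist_upto I m y z"
proof (rule field_le_epsilon)
  fix e :: real assume e: "0 < e"
  define a where "a = skorokhod_dist_upto I m x y + e/2"
  define b where "b = skorokhod_dist_upto I m y z + e/2"
  obtain l where l: "l \<in> time_changes m"
    and l1: "\<And>t. t \<in> {0..real m} \<Longrightarrow> \<bar>l t - t\<bar> < a"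
    and l2: "\<And>t. t \<in> {0..real m} \<Longrightarrow>
        L2_set (\<lambda>i. cutoff m t * x t i - cutoff m (l t) * y (l t) i) I < a"
    using skorokhod_dist_upto_lessD[OF x y, of m a] e unfolding a_def by auto
  obtain k where k: "k \<in> time_changes m"
    and k1: "\<And>t. t \<in> {0..real m} \<Longrightarrow> \<bar>k t - t\<bar> < b"
    and k2: "\<And>t. t \<in> {0..real m} \<Longrightarrow>
        L2_set (\<lambda>i. cutoff m t * y t i - cutoff m (k t) * z (k t) i) I < b"
    using skorokhod_dist_upto_lessD[OF y z, of m b] e unfolding b_def by auto
  have lt: "l t \<in> {0..real m}" if "t \<in> {0..real m}" for t
    using l that by (auto simp: time_changes_def)
  have kl: "(\<lambda>t. k (l t)) \<in> time_changes m"
  proof -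
    have "(\<lambda>t. k (l t)) ` {0..real m} = k ` (l ` {0..real m})" by auto
    then have "(\<lambda>t. k (l t)) ` {0..real m} = {0..real m}"
      using l k by (auto simp: time_changes_def)
    moreover have "strict_mono_on {0..real m} (\<lambda>t. k (l t))"
      using l k lt by (auto simp: time_changes_def strict_mono_on_def)
    ultimately show ?thesis by (simp add: time_changes_def)
  qed
  have "skorokhod_dist_upto I m x z \<le> a + b"
  proof (rule skorokhod_dist_upto_leI[OF kl])
    fix t assume t: "t \<in> {0..real m}"
    show "\<bar>k (l t) - t\<bar> \<le> a + b" using l1[OF t] k1[OF lt[OF t]] by linarith
    have "L2_set (\<lambda>i. cutoff m t * x t i - cutoff m (k (l t)) * z (k (l t)) i) I
        = L2_set (\<lambda>i. (cutoff m t * x t i - cutoff m (l t) * y (l t) i)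
            + (cutoff m (l t) * y (l t) i - cutoff m (k (l t)) * z (k (l t)) i)) I"
      by simp
    also have "\<dots> \<le> L2_set (\<lambda>i. cutoff m t * x t i - cutoff m (l t) * y (l t) i) I
        + L2_set (\<lambda>i. cutoff m (l t) * y (l t) i - cutoff m (k (l t)) * z (k (l t)) i) I"
      by (rule L2_set_triangle_ineq)
    also have "\<dots> \<le> a + b" using l2[OF t] k2[OF lt[OF t]] by linarith
    finally show "L2_set (\<lambda>i. cutoff m t * x t i - cutoff m (k (l t)) * z (k (l t)) i) I \<le> a + b" .
  qed
  then show "skorokhod_dist_upto I m x z
      \<le> skorokhod_dist_upto I m x y + skorokhod_dist_upto I m y z + e"
    by (simp add: a_def b_def)
qed

lemma skorokhod_dist_upto_eq_0D:
  assumes fin: "finite I" and x: "x \<in> skorokhod_space I" and y: "y \<in> skorokhod_space I"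
    and 0: "\<And>n. skorokhod_dist_upto I (Suc n) x y = 0"
  shows "x = y"
proof -
  have "x t i = y t i" if t: "0 \<le> t" and i: "i \<in> I" for t i
  proof (rule ccontr)
    assume ne: "x t i \<noteq> y t i"
    define h where "h = \<bar>x t i - y t i\<bar> / 3"
    have h: "h > 0" using ne by (simp add: h_def)
    have lim: "((\<lambda>s. x s i) \<longlongrightarrow> x t i) (at_right t)" "((\<lambda>s. y s i) \<longlongrightarrow> y t i) (at_right t)"
      using x y t i by (auto simp: skorokhod_space_def)
    have "eventually (\<lambda>s. dist (x s i) (x t i) < h \<and> dist (y s i) (y t i) < h) (at_right t)"
      by (intro eventually_conj tendstoD[OF lim(1) h] tendstoD[OF lim(2) h])
    then obtain b where b: "b > t" and near:
      "\<And>s. t < s \<Longrightarrow> s < b \<Longrightarrow> dist (x s i) (x t i) < h \<and> dist (y s i) (y t i) < h"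
      unfolding eventually_at_right_field by auto
    define s where "s = (t + b) / 2"
    obtain n where n: "b + 1 \<le> real n" using real_arch_simple by blast
    define m where "m = Suc n"
    define e where "e = min h ((b - t) / 2)"
    have e: "e > 0" using h b by (simp add: e_def)
    have "skorokhod_dist_upto I m x y < e" using 0[of n] e by (simp add: m_def)
    from skorokhod_dist_upto_lessD[OF x y this] obtain l where l: "l \<in> time_changes m"
      and l1: "\<And>t. t \<in> {0..real m} \<Longrightarrow> \<bar>l t - t\<bar> < e"
      and l2: "\<And>t. t \<in> {0..real m} \<Longrightarrow>
        L2_set (\<lambda>i. cutoff m t * x t i - cutoff m (l t) * y (l t) i) I < e"
      by blast
    have s: "s \<in> {0..real m}" "t < s" "s < b" using b t n by (auto simp: s_def m_def)
    have "\<bar>l s - s\<bar> < (b - t) / 2" using l1[OF s(1)] by (simp add: e_def)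
    moreover have "s - (b - t) / 2 = t" "s + (b - t) / 2 = b" by (simp_all add: s_def field_simps)
    ultimately have ls: "t < l s" "l s < b" by linarith+
    have c: "cutoff m s = 1" "cutoff m (l s) = 1" using s ls n by (auto simp: cutoff_def m_def)
    have "\<bar>x s i - y (l s) i\<bar> = \<bar>cutoff m s * x s i - cutoff m (l s) * y (l s) i\<bar>" by (simp add: c)
    also have "\<dots> \<le> L2_set (\<lambda>i. \<bar>cutoff m s * x s i - cutoff m (l s) * y (l s) i\<bar>) I"
      by (rule member_le_L2_set[OF fin i])
    also have "\<dots> = L2_set (\<lambda>i. cutoff m s * x s i - cutoff m (l s) * y (l s) i) I"
      by (simp add: L2_set_def)
    also have "\<dots> < e" by (rule l2[OF s(1)])
    also have "e \<le> h" by (simp add: e_def)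
    finally have "\<bar>x s i - y (l s) i\<bar> < h" .
    moreover have "\<bar>x s i - x t i\<bar> < h" using near[OF s(2,3)] by (simp add: dist_real_def)
    moreover have "\<bar>y (l s) i - y t i\<bar> < h" using near[OF ls] by (simp add: dist_real_def)
    ultimately have "\<bar>x t i - y t i\<bar> < 3 * h" by linarith
    then show False by (simp add: h_def)
  qed
  moreover have "x t \<in> extensional I" "y t \<in> extensional I" if "0 \<le> t" for t
    using x y that by (auto simp: skorokhod_space_def PiE_iff)
  ultimately have "x t = y t" if "0 \<le> t" for t
    using that by (metis extensionalityI)
  moreover have "x \<in> extensional {0..}" "y \<in> extensional {0..}"
    using x y by (auto simp: skorokhod_space_def PiE_iff)
  ultimately show ?thesis by (metis extensionalityI atLeast_iff)
qed

theorem Metric_space_skorokhod: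
  assumes fin: "finite I"
  shows "Metric_space (skorokhod_space I) (skorokhod_dist I)"
proof -
  define T where "T x y n = (1/2::real) ^ Suc n * min 1 (skorokhod_dist_upto I (Suc n) x y)" for x y n
  have T0: "0 \<le> T x y n" for x y n
    unfolding T_def using skorokhod_dist_upto_nonneg[of I "Suc n" x y] by auto
  have half: "summable (\<lambda>n. (1/2::real) ^ Suc n)"
    by (subst summable_Suc_iff) (rule summable_geometric, simp)
  have sT: "summable (T x y)" for x y
  proof (rule summable_comparison_test[OF _ half], intro exI[of _ 0] allI impI)
    fix n
    have "T x y n \<le> (1/2) ^ Suc n * 1" unfolding T_def by (intro mult_left_mono) auto
    then show "norm (T x y n) \<le> (1/2) ^ Suc n" using T0[of x y n] by simp
  qed
  have d: "skorokhod_dist I x y = (\<Sum>n. T x y n)"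
    if "x \<in> skorokhod_space I" "y \<in> skorokhod_space I" for x y
    using that by (simp add: skorokhod_dist_def T_def)
  have sym: "skorokhod_dist_upto I m x y = skorokhod_dist_upto I m y x"
    if "x \<in> skorokhod_space I" "y \<in> skorokhod_space I" for x y m
    using skorokhod_dist_upto_sym_le that by (metis order_antisym)
  show ?thesis
  proof
    fix x y
    show "0 \<le> skorokhod_dist I x y"
      using suminf_nonneg[OF sT T0] d by (cases "x \<in> skorokhod_space I \<and> y \<in> skorokhod_space I")
        (auto simp: skorokhod_dist_def)
    show "skorokhod_dist I x y = skorokhod_dist I y x"
    proof (cases "x \<in> skorokhod_space I \<and> y \<in> skorokhod_space I")
      case True
      then have "T x y = T y x" unfolding T_def using sym by auto
      then show ?thesis using d True by simp
    qed (auto simp: skorokhod_dist_def)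
  next
    fix x y assume x: "x \<in> skorokhod_space I" and y: "y \<in> skorokhod_space I"
    show "skorokhod_dist I x y = 0 \<longleftrightarrow> x = y"
    proof
      assume "skorokhod_dist I x y = 0"
      then have "T x y n = 0" for n using suminf_eq_zero_iff[OF sT T0] d[OF x y] by simp
      then have "min 1 (skorokhod_dist_upto I (Suc n) x y) = 0" for n
        by (simp add: T_def)
      then have "skorokhod_dist_upto I (Suc n) x y = 0" for n
        by (metis min_def zero_neq_one)
      then show "x = y" by (rule skorokhod_dist_upto_eq_0D[OF fin x y])
    next
      assume eq: "x = y"
      have "skorokhod_dist_upto I m x x \<le> 0" for m
        by (rule skorokhod_dist_upto_leI[OF id_time_change]) (auto simp: L2_set_def)
      then have "skorokhod_dist_upto I m x x = 0" for m
        using skorokhod_dist_upto_nonneg by (metis order_antisym)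
      then have "T x y = (\<lambda>n. 0)" by (auto simp: T_def eq)
      then show "skorokhod_dist I x y = 0" using d[OF x y] by simp
    qed
  next
    fix x y z
    assume x: "x \<in> skorokhod_space I" and y: "y \<in> skorokhod_space I" and z: "z \<in> skorokhod_space I"
    have "T x z n \<le> T x y n + T y z n" for n
    proof -
      have "min 1 (skorokhod_dist_upto I (Suc n) x z)
          \<le> min 1 (skorokhod_dist_upto I (Suc n) x y) + min 1 (skorokhod_dist_upto I (Suc n) y z)"
        using skorokhod_dist_upto_triangle[OF x y z, of "Suc n"]
          skorokhod_dist_upto_nonneg[of I "Suc n" x y] skorokhod_dist_upto_nonneg[of I "Suc n" y z]
        by (simp add: min_def)
      then have "(1/2::real) ^ Suc n * min 1 (skorokhod_dist_upto I (Suc n) x z)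
          \<le> (1/2) ^ Suc n * (min 1 (skorokhod_dist_upto I (Suc n) x y)
                + min 1 (skorokhod_dist_upto I (Suc n) y z))"
        by (intro mult_left_mono) auto
      then show ?thesis by (simp only: T_def distrib_left)
    qed
    then have "(\<Sum>n. T x z n) \<le> (\<Sum>n. T x y n + T y z n)"
      by (intro suminf_le sT summable_add)
    then show "skorokhod_dist I x z \<le> skorokhod_dist I x y + skorokhod_dist I y z"
      using d x y z suminf_add[OF sT[of x y] sT[of y z]] by simp
  qed
qed


section \<open>Convergence in distribution\<close>

definition borel_of_topology :: "'s topology \<Rightarrow> 's measure" where
  "borel_of_topology T = sigma (topspace T) {U. openin T U}"

text \<open>
  \<open>converges_in_distribution M Z T P\<close>: the \<open>Z n\<close> are random elements of the topological space \<open>T\<close>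
  on the probability space \<open>M\<close>, and their laws converge weakly to the Borel probability measure \<open>P\<close>.
\<close>

definition converges_in_distribution ::
  "'e measure \<Rightarrow> (nat \<Rightarrow> 'e \<Rightarrow> 's) \<Rightarrow> 's topology \<Rightarrow> 's measure \<Rightarrow> bool" where
  "converges_in_distribution M Z T P \<longleftrightarrow>
     (\<forall>n. Z n \<in> M \<rightarrow>\<^sub>M borel_of_topology T) \<and>
     prob_space P \<and> sets P = sets (borel_of_topology T) \<and>
     (\<forall>F. continuous_map T euclideanreal F \<and> bounded (F ` topspace T) \<longrightarrow>
        (\<lambda>n. \<integral>x. F (Z n x) \<partial>M) \<longlonglongrightarrow> (\<integral>y. F y \<partial>P))"


section \<open>Lebesgue spaces with exponent in \<open>[1,\<infinity>]\<close>\<close>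

definition Lp_norm :: "'a measure \<Rightarrow> ennreal \<Rightarrow> ('a \<Rightarrow> 'b::real_normed_vector) \<Rightarrow> ennreal" where
  "Lp_norm M p f =
    (if p = \<infinity> then esssup M (\<lambda>x. ennreal (norm (f x)))
     else let J = (\<integral>\<^sup>+x. ennreal (norm (f x) powr enn2real p) \<partial>M)
          in if J = \<infinity> then \<infinity> else ennreal (enn2real J powr (1 / enn2real p)))"

definition Lp_space :: "'a measure \<Rightarrow> ennreal \<Rightarrow> ('a \<Rightarrow> real) set" where
  "Lp_space M p = {f \<in> borel_measurable M. Lp_norm M p f < \<infinity>}"

definition Lp_closure :: "'a measure \<Rightarrow> ennreal \<Rightarrow> ('a \<Rightarrow> real) set \<Rightarrow> ('a \<Rightarrow> real) set" where
  "Lp_closure M p A =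
    {f \<in> Lp_space M p. \<forall>e>0. \<exists>s\<in>A. Lp_norm M p (\<lambda>x. f x - s x) < ennreal e}"


section \<open>The processes\<close>

text \<open>
  \<open>\<X>\<^sub>0, \<X>\<^sub>1, \<dots>\<close> are measurable spaces \<open>MX 0, MX 1, \<dots>\<close>; their carriers may differ, but live in one
  common type. The space \<open>\<Y>\<^sub>n\<close> consists of sequences indexed by \<open>{n..}\<close>, without shifting the index.
\<close>

definition future_space :: "(nat \<Rightarrow> 'x measure) \<Rightarrow> nat \<Rightarrow> (nat \<Rightarrow> 'x) measure" where
  "future_space MX n = (\<Pi>\<^sub>M j\<in>{n..}. MX j)"

definition future :: "(nat \<Rightarrow> 'e \<Rightarrow> 'x) \<Rightarrow> nat \<Rightarrow> 'e \<Rightarrow> nat \<Rightarrow> 'x" where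
  "future X n x = (\<lambda>j\<in>{n..}. X j x)"

definition birkhoff_sum ::
  "(nat \<Rightarrow> 'e \<Rightarrow> 'x) \<Rightarrow> (nat \<Rightarrow> (nat \<Rightarrow> 'x) \<Rightarrow> real) \<Rightarrow> nat \<Rightarrow> 'e \<Rightarrow> real" where
  "birkhoff_sum X \<phi> n x = (\<Sum>j<n. \<phi> j (future X j x))"

definition iterated_sum ::
  "(nat \<Rightarrow> 'e \<Rightarrow> 'x) \<Rightarrow> (nat \<Rightarrow> (nat \<Rightarrow> 'x) \<Rightarrow> real) \<Rightarrow> (nat \<Rightarrow> (nat \<Rightarrow> 'x) \<Rightarrow> real) \<Rightarrow> nat \<Rightarrow> 'e \<Rightarrow> real"
  where
  "iterated_sum X f h n x =
    (\<Sum>i<n. \<Sum>j\<in>{i+1..<n}. f i (future X i x) * h j (future X j x))"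

text \<open>
  The coordinates of \<open>\<real>\<^sup>N\<close>, the range of \<open>V\<^sub>n(t)\<close>: \<open>LCoord i a\<close> is the \<open>a\<close>-th coordinate of the
  block \<open>g\<^sup>(\<^sup>i\<^sup>)\<close>, and \<open>RCoord k u v\<close> is the \<open>(u,v)\<close> entry of the matrix \<open>A f\<^sub>k\<close>.
\<close>

datatype coord = LCoord nat nat | RCoord nat nat nat

definition coords ::
  "nat \<Rightarrow> nat \<Rightarrow> (nat \<Rightarrow> nat) \<Rightarrow> (nat \<Rightarrow> nat) \<Rightarrow> (nat \<Rightarrow> nat) \<Rightarrow> coord set" where
  "coords d m dims p q =
    {LCoord i a | i a. i \<in> {1..d} \<and> a \<in> {1..dims i}} \<union>
    {RCoord k u v | k u v. k \<in> {d+1..d+m} \<and> u \<in> {1..p k} \<and> v \<in> {1..q k}}"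

lemma finite_coords: "finite (coords d m dims p q)"
proof -
  have "coords d m dims p q =
      (\<lambda>(i, a). LCoord i a) ` (SIGMA i:{1..d}. {1..dims i}) \<union>
      (\<lambda>(k, u, v). RCoord k u v) ` (SIGMA k:{d+1..d+m}. {1..p k} \<times> {1..q k})"
    by (auto simp: coords_def image_iff)
  then show ?thesis by (simp only:) (intro finite_UnI finite_imageI finite_SigmaI; simp)
qed

text \<open>Only \<open>n \<ge> 1\<close> is meaningful; for \<open>n = 0\<close> the path below is identically \<open>0\<close>.\<close>

definition V_process ::
  "(nat \<Rightarrow> 'e \<Rightarrow> 'x) \<Rightarrow> nat \<Rightarrow> nat \<Rightarrow> (nat \<Rightarrow> nat) \<Rightarrow> (nat \<Rightarrow> nat) \<Rightarrow> (nat \<Rightarrow> nat) \<Rightarrow>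
   (nat \<Rightarrow> nat \<Rightarrow> (nat \<Rightarrow> 'x) \<Rightarrow> nat \<Rightarrow> real) \<Rightarrow>
   (nat \<Rightarrow> nat \<Rightarrow> nat \<Rightarrow> (nat \<Rightarrow> 'x) \<Rightarrow> real) \<Rightarrow>
   (nat \<Rightarrow> nat \<Rightarrow> nat \<Rightarrow> (nat \<Rightarrow> 'x) \<Rightarrow> real) \<Rightarrow>
   nat \<Rightarrow> 'e \<Rightarrow> real \<Rightarrow> coord \<Rightarrow> real" where
  "V_process X d m dims p q g f h n x =
    (\<lambda>t\<in>{0..}. \<lambda>c\<in>coords d m dims p q.
       (case c of
          LCoord i a \<Rightarrow> birkhoff_sum X (\<lambda>j y. g i j y a) (nat \<lfloor>real n * t\<rfloor>) x / sqrt (real n)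
        | RCoord k u v \<Rightarrow> iterated_sum X (f k u) (h k v) (nat \<lfloor>real n * t\<rfloor>) x / real n))"


section \<open>The standing assumptions\<close>

definition decay_of_correlations ::
  "'e measure \<Rightarrow> (nat \<Rightarrow> 'x measure) \<Rightarrow> (nat \<Rightarrow> 'e \<Rightarrow> 'x) \<Rightarrow>
   ('e \<Rightarrow> real) set \<Rightarrow> (('e \<Rightarrow> real) \<Rightarrow> real) \<Rightarrow> (nat \<Rightarrow> real) \<Rightarrow> bool" where
  "decay_of_correlations \<mu> MX X B nrm \<delta> \<longleftrightarrow>
     \<delta> \<longlonglongrightarrow> 0 \<and>
     (\<forall>s\<in>B. integrable \<mu> s \<and> 0 \<le> nrm s) \<and>
     (\<forall>n. \<forall>s\<in>B. \<forall>\<psi> :: (nat \<Rightarrow> 'x) \<Rightarrow> complex.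
        \<psi> \<in> borel_measurable (future_space MX n) \<and> bounded (\<psi> ` space (future_space MX n)) \<longrightarrow>
        cmod ((\<integral>x. of_real (s x) * \<psi> (future X n x) \<partial>\<mu>)
              - of_real (\<integral>x. s x \<partial>\<mu>) * (\<integral>x. \<psi> (future X n x) \<partial>\<mu>))
          \<le> nrm s * enn2real (Lp_norm \<mu> \<infinity> (\<lambda>x. \<psi> (future X n x))) * \<delta> n)"

text \<open>
  Arithmetic is that of \<^typ>\<open>ennreal\<close>, where \<open>1 / 0 = \<infinity>\<close> and \<open>1 / \<infinity> = 0\<close>. The exponents \<open>p\<^sub>1\<close>, \<open>s\<^sub>1\<close>
  may be infinite. For \<open>p\<^sub>1 = \<infinity>\<close> the term \<open>p\<^sub>1 / (p\<^sub>1 - 1)\<close> evaluates to \<open>0\<close> instead of the conjugate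
  exponent \<open>1\<close>, which makes no difference for \<open>s\<^sub>1 \<ge> 1\<close>. The truncated subtraction in \<open>s\<^sub>3\<close> is
  genuine because \<open>1 / s\<^sub>1 + 1 / p\<^sub>1 \<le> 1\<close>.
\<close>

definition moment_assumption ::
  "'e measure \<Rightarrow> (nat \<Rightarrow> 'e \<Rightarrow> 'x) \<Rightarrow> nat \<Rightarrow> nat \<Rightarrow> (nat \<Rightarrow> nat) \<Rightarrow> (nat \<Rightarrow> nat) \<Rightarrow>
   (nat \<Rightarrow> nat \<Rightarrow> nat \<Rightarrow> (nat \<Rightarrow> 'x) \<Rightarrow> real) \<Rightarrow>
   (nat \<Rightarrow> nat \<Rightarrow> nat \<Rightarrow> (nat \<Rightarrow> 'x) \<Rightarrow> real) \<Rightarrow> ennreal \<Rightarrow> bool" where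
  "moment_assumption \<mu> X d m p q f h s\<^sub>1 \<longleftrightarrow>
     (\<exists>p\<^sub>1::ennreal. \<exists>\<epsilon>::real. \<exists>C::real.
        1 \<le> p\<^sub>1 \<and> p\<^sub>1 / (p\<^sub>1 - 1) \<le> s\<^sub>1 \<and> 0 < \<epsilon> \<and> \<epsilon> < 1 \<and>
        (\<forall>k\<in>{d+1..d+m}. \<forall>v\<in>{1..q k}. \<forall>n\<ge>1.
           Lp_norm \<mu> p\<^sub>1 (birkhoff_sum X (h k v) n) \<le> ennreal (C * real n powr (1 - \<epsilon>))) \<and>
        (let s\<^sub>3 = 1 / (1 - 1 / s\<^sub>1 - 1 / p\<^sub>1) in
           \<forall>i. \<forall>k\<in>{d+1..d+m}. \<forall>u\<in>{1..p k}. (\<lambda>x. f k u i (future X i x)) \<in> Lp_space \<mu> s\<^sub>3))"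

end

(*
  Dropping the terms of index below N changes the iterated sums by f_i times S_[nt] h / n, which is
  small in L^1 for each fixed t but not uniformly in t, so the processes themselves cannot be
  compared in the Skorokhod metric.  A bounded continuous function F on the Skorokhod space is
  therefore approximated in L^1(P), P being the limit law, by functions G of finitely many window
  means of the path: discretised paths converge to the path, and window means converge to its values
  by right continuity.  Such a G is itself continuous, so closeness of F and G in L^1(P) passes to
  the processes under the measure for which convergence is assumed, and, since the other density is
  dominated by a multiple of this one up to a set of small mass, under the other measure too.
  For G, the window means of V_n and of its truncation differ by a quantity that tends to 0 almost
  surely along subsequences, so the decay of correlations decorrelates G(V_n) from every s in B,
  hence from r by density.
*)
theory Submission
  imports Defs
begin

section \<open>Time changes and convergence of Skorokhod paths\<close>

text \<open>Assumption (M) bounds the first moment of each S_r h separately and gives no hold on a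
  maximum over r; this is why a fixed time is harmless and a supremum over times is not. A window
  mean is a weighted sum over r with total weight 1, so its expectation is at most the largest of
  these moments, of order n^(1-\<epsilon>). The other factor of the truncation error is built from
  the first N terms and does not depend on n: at a single point it is a constant, so the product is
  treated pointwise along subsequences and then by dominated convergence. Applying F itself to a
  step path of window means, instead of taking some other function of them, preserves the bound of
  F. It also means that only finitely many entries are read: the truncated process needs measurable
  entries and need not be known to be a random element of the Skorokhod space. The choices are made
  in this order: the approximation of F under P, then s in B close to r, then N with \<delta>_N
  small uniformly in n, and n last.\<close>

lemma right_limits_partition:
  fixes f :: "real \<Rightarrow> real"
  assumes "0 \<le> b" and e: "0 < e"
    and right: "\<And>t. 0 \<le> t \<Longrightarrow> (f \<longlongrightarrow> f t) (at_right t)"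
    and left: "\<And>t. 0 < t \<Longrightarrow> \<exists>l. (f \<longlongrightarrow> l) (at_left t)"
  shows "\<exists>T. finite T \<and> (\<forall>s\<in>{0..b}. \<forall>t\<in>{0..b}. s \<le> t \<longrightarrow> T \<inter> {s<..t} = {} \<longrightarrow> \<bar>f s - f t\<bar> < e)"
proof -
  define Q where "Q u v T \<longleftrightarrow> (\<forall>s\<in>{u..v}. \<forall>t\<in>{u..v}. s \<le> t \<longrightarrow> T \<inter> {s<..t} = {} \<longrightarrow> \<bar>f s - f t\<bar> < e)"
    for u v and T :: "real set"
  \<comment> \<open>The guard \<open>0 \<le> u\<close> answers to the bisection principle
    \<open>Bolzano\<close>, whose local hypothesis also ranges over intervals that stick out to the
    left of 0, where nothing is known about \<open>f\<close>.\<close>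
  define P where "P u v \<longleftrightarrow> (0 \<le> u \<longrightarrow> (\<exists>T. finite T \<and> Q u v T))" for u v
  have trans: "P u w" if uvw: "P u v" "P v w" "u \<le> v" "v \<le> w" for u v w
  proof -
    show ?thesis
      unfolding P_def
    proof
      assume "0 \<le> u"
      then obtain T1 T2 where T: "finite T1" "Q u v T1" "finite T2" "Q v w T2"
        using uvw unfolding P_def by auto
      \<comment> \<open>Adding \<open>v\<close> excludes pairs that straddle it: if \<open>t\<close>
        lies beyond \<open>v\<close> and \<open>v\<close> is not in \<open>{s<..t}\<close>, then
        \<open>s\<close> is already at or beyond \<open>v\<close>.\<close>
      have "Q u w (insert v (T1 \<union> T2))"
        unfolding Q_def
      proof (intro ballI impI)
        fix s t assume st: "s \<in> {u..w}" "t \<in> {u..w}" "s \<le> t"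
          and no: "insert v (T1 \<union> T2) \<inter> {s<..t} = {}"
        show "\<bar>f s - f t\<bar> < e"
        proof (cases "t \<le> v")
          case True
          then have "s \<in> {u..v}" "t \<in> {u..v}" "T1 \<inter> {s<..t} = {}" using st no by auto
          then show ?thesis using T(2) st(3) unfolding Q_def by blast
        next
          case False
          then have "v \<le> s" using no by auto
          then have "s \<in> {v..w}" "t \<in> {v..w}" "T2 \<inter> {s<..t} = {}" using st no by auto
          then show ?thesis using T(4) st(3) unfolding Q_def by blast
        qed
      qed
      moreover have "finite (insert v (T1 \<union> T2))" using T by simp
      ultimately show "\<exists>T. finite T \<and> Q u w T" by (intro exI conjI)
    qed
  qed
  have loc: "\<exists>d>0. \<forall>u v. u \<le> x \<and> x \<le> v \<and> v - u < d \<longrightarrow> P u v" if "0 \<le> x" "x \<le> b" for x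
  proof -
    have "eventually (\<lambda>s. dist (f s) (f x) < e/2) (at_right x)"
      by (rule tendstoD[OF right[OF \<open>0 \<le> x\<close>]]) (use e in simp)
    then have "\<exists>c>x. \<forall>s>x. s < c \<longrightarrow> dist (f s) (f x) < e/2"
      unfolding eventually_at_right_field .
    then obtain c where c: "c > x" "\<And>s. x < s \<Longrightarrow> s < c \<Longrightarrow> dist (f s) (f x) < e/2"
      by blast
    have "\<exists>a<x. \<exists>l. \<forall>s. 0 \<le> s \<longrightarrow> a < s \<longrightarrow> s < x \<longrightarrow> dist (f s) l < e/2"
    proof (cases "x = 0")
      case True
      then show ?thesis by (intro exI[of _ "-1"]) auto
    next
      case False
      then obtain l where "(f \<longlongrightarrow> l) (at_left x)" using left[of x] \<open>0 \<le> x\<close> by auto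
      then have "eventually (\<lambda>s. dist (f s) l < e/2) (at_left x)"
        by (rule tendstoD) (use e in simp)
      then have "\<exists>a<x. \<forall>s>a. s < x \<longrightarrow> dist (f s) l < e/2"
        unfolding eventually_at_left_field .
      then show ?thesis by blast
    qed
    then obtain a l where a: "a < x" "\<And>s. 0 \<le> s \<Longrightarrow> a < s \<Longrightarrow> s < x \<Longrightarrow> dist (f s) l < e/2" by blast
    show ?thesis
    proof (intro exI[of _ "min (c - x) (x - a)"] conjI allI impI)
      show "0 < min (c - x) (x - a)" using a c by simp
      fix u v assume uv: "u \<le> x \<and> x \<le> v \<and> v - u < min (c - x) (x - a)"
      show "P u v"
        unfolding P_def
      proof
        assume u: "0 \<le> u"
        \<comment> \<open>One point suffices locally. As the interval is open at \<open>s\<close>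
          and closed at \<open>t\<close>, either both times precede \<open>x\<close> and both values
          are near \<open>l\<close>, or both are at least \<open>x\<close> and both values are near
          \<open>f x\<close>.\<close>
        have "Q u v {x}"
          unfolding Q_def
        proof (intro ballI impI)
          fix s t assume st: "s \<in> {u..v}" "t \<in> {u..v}" "s \<le> t" "{x} \<inter> {s<..t} = {}"
          consider "t < x" | "x \<le> s" using st by force
          then show "\<bar>f s - f t\<bar> < e"
          proof cases
            case 1
            then have "dist (f s) l < e/2" "dist (f t) l < e/2"
              using a(2) st uv u by auto
            then show ?thesis unfolding dist_real_def by argo
          next
            case 2
            have "dist (f r) (f x) < e/2" if "x \<le> r" "r \<le> v" for r
              using c(2)[of r] that uv e by (cases "r = x") auto
            from this[of s] this[of t] have "dist (f s) (f x) < e/2" "dist (f t) (f x) < e/2"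
              using st 2 by auto
            then show ?thesis unfolding dist_real_def by argo
          qed
        qed
        then show "\<exists>T. finite T \<and> Q u v T" by blast
      qed
    qed
  qed
  have "P 0 b" by (rule Bolzano[OF \<open>0 \<le> b\<close> trans loc])
  then show ?thesis by (simp add: P_def Q_def)
qed

lemma skorokhod_space_partition:
  assumes fin: "finite I" and x: "x \<in> skorokhod_space I" and e: "0 < e"
  obtains T where "finite T" "T \<subseteq> {0..real m}" "0 \<in> T" "real m \<in> T"
    "\<And>i s t. i \<in> I \<Longrightarrow> s \<in> {0..real m} \<Longrightarrow> t \<in> {0..real m} \<Longrightarrow> s \<le> t \<Longrightarrow> T \<inter> {s<..t} = {} \<Longrightarrow>
      \<bar>x s i - x t i\<bar> < e"
proof -
  have "\<forall>i\<in>I. \<exists>T. finite T \<and>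
      (\<forall>s\<in>{0..real m}. \<forall>t\<in>{0..real m}. s \<le> t \<longrightarrow> T \<inter> {s<..t} = {} \<longrightarrow> \<bar>x s i - x t i\<bar> < e)"
    using x e by (intro ballI right_limits_partition) (auto simp: skorokhod_space_def)
  from bchoice[OF this] obtain T where T: "\<forall>i\<in>I. finite (T i) \<and>
      (\<forall>s\<in>{0..real m}. \<forall>t\<in>{0..real m}. s \<le> t \<longrightarrow> T i \<inter> {s<..t} = {} \<longrightarrow> \<bar>x s i - x t i\<bar> < e)" ..
  \<comment> \<open>The end points are included because the time change attached to the partition
    has to fix 0 and \<open>m\<close>.\<close>
  define U where "U = insert 0 (insert (real m) ((\<Union>i\<in>I. T i) \<inter> {0..real m}))"
  show ?thesis
  proof (rule that[of U])
    fix i s t assume *: "i \<in> I" "s \<in> {0..real m}" "t \<in> {0..real m}" "s \<le> t" "U \<inter> {s<..t} = {}"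
    have "T i \<inter> {s<..t} \<subseteq> U \<inter> {s<..t}" using * unfolding U_def by auto
    then show "\<bar>x s i - x t i\<bar> < e" using T * by auto
  qed (use fin T in \<open>auto simp: U_def\<close>)
qed

text \<open>Linear interpolation of \<phi> between neighbours would need \<open>T\<close> to be
  listed in order. Instead, a tent of height \<open>\<phi> \<tau> - \<tau>\<close> and half-width
  \<open>w\<close> over each point \<tau> of \<open>T\<close> is added to the identity. By
  separation each point of \<open>T\<close> sees only its own tent, so \<phi> is met exactly; the
  sum of the tents has slope at most \<open>card T * \<eta> / w < 1\<close>, which keeps the result
  strictly increasing.\<close>

lemma tent_sum_time_change:
  fixes \<phi> :: "real \<Rightarrow> real"
  assumes fin: "finite T" and T: "T \<subseteq> {0..real m}" and 0: "0 \<in> T" "real m \<in> T"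
    and \<phi>0: "\<phi> 0 = 0" "\<phi> (real m) = real m" and \<eta>: "\<And>\<tau>. \<tau> \<in> T \<Longrightarrow> \<bar>\<phi> \<tau> - \<tau>\<bar> \<le> \<eta>"
    and w: "0 < w" and sep: "\<And>\<sigma> \<tau>. \<sigma> \<in> T \<Longrightarrow> \<tau> \<in> T \<Longrightarrow> \<sigma> \<noteq> \<tau> \<Longrightarrow> w \<le> \<bar>\<sigma> - \<tau>\<bar>"
    and small: "real (card T) * \<eta> < w"
  obtains \<kappa> where "\<kappa> \<in> time_changes m" "\<And>\<tau>. \<tau> \<in> T \<Longrightarrow> \<kappa> \<tau> = \<phi> \<tau>"
    "\<And>t. \<bar>\<kappa> t - t\<bar> \<le> real (card T) * \<eta>"
proof -
  define b where "b \<tau> t = max 0 (1 - \<bar>t - \<tau>\<bar> / w)" for \<tau> t :: real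
  define \<rho> where "\<rho> t = (\<Sum>\<tau>\<in>T. (\<phi> \<tau> - \<tau>) * b \<tau> t)" for t
  define \<kappa> where "\<kappa> t = t + \<rho> t" for t
  have b: "0 \<le> b \<tau> t" "b \<tau> t \<le> 1" for \<tau> t using w by (auto simp: b_def)
  have bL: "\<bar>b \<tau> s - b \<tau> t\<bar> \<le> \<bar>s - t\<bar> / w" for \<tau> s t
  proof -
    have "\<bar>\<bar>s - \<tau>\<bar> / w - \<bar>t - \<tau>\<bar> / w\<bar> = \<bar>\<bar>s - \<tau>\<bar> - \<bar>t - \<tau>\<bar>\<bar> / w"
      using w by (simp add: diff_divide_distrib[symmetric])
    also have "\<dots> \<le> \<bar>s - t\<bar> / w" using w by (intro divide_right_mono) auto
    finally show ?thesis unfolding b_def by linarith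
  qed
  have \<eta>0: "0 \<le> \<eta>" using \<eta>[OF 0(1)] by linarith
  have \<rho>: "\<bar>\<rho> t\<bar> \<le> real (card T) * \<eta>" for t
  proof -
    have "\<bar>\<rho> t\<bar> \<le> (\<Sum>\<tau>\<in>T. \<bar>(\<phi> \<tau> - \<tau>) * b \<tau> t\<bar>)" unfolding \<rho>_def by (rule sum_abs)
    also have "\<dots> \<le> (\<Sum>\<tau>\<in>T. \<eta> * 1)"
      unfolding abs_mult using \<eta> b \<eta>0 by (intro sum_mono mult_mono) auto
    finally show ?thesis by simp
  qed
  have \<rho>L: "\<bar>\<rho> s - \<rho> t\<bar> < \<bar>s - t\<bar>" if "s \<noteq> t" for s t
  proof -
    have "\<rho> s - \<rho> t = (\<Sum>\<tau>\<in>T. (\<phi> \<tau> - \<tau>) * (b \<tau> s - b \<tau> t))"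
      by (simp add: \<rho>_def sum_subtractf[symmetric] right_diff_distrib)
    also have "\<bar>\<dots>\<bar> \<le> (\<Sum>\<tau>\<in>T. \<bar>(\<phi> \<tau> - \<tau>) * (b \<tau> s - b \<tau> t)\<bar>)" by (rule sum_abs)
    also have "\<dots> \<le> (\<Sum>\<tau>\<in>T. \<eta> * (\<bar>s - t\<bar> / w))"
      unfolding abs_mult using \<eta> bL \<eta>0 by (intro sum_mono mult_mono) auto
    also have "\<dots> = (real (card T) * \<eta>) / w * \<bar>s - t\<bar>" by simp
    also have "\<dots> < 1 * \<bar>s - t\<bar>"
      using small w that by (intro mult_strict_right_mono) auto
    finally show ?thesis by simp
  qed
  have fix_T: "\<kappa> \<tau> = \<phi> \<tau>" if \<tau>: "\<tau> \<in> T" for \<tau>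
  proof -
    have "\<rho> \<tau> = (\<Sum>\<sigma>\<in>T. if \<sigma> = \<tau> then \<phi> \<tau> - \<tau> else 0)"
      unfolding \<rho>_def
    proof (rule sum.cong[OF refl])
      fix \<sigma> assume "\<sigma> \<in> T"
      then show "(\<phi> \<sigma> - \<sigma>) * b \<sigma> \<tau> = (if \<sigma> = \<tau> then \<phi> \<tau> - \<tau> else 0)"
        using sep[of \<sigma> \<tau>] \<tau> w by (auto simp: b_def abs_minus_commute)
    qed
    also have "\<dots> = \<phi> \<tau> - \<tau>" using fin \<tau> by simp
    finally show ?thesis by (simp add: \<kappa>_def)
  qed
  have mono: "\<kappa> s < \<kappa> t" if "s < t" for s t
    using \<rho>L[of s t] that unfolding \<kappa>_def by linarith
  have cont: "continuous_on {0..real m} \<kappa>"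
    unfolding \<kappa>_def \<rho>_def b_def using w by (intro continuous_intros) auto
  have ends: "\<kappa> 0 = 0" "\<kappa> (real m) = real m" using fix_T 0 \<phi>0 by auto
  have "\<kappa> ` {0..real m} = {0..real m}"
  proof
    show "\<kappa> ` {0..real m} \<subseteq> {0..real m}"
    proof safe
      fix t assume t: "t \<in> {0..real m}"
      have "0 \<le> \<kappa> t" using mono[of 0 t] ends t by (cases "t = 0") auto
      moreover have "\<kappa> t \<le> real m" using mono[of t "real m"] ends t by (cases "t = real m") auto
      ultimately show "\<kappa> t \<in> {0..real m}" by simp
    qed
    show "{0..real m} \<subseteq> \<kappa> ` {0..real m}"
    proof
      fix y assume y: "y \<in> {0..real m}"
      then obtain t where "0 \<le> t" "t \<le> real m" "\<kappa> t = y"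
        using IVT'[of \<kappa> 0 y "real m"] ends cont by auto
      then show "y \<in> \<kappa> ` {0..real m}" by auto
    qed
  qed
  then have "\<kappa> \<in> time_changes m" using mono by (auto simp: time_changes_def strict_mono_on_def)
  moreover have "\<bar>\<kappa> t - t\<bar> \<le> real (card T) * \<eta>" for t using \<rho>[of t] by (simp add: \<kappa>_def)
  ultimately show ?thesis using that fix_T by blast
qed

section \<open>Convergence in the Skorokhod metric, one time horizon at a time\<close>

lemma cutoff_lipschitz: "\<bar>cutoff m s - cutoff m t\<bar> \<le> \<bar>s - t\<bar>"
  by (auto simp: cutoff_def max_def min_def)

lemma topspace_skorokhod [simp]:
  assumes "finite I"
  shows "topspace (skorokhod_topology I) = skorokhod_space I"
  using Metric_space.topspace_mtopology[OF Metric_space_skorokhod[OF assms]]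
  by (simp add: skorokhod_topology_def)

lemma skorokhod_dist_upto_commute:
  assumes "x \<in> skorokhod_space I" and "y \<in> skorokhod_space I"
  shows "skorokhod_dist_upto I m x y = skorokhod_dist_upto I m y x"
  using skorokhod_dist_upto_sym_le[OF assms, of m] skorokhod_dist_upto_sym_le[OF assms(2,1), of m]
  by (rule order_antisym[rotated])

lemma skorokhod_dist_upto_le_dist:
  assumes "x \<in> skorokhod_space I" and "y \<in> skorokhod_space I"
  shows "(1/2) ^ Suc n * min 1 (skorokhod_dist_upto I (Suc n) x y) \<le> skorokhod_dist I x y"
proof -
  have half: "summable (\<lambda>n. (1/2::real) ^ Suc n)"
    by (subst summable_Suc_iff) (rule summable_geometric, simp)
  have "summable (\<lambda>n. (1/2) ^ Suc n * min 1 (skorokhod_dist_upto I (Suc n) x y))"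
  proof (rule summable_comparison_test[OF _ half], intro exI[of _ 0] allI impI)
    fix n
    have "(1/2::real) ^ Suc n * min 1 (skorokhod_dist_upto I (Suc n) x y) \<le> (1/2) ^ Suc n * 1"
      by (intro mult_left_mono) auto
    then show "norm ((1/2::real) ^ Suc n * min 1 (skorokhod_dist_upto I (Suc n) x y)) \<le> (1/2) ^ Suc n"
      using skorokhod_dist_upto_nonneg[of I "Suc n" x y] by (simp add: abs_mult)
  qed
  from sum_le_suminf[OF this, of "{n}"] show ?thesis
    using assms skorokhod_dist_upto_nonneg[of I _ x y]
    by (simp add: skorokhod_dist_def)
qed

text \<open>Each term of the series is bounded by the whole distance; conversely the weights
  \<open>(1/2) ^ Suc m\<close> dominate the terms, so Tannery's theorem exchanges the limit with the
  series.\<close>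

lemma limitin_skorokhod_iff:
  assumes fin: "finite I" and x: "x \<in> skorokhod_space I" and xn: "\<And>n. xn n \<in> skorokhod_space I"
  shows "limitin (skorokhod_topology I) xn x sequentially \<longleftrightarrow>
    (\<forall>m. (\<lambda>n. skorokhod_dist_upto I (Suc m) (xn n) x) \<longlonglongrightarrow> 0)"
proof -
  interpret Metric_space "skorokhod_space I" "skorokhod_dist I"
    by (rule Metric_space_skorokhod[OF fin])
  define T where "T m n = (1/2::real) ^ Suc m * min 1 (skorokhod_dist_upto I (Suc m) (xn n) x)" for m n
  have T0: "0 \<le> T m n" for m n
    unfolding T_def using skorokhod_dist_upto_nonneg[of I "Suc m" "xn n" x] by auto
  have "limitin (skorokhod_topology I) xn x sequentially \<longleftrightarrow> (\<lambda>n. skorokhod_dist I (xn n) x) \<longlonglongrightarrow> 0"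
    using x xn by (simp add: skorokhod_topology_def limitin_metric_dist_null)
  also have "\<dots> \<longleftrightarrow> (\<forall>m. (\<lambda>n. skorokhod_dist_upto I (Suc m) (xn n) x) \<longlonglongrightarrow> 0)"
  proof safe
    fix m assume lim: "(\<lambda>n. skorokhod_dist I (xn n) x) \<longlonglongrightarrow> 0"
    have "T m n \<le> skorokhod_dist I (xn n) x" for n
      unfolding T_def by (rule skorokhod_dist_upto_le_dist[OF xn x])
    then have "T m \<longlonglongrightarrow> 0"
      by (intro tendsto_sandwich[OF always_eventually always_eventually tendsto_const lim])
        (use T0 in auto)
    then have "(\<lambda>n. 2 ^ Suc m * T m n) \<longlonglongrightarrow> 0" by (rule tendsto_mult_right_zero)
    then have *: "(\<lambda>n. min 1 (skorokhod_dist_upto I (Suc m) (xn n) x)) \<longlonglongrightarrow> 0"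
      by (simp add: T_def power_one_over)
    \<comment> \<open>Once the capped distance is below 1 the cap is inactive, so it agrees with the
      distance itself.\<close>
    then have "eventually (\<lambda>n. min 1 (skorokhod_dist_upto I (Suc m) (xn n) x) < 1) sequentially"
      by (rule order_tendstoD) simp
    then show "(\<lambda>n. skorokhod_dist_upto I (Suc m) (xn n) x) \<longlonglongrightarrow> 0"
      by (intro Lim_transform_eventually[OF *]) (auto elim!: eventually_mono)
  next
    assume lim: "\<forall>m. (\<lambda>n. skorokhod_dist_upto I (Suc m) (xn n) x) \<longlonglongrightarrow> 0"
    have "T m \<longlonglongrightarrow> (1/2) ^ Suc m * min 1 0" for m
      unfolding T_def using lim by (intro tendsto_mult tendsto_min tendsto_const) auto
    then have T: "T m \<longlonglongrightarrow> 0" for m by simp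
    have "norm (T m n) \<le> (1/2) ^ Suc m" for m n
    proof -
      have "T m n \<le> (1/2) ^ Suc m * 1" unfolding T_def by (intro mult_left_mono) auto
      then show ?thesis using T0[of m n] by simp
    qed
    moreover have "summable (\<lambda>n. (1/2::real) ^ Suc n)"
      by (subst summable_Suc_iff) (rule summable_geometric, simp)
    ultimately have "(\<lambda>n. suminf (\<lambda>m. T m n)) \<longlonglongrightarrow> suminf (\<lambda>m. 0)"
      using T
      by (intro conjunct2[OF conjunct2[OF tannerys_theorem[where M = "\<lambda>m. (1/2) ^ Suc m"]]]
        always_eventually) auto
    moreover have "skorokhod_dist I (xn n) x = suminf (\<lambda>m. T m n)" for n
      using x xn by (simp add: skorokhod_dist_def T_def)
    ultimately show "(\<lambda>n. skorokhod_dist I (xn n) x) \<longlonglongrightarrow> 0" by simp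
  qed
  finally show ?thesis .
qed

lemma sequentially_continuous_imp_continuous_map:
  assumes M: "Metric_space M d" and f: "f \<in> M \<rightarrow> topspace Y"
    and seq: "\<And>\<sigma> l. range \<sigma> \<subseteq> M \<Longrightarrow> limitin (Metric_space.mtopology M d) \<sigma> l sequentially \<Longrightarrow>
      limitin Y (\<lambda>n. f (\<sigma> n)) (f l) sequentially"
  shows "continuous_map (Metric_space.mtopology M d) Y f"
proof -
  interpret Metric_space M d by (rule M)
  show ?thesis
    unfolding continuous_map_closedin
  proof (intro conjI allI impI ballI)
    show "f \<in> topspace mtopology \<rightarrow> topspace Y" using f by simp
    fix C assume C: "closedin Y C"
    show "closedin mtopology {x \<in> topspace mtopology. f x \<in> C}"
      unfolding metric_closedin_iff_sequentially_closed
    proof (intro conjI allI impI)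
      fix \<sigma> l assume *: "range \<sigma> \<subseteq> {x \<in> topspace mtopology. f x \<in> C} \<and> limitin mtopology \<sigma> l sequentially"
      then have "limitin Y (\<lambda>n. f (\<sigma> n)) (f l) sequentially" by (intro seq) auto
      then have "f l \<in> C"
        by (rule limitin_closedin[OF _ C always_eventually]) (use * in auto)
      then show "l \<in> {x \<in> topspace mtopology. f x \<in> C}" using * limitin_mspace by auto
    qed auto
  qed
qed

section \<open>Discretised paths\<close>

lemma eventually_floor_at_right:
  fixes c t :: real
  assumes "0 < c"
  shows "eventually (\<lambda>s. \<lfloor>c * s\<rfloor> = \<lfloor>c * t\<rfloor>) (at_right t)"
  unfolding eventually_at_right_field
proof (intro exI[of _ "(of_int \<lfloor>c * t\<rfloor> + 1) / c"] conjI allI impI)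
  show "t < (of_int \<lfloor>c * t\<rfloor> + 1) / c"
    using assms by (simp add: pos_less_divide_eq mult.commute)
  fix s assume s: "t < s" "s < (of_int \<lfloor>c * t\<rfloor> + 1) / c"
  have "c * t < c * s" using s assms by simp
  moreover have "c * s < of_int \<lfloor>c * t\<rfloor> + 1"
    using s assms by (simp add: pos_less_divide_eq mult.commute)
  ultimately show "\<lfloor>c * s\<rfloor> = \<lfloor>c * t\<rfloor>" by linarith
qed

text \<open>The value \<open>\<lceil>c * t\<rceil> - 1\<close> differs from
  \<open>\<lfloor>c * t\<rfloor>\<close> exactly when \<open>c * t\<close> is an integer, which is
  where the floor jumps.\<close>

lemma eventually_floor_at_left:
  fixes c t :: real
  assumes "0 < c"
  shows "eventually (\<lambda>s. \<lfloor>c * s\<rfloor> = \<lceil>c * t\<rceil> - 1) (at_left t)"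
  unfolding eventually_at_left_field
proof (intro exI[of _ "(of_int \<lceil>c * t\<rceil> - 1) / c"] conjI allI impI)
  have "of_int \<lceil>c * t\<rceil> - 1 < t * c" by (simp add: mult.commute) linarith
  then show "(of_int \<lceil>c * t\<rceil> - 1) / c < t"
    using assms by (simp add: pos_divide_less_eq)
  fix s assume s: "s < t" "(of_int \<lceil>c * t\<rceil> - 1) / c < s"
  have "c * s < c * t" using s assms by simp
  moreover have "of_int \<lceil>c * t\<rceil> - 1 < c * s"
    using s assms by (simp add: pos_divide_less_eq mult.commute)
  ultimately show "\<lfloor>c * s\<rfloor> = \<lceil>c * t\<rceil> - 1" by linarith
qed

text \<open>The truncation of the index makes the path depend on finitely many entries of \<open>a\<close>.\<close>

definition step_path :: "'i set \<Rightarrow> nat \<Rightarrow> (nat \<times> 'i \<Rightarrow> real) \<Rightarrow> real \<Rightarrow> 'i \<Rightarrow> real" where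
  "step_path I k a = (\<lambda>t\<in>{0..}. \<lambda>i\<in>I. a (min (nat \<lfloor>real k * t\<rfloor>) (k * k), i))"

lemma step_path_in_skorokhod_space:
  assumes k: "0 < k"
  shows "step_path I k a \<in> skorokhod_space I"
proof -
  have "((\<lambda>s. step_path I k a s i) \<longlongrightarrow> step_path I k a t i) (at_right t)"
    if i: "i \<in> I" and t: "0 \<le> t" for i t
  proof (rule tendsto_eventually)
    have "eventually (\<lambda>s. t < s) (at_right t)" by (simp add: eventually_at_filter)
    moreover have "eventually (\<lambda>s. \<lfloor>real k * s\<rfloor> = \<lfloor>real k * t\<rfloor>) (at_right t)"
      using k by (intro eventually_floor_at_right) simp
    ultimately show "eventually (\<lambda>s. step_path I k a s i = step_path I k a t i) (at_right t)"
      by eventually_elim (use t in \<open>simp add: step_path_def\<close>)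
  qed
  moreover have "\<exists>l. ((\<lambda>s. step_path I k a s i) \<longlongrightarrow> l) (at_left t)"
    if i: "i \<in> I" and t: "0 < t" for i t
  proof (intro exI tendsto_eventually)
    have "eventually (\<lambda>s. 0 < s) (at_left t)"
      using t by (auto simp: eventually_at_left_field)
    moreover have "eventually (\<lambda>s. \<lfloor>real k * s\<rfloor> = \<lceil>real k * t\<rceil> - 1) (at_left t)"
      using k by (intro eventually_floor_at_left) simp
    ultimately show
      "eventually (\<lambda>s. step_path I k a s i = a (min (nat (\<lceil>real k * t\<rceil> - 1)) (k * k), i)) (at_left t)"
      by eventually_elim (use i in \<open>simp add: step_path_def\<close>)
  qed
  ultimately show ?thesis by (auto simp: skorokhod_space_def step_path_def)
qed

text \<open>All these paths jump on the same grid, so the identity serves as time change, and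
  convergence of finitely many entries is uniform convergence of the paths.\<close>

lemma step_path_limitin:
  assumes fin: "finite I" and k: "0 < k"
    and lim: "\<And>j i. j \<le> k * k \<Longrightarrow> i \<in> I \<Longrightarrow> (\<lambda>n. a n (j, i)) \<longlonglongrightarrow> b (j, i)"
  shows "limitin (skorokhod_topology I) (\<lambda>n. step_path I k (a n)) (step_path I k b) sequentially"
proof -
  define D where "D n = (\<Sum>i\<in>I. \<Sum>j\<le>k * k. \<bar>a n (j, i) - b (j, i)\<bar>)" for n
  have "D \<longlonglongrightarrow> (\<Sum>i\<in>I. \<Sum>j\<le>k * k. \<bar>b (j, i) - b (j, i)\<bar>)"
    unfolding D_def using lim by (intro tendsto_intros) auto
  then have D: "D \<longlonglongrightarrow> 0" by simp
  have le: "skorokhod_dist_upto I m (step_path I k (a n)) (step_path I k b) \<le> D n" for m n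
  proof (rule skorokhod_dist_upto_leI[OF id_time_change])
    have D0: "0 \<le> D n" unfolding D_def by (intro sum_nonneg) auto
    fix t assume t: "t \<in> {0..real m}"
    show "\<bar>t - t\<bar> \<le> D n" using D0 by simp
    have "L2_set (\<lambda>i. cutoff m t * step_path I k (a n) t i - cutoff m t * step_path I k b t i) I
        \<le> (\<Sum>i\<in>I. \<bar>cutoff m t * step_path I k (a n) t i - cutoff m t * step_path I k b t i\<bar>)"
      by (rule L2_set_le_sum_abs)
    also have "\<dots> \<le> D n"
      unfolding D_def
    proof (rule sum_mono)
      fix i assume i: "i \<in> I"
      define j where "j = min (nat \<lfloor>real k * t\<rfloor>) (k * k)"
      have "\<bar>cutoff m t * step_path I k (a n) t i - cutoff m t * step_path I k b t i\<bar>
          = cutoff m t * \<bar>a n (j, i) - b (j, i)\<bar>"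
        using t i cutoff_bounds(1)[of m t]
        by (simp add: step_path_def j_def right_diff_distrib[symmetric] abs_mult)
      also have "\<dots> \<le> 1 * \<bar>a n (j, i) - b (j, i)\<bar>"
        using cutoff_bounds by (intro mult_right_mono) auto
      also have "\<dots> \<le> (\<Sum>j\<le>k * k. \<bar>a n (j, i) - b (j, i)\<bar>)"
        using member_le_sum[of j "{..k * k}" "\<lambda>j. \<bar>a n (j, i) - b (j, i)\<bar>"]
        by (simp add: j_def)
      finally show "\<bar>cutoff m t * step_path I k (a n) t i - cutoff m t * step_path I k b t i\<bar>
          \<le> (\<Sum>j\<le>k * k. \<bar>a n (j, i) - b (j, i)\<bar>)" .
    qed
    finally show "L2_set (\<lambda>i. cutoff m t * step_path I k (a n) t i
        - cutoff m t * step_path I k b t i) I \<le> D n" .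
  qed
  have "(\<lambda>n. skorokhod_dist_upto I (Suc m) (step_path I k (a n)) (step_path I k b)) \<longlonglongrightarrow> 0" for m
    by (rule tendsto_sandwich[OF always_eventually always_eventually tendsto_const D])
      (auto simp: skorokhod_dist_upto_nonneg le)
  then show ?thesis
    by (subst limitin_skorokhod_iff[OF fin]) (auto simp: step_path_in_skorokhod_space k)
qed

lemma finite_real_set_separated:
  fixes T :: "real set"
  assumes "finite T"
  obtains w where "0 < w" "\<And>\<sigma> \<tau>. \<sigma> \<in> T \<Longrightarrow> \<tau> \<in> T \<Longrightarrow> \<sigma> \<noteq> \<tau> \<Longrightarrow> w \<le> \<bar>\<sigma> - \<tau>\<bar>"
proof -
  \<comment> \<open>The 1 keeps \<open>W\<close> nonempty when \<open>T\<close> has at most one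
    point.\<close>
  define W where "W = insert 1 ((\<lambda>(\<sigma>, \<tau>). \<bar>\<sigma> - \<tau>\<bar>) ` (T \<times> T - Id))"
  have W: "finite W" "W \<noteq> {}" "\<And>w. w \<in> W \<Longrightarrow> 0 < w" using assms by (auto simp: W_def)
  show ?thesis
  proof (rule that[of "Min W"])
    show "0 < Min W" using W by simp
    fix \<sigma> \<tau> assume "\<sigma> \<in> T" "\<tau> \<in> T" "\<sigma> \<noteq> \<tau>"
    then have "\<bar>\<sigma> - \<tau>\<bar> \<in> W" unfolding W_def by (intro insertI2 image_eqI[of _ _ "(\<sigma>, \<tau>)"]) auto
    then show "Min W \<le> \<bar>\<sigma> - \<tau>\<bar>" using W by simp
  qed
qed

text \<open>The time change moves each point \<open>\<tau>\<close> of a partition adapted to \<open>x\<close> to the next grid point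
  \<open>\<lceil>k \<tau>\<rceil> / k\<close>, where the discretised path jumps.\<close>

lemma discretisation_dist_upto_le:
  assumes fin: "finite I" and x: "x \<in> skorokhod_space I" and e: "0 < e"
  shows "eventually (\<lambda>k. skorokhod_dist_upto I m x (step_path I k (\<lambda>(j, i). x (real j / real k) i)) \<le> e)
    sequentially"
proof -
  have "\<forall>i\<in>I. \<exists>K. \<forall>t\<in>{0..real m}. \<bar>x t i\<bar> \<le> K"
    using skorokhod_space_bounded[OF x] by blast
  from bchoice[OF this] obtain K0 where K0: "\<forall>i\<in>I. \<forall>t\<in>{0..real m}. \<bar>x t i\<bar> \<le> K0 i" ..
  define K where "K = (\<Sum>i\<in>I. \<bar>K0 i\<bar>)"
  have K: "\<bar>x t i\<bar> \<le> K" if "i \<in> I" "t \<in> {0..real m}" for i t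
  proof -
    have "\<bar>x t i\<bar> \<le> \<bar>K0 i\<bar>" using K0 that by force
    also have "\<dots> \<le> K" unfolding K_def using that fin by (intro member_le_sum) auto
    finally show ?thesis .
  qed
  have K_nonneg: "0 \<le> K" unfolding K_def by (intro sum_nonneg) auto
  \<comment> \<open>The tolerance is shared among the coordinates, since the Euclidean norm is
    estimated by the sum of absolute values; the \<open>+ 1\<close> covers an empty
    \<open>I\<close>.\<close>
  define e1 where "e1 = e / (real (card I) + 1)"
  have e1: "0 < e1" using e by (simp add: e1_def)
  have cardI: "real (card I) * e1 \<le> e" using e by (simp add: e1_def field_simps)
  obtain T where T: "finite T" "T \<subseteq> {0..real m}" "0 \<in> T" "real m \<in> T"
    and osc: "\<And>i s t. i \<in> I \<Longrightarrow> s \<in> {0..real m} \<Longrightarrow> t \<in> {0..real m} \<Longrightarrow> s \<le> t \<Longrightarrow> T \<inter> {s<..t} = {} \<Longrightarrow>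
      \<bar>x s i - x t i\<bar> < e1 / 2"
    using skorokhod_space_partition[OF fin x, of "e1/2" m] e1 by auto
  obtain w where w: "0 < w" "\<And>\<sigma> \<tau>. \<sigma> \<in> T \<Longrightarrow> \<tau> \<in> T \<Longrightarrow> \<sigma> \<noteq> \<tau> \<Longrightarrow> w \<le> \<bar>\<sigma> - \<tau>\<bar>"
    using finite_real_set_separated[OF T(1)] by blast
  have lim: "(\<lambda>k. c * (1 / real k)) \<longlonglongrightarrow> 0" for c
    by (rule tendsto_mult_right_zero[OF lim_1_over_n])
  \<comment> \<open>In turn: the tents of the time change stay less steep than the identity, the
    displacement of time is below \<open>e\<close>, and the resulting change of the cutoff costs at
    most \<open>e1 / 2\<close> on a path bounded by \<open>K\<close>.\<close>
  have "eventually (\<lambda>k. real (card T) * (1 / real k) < w) sequentially"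
    "eventually (\<lambda>k. real (card T) * (1 / real k) < e) sequentially"
    "eventually (\<lambda>k. K * real (card T) * (1 / real k) < e1 / 2) sequentially"
    by (rule order_tendstoD(2)[OF lim]; use w(1) e e1 in simp)+
  moreover have "eventually (\<lambda>k. max m 1 \<le> k) sequentially" by (rule eventually_ge_at_top)
  ultimately show ?thesis
  proof eventually_elim
    case (elim k)
    then have k: "0 < real k" "real m \<le> real k" "m \<le> k" by auto
    define \<phi> where "\<phi> \<tau> = of_int \<lceil>real k * \<tau>\<rceil> / real k" for \<tau>
    have \<phi>: "\<tau> \<le> \<phi> \<tau>" "\<phi> \<tau> < \<tau> + 1 / real k" for \<tau>
    proof -
      have "real k * \<tau> \<le> of_int \<lceil>real k * \<tau>\<rceil>" "of_int \<lceil>real k * \<tau>\<rceil> < real k * \<tau> + 1" by linarith+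
      then show "\<tau> \<le> \<phi> \<tau>" "\<phi> \<tau> < \<tau> + 1 / real k" using k by (auto simp: \<phi>_def field_simps)
    qed
    have "\<phi> (real m) = real m"
    proof -
      have "\<lceil>real k * real m\<rceil> = int (k * m)" by (metis ceiling_of_nat of_nat_mult)
      then show ?thesis using k by (simp add: \<phi>_def)
    qed
    moreover have "\<phi> 0 = 0" by (simp add: \<phi>_def)
    moreover have "\<bar>\<phi> \<tau> - \<tau>\<bar> \<le> 1 / real k" for \<tau> using \<phi>[of \<tau>] by linarith
    ultimately obtain \<kappa> where \<kappa>: "\<kappa> \<in> time_changes m" "\<And>\<tau>. \<tau> \<in> T \<Longrightarrow> \<kappa> \<tau> = \<phi> \<tau>"
      "\<And>t. \<bar>\<kappa> t - t\<bar> \<le> real (card T) * (1 / real k)"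
      using tent_sum_time_change[of T m \<phi> "1 / real k" w] T w elim by blast
    have mono: "\<kappa> s < \<kappa> t" if "s \<in> {0..real m}" "t \<in> {0..real m}" "s < t" for s t
      using \<kappa>(1) that by (auto simp: time_changes_def strict_mono_on_def)
    show ?case
    proof (rule skorokhod_dist_upto_leI[OF \<kappa>(1)])
      fix t assume t: "t \<in> {0..real m}"
      show "\<bar>\<kappa> t - t\<bar> \<le> e" using \<kappa>(3)[of t] elim by linarith
      have \<kappa>t: "\<kappa> t \<in> {0..real m}" using \<kappa>(1) t by (auto simp: time_changes_def)
      define J where "J = \<lfloor>real k * \<kappa> t\<rfloor>"
      define u where "u = of_int J / real k"
      have J: "0 \<le> J" using \<kappa>t k by (simp add: J_def)
      have u: "u \<le> \<kappa> t" "\<kappa> t < u + 1 / real k"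
      proof -
        have "of_int J \<le> real k * \<kappa> t" "real k * \<kappa> t < of_int J + 1" by (simp_all add: J_def)
        then show "u \<le> \<kappa> t" "\<kappa> t < u + 1 / real k" using k by (auto simp: u_def field_simps)
      qed
      have u0: "u \<in> {0..real m}" using J k u \<kappa>t by (auto simp: u_def)
      have grid_le: "\<phi> \<tau> \<le> u" if "\<phi> \<tau> \<le> \<kappa> t" for \<tau>
      proof -
        have "of_int \<lceil>real k * \<tau>\<rceil> \<le> real k * \<kappa> t"
          using that k by (simp add: \<phi>_def pos_divide_le_eq mult.commute)
        then have "\<lceil>real k * \<tau>\<rceil> \<le> J" unfolding J_def by (simp add: le_floor_iff)
        then show ?thesis using k by (simp add: \<phi>_def u_def divide_right_mono)
      qed
      have grid_less: "u + 1 / real k \<le> \<phi> \<tau>" if "u < \<phi> \<tau>" for \<tau>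
      proof -
        have "(of_int J :: real) < of_int \<lceil>real k * \<tau>\<rceil>"
          using that k by (simp add: \<phi>_def u_def divide_less_cancel)
        then have "J + 1 \<le> \<lceil>real k * \<tau>\<rceil>" by linarith
        then have "(of_int J :: real) + 1 \<le> of_int \<lceil>real k * \<tau>\<rceil>" by linarith
        then show ?thesis using k by (simp add: \<phi>_def u_def add_divide_distrib[symmetric] divide_right_mono)
      qed
      \<comment> \<open>Here \<open>u\<close> is the last grid point up to
        \<open>\<kappa> t\<close>. A partition point \<tau> up to \<open>t\<close> is sent to a grid
        point up to \<open>\<kappa> t\<close>, hence up to \<open>u\<close>, and it only moved to
        the right. One beyond \<open>t\<close> is sent beyond \<open>\<kappa> t\<close>, hence to
        \<open>u + 1 / k\<close> or later, and it moved by less than \<open>1 / k\<close>. So no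
        partition point separates \<open>t\<close> from \<open>u\<close>.\<close>
      have "T \<inter> {min t u<..max t u} = {}"
      proof (rule ccontr)
        assume "T \<inter> {min t u<..max t u} \<noteq> {}"
        then obtain \<tau> where \<tau>: "\<tau> \<in> T" "min t u < \<tau>" "\<tau> \<le> max t u" by auto
        have \<tau>m: "\<tau> \<in> {0..real m}" using \<tau> T by auto
        show False
        proof (cases "\<tau> \<le> t")
          case True
          then have "\<phi> \<tau> \<le> \<kappa> t"
            using mono[OF \<tau>m t] \<kappa>(2)[OF \<tau>(1)] by (cases "\<tau> = t") auto
          then have "\<tau> \<le> u" using grid_le \<phi>(1)[of \<tau>] by fastforce
          then show False using True \<tau>(2) by linarith
        next
          case False
          then have "\<kappa> t < \<phi> \<tau>" using mono[OF t \<tau>m] \<kappa>(2)[OF \<tau>(1)] by simp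
          then have "u + 1 / real k \<le> \<phi> \<tau>" using grid_less u(1) by force
          moreover have "\<tau> \<le> u" using False \<tau>(3) by linarith
          ultimately show False using \<phi>(2)[of \<tau>] by linarith
        qed
      qed
      then have close: "\<bar>x t i - x u i\<bar> < e1 / 2" if "i \<in> I" for i
        using osc[OF that, of "min t u" "max t u"] t u0 by (auto simp: min_def max_def abs_minus_commute split: if_splits)
      \<comment> \<open>The indices used on \<open>[0,m]\<close> are at most \<open>k * m\<close>,
        and \<open>m \<le> k\<close> makes the truncation at \<open>k * k\<close> inactive.\<close>
      have index: "min (nat \<lfloor>real k * \<kappa> t\<rfloor>) (k * k) = nat J"
      proof -
        have "real k * \<kappa> t \<le> real k * real k" using \<kappa>t k by (intro mult_left_mono) auto
        then have "J \<le> int (k * k)" unfolding J_def by (simp add: floor_le_iff)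
        then have "nat J \<le> k * k" by linarith
        then show ?thesis by (simp add: J_def)
      qed
      have val: "step_path I k (\<lambda>(j, i). x (real j / real k) i) (\<kappa> t) i = x u i" if "i \<in> I" for i
        using that \<kappa>t index J by (simp add: step_path_def u_def)
      have "L2_set (\<lambda>i. cutoff m t * x t i
            - cutoff m (\<kappa> t) * step_path I k (\<lambda>(j, i). x (real j / real k) i) (\<kappa> t) i) I
          \<le> (\<Sum>i\<in>I. \<bar>cutoff m t * x t i
            - cutoff m (\<kappa> t) * step_path I k (\<lambda>(j, i). x (real j / real k) i) (\<kappa> t) i\<bar>)"
        by (rule L2_set_le_sum_abs)
      also have "\<dots> \<le> (\<Sum>i\<in>I. e1)"
      proof (rule sum_mono)
        fix i assume i: "i \<in> I"
        \<comment> \<open>The first half of \<open>e1\<close> pays for the oscillation of the path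
          between \<open>t\<close> and \<open>u\<close>, the second for the change of the cutoff,
          which is 1-Lipschitz, under the time change.\<close>
        have "\<bar>cutoff m t * x t i - cutoff m (\<kappa> t) * x u i\<bar>
            = \<bar>cutoff m t * (x t i - x u i) + (cutoff m t - cutoff m (\<kappa> t)) * x u i\<bar>"
          by (simp add: algebra_simps)
        also have "\<dots> \<le> \<bar>cutoff m t\<bar> * \<bar>x t i - x u i\<bar> + \<bar>cutoff m t - cutoff m (\<kappa> t)\<bar> * \<bar>x u i\<bar>"
          by (simp add: abs_mult[symmetric])
        also have "\<dots> \<le> 1 * (e1 / 2) + real (card T) * (1 / real k) * K"
        proof (intro add_mono mult_mono)
          show "\<bar>cutoff m t - cutoff m (\<kappa> t)\<bar> \<le> real (card T) * (1 / real k)"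
            using cutoff_lipschitz[of m t "\<kappa> t"] \<kappa>(3)[of t] by linarith
        qed (use cutoff_bounds[of m t] close[OF i] K[OF i u0] K_nonneg in auto)
        also have "\<dots> = e1 / 2 + K * real (card T) * (1 / real k)" by simp
        also have "\<dots> \<le> e1" using elim(3) by linarith
        finally show "\<bar>cutoff m t * x t i
            - cutoff m (\<kappa> t) * step_path I k (\<lambda>(j, i). x (real j / real k) i) (\<kappa> t) i\<bar> \<le> e1"
          using val[OF i] by simp
      qed
      also have "\<dots> \<le> e" using cardI by simp
      finally show "L2_set (\<lambda>i. cutoff m t * x t i
            - cutoff m (\<kappa> t) * step_path I k (\<lambda>(j, i). x (real j / real k) i) (\<kappa> t) i) I \<le> e" .
    qed
  qed
qed

lemma discretisation_limitin:
  assumes fin: "finite I" and x: "x \<in> skorokhod_space I"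
  shows "limitin (skorokhod_topology I)
    (\<lambda>k. step_path I (Suc k) (\<lambda>(j, i). x (real j / real (Suc k)) i)) x sequentially"
proof -
  define y where "y k = step_path I k (\<lambda>(j, i). x (real j / real k) i)" for k
  have y: "y (Suc k) \<in> skorokhod_space I" for k
    unfolding y_def by (rule step_path_in_skorokhod_space) simp
  have "(\<lambda>k. skorokhod_dist_upto I (Suc m) (y (Suc k)) x) \<longlonglongrightarrow> 0" for m
  proof (rule tendstoI)
    fix e :: real assume e: "0 < e"
    have "eventually (\<lambda>k. skorokhod_dist_upto I (Suc m) x (y k) \<le> e/2) sequentially"
      unfolding y_def using e by (intro discretisation_dist_upto_le[OF fin x]) simp
    then have "eventually (\<lambda>k. skorokhod_dist_upto I (Suc m) x (y (Suc k)) \<le> e/2) sequentially"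
      by (rule eventually_compose_filterlim[OF _ filterlim_Suc])
    then show "eventually (\<lambda>k. dist (skorokhod_dist_upto I (Suc m) (y (Suc k)) x) 0 < e) sequentially"
    proof eventually_elim
      case (elim k)
      then show ?case
        using e skorokhod_dist_upto_commute[OF x y] skorokhod_dist_upto_nonneg[of I "Suc m" x "y (Suc k)"]
        by simp
    qed
  qed
  then show ?thesis
    using limitin_skorokhod_iff[OF fin x, of "\<lambda>k. y (Suc k)"] y by (simp add: y_def)
qed

section \<open>Window means\<close>

text \<open>The exceptional set is covered by the finite partitions for horizon \<open>m\<close> and
  precision \<open>1 / Suc q\<close>. Off a finite, hence closed, set a whole ball around
  \<open>t\<close> meets no partition point, and there the oscillation is below the
  precision.\<close>

lemma countable_discontinuities:
  assumes fin: "finite I" and x: "x \<in> skorokhod_space I" and i: "i \<in> I"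
  shows "countable {t. 0 < t \<and> \<not> isCont (\<lambda>s. x s i) t}"
proof -
  define Q where "Q m q T \<longleftrightarrow> finite T \<and> (\<forall>s\<in>{0..real m}. \<forall>t\<in>{0..real m}. s \<le> t \<longrightarrow>
      T \<inter> {s<..t} = {} \<longrightarrow> \<bar>x s i - x t i\<bar> < 1 / real (Suc q))" for m q T
  have "\<exists>T. Q m q T" for m q
    using skorokhod_space_partition[OF fin x, of "1 / real (Suc q)" m] i unfolding Q_def
    by (metis divide_pos_pos of_nat_0_less_iff zero_less_Suc zero_less_one)
  then have Q: "Q m q (SOME T. Q m q T)" for m q by (rule someI_ex)
  define T where "T m q = (SOME T. Q m q T)" for m q
  have finT: "finite (T m q)"
    and osc: "\<And>s t. s \<in> {0..real m} \<Longrightarrow> t \<in> {0..real m} \<Longrightarrow> s \<le> t \<Longrightarrow> T m q \<inter> {s<..t} = {} \<Longrightarrow>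
      \<bar>x s i - x t i\<bar> < 1 / real (Suc q)" for m q
    using Q[of m q] unfolding Q_def T_def by blast+
  have "isCont (\<lambda>s. x s i) t" if t: "0 < t" "t \<notin> (\<Union>m. \<Union>q. T m q)" for t
    unfolding continuous_at_eps_delta
  proof (intro allI impI)
    fix e :: real assume "0 < e"
    then obtain q where q: "1 / real (Suc q) < e" using nat_approx_posE by blast
    obtain m where m: "t < real m" using reals_Archimedean2 by blast
    have "open (- T m q \<inter> {0<..<real m})"
      using finite_imp_closed[OF finT[of m q]] by (intro open_Int) auto
    moreover have "t \<in> - T m q \<inter> {0<..<real m}" using t m by auto
    ultimately obtain d where d: "0 < d" "ball t d \<subseteq> - T m q \<inter> {0<..<real m}"
      using open_contains_ball by blast
    have "dist (x s i) (x t i) < e" if s: "dist s t < d" for s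
    proof -
      have "{min s t..max s t} \<subseteq> ball t d"
        using s d(1) by (auto simp: dist_real_def min_def max_def split: if_splits)
      then have sub: "{min s t..max s t} \<subseteq> - T m q \<inter> {0<..<real m}" using d(2) by blast
      then have "min s t \<in> {0..real m}" "max s t \<in> {0..real m}"
        using subsetD[OF sub, of "min s t"] subsetD[OF sub, of "max s t"]
        by (simp_all add: min_def max_def split: if_splits)
      moreover have "T m q \<inter> {min s t<..max s t} = {}" using sub by force
      ultimately have "\<bar>x (min s t) i - x (max s t) i\<bar> < 1 / real (Suc q)"
        by (intro osc[of _ m]) auto
      then show ?thesis using q by (auto simp: dist_real_def min_def max_def split: if_splits)
    qed
    then show "\<exists>d>0. \<forall>s. dist s t < d \<longrightarrow> dist (x s i) (x t i) < e" using d(1) by blast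
  qed
  then have "{t. 0 < t \<and> \<not> isCont (\<lambda>s. x s i) t} \<subseteq> (\<Union>m. \<Union>q. T m q)" by blast
  moreover have "countable (\<Union>m. \<Union>q. T m q)"
    using finT by (intro countable_UN) (auto intro: countable_finite)
  ultimately show ?thesis by (rule countable_subset)
qed

lemma skorokhod_path_measurable:
  assumes fin: "finite I" and x: "x \<in> skorokhod_space I" and i: "i \<in> I"
  shows "(\<lambda>t. x t i) \<in> borel_measurable borel"
proof (rule borel_measurable_continuous_countable_exceptions)
  show "countable (insert 0 {t. 0 < t \<and> \<not> isCont (\<lambda>s. x s i) t})"
    using countable_discontinuities[OF assms] by simp
  \<comment> \<open>At negative times a path has the default value of an extensional function, a
    constant; only the switch at 0 has to be added to the exceptional set.\<close>
  have "isCont (\<lambda>s. x s i) t" if "t < 0" for t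
    unfolding isCont_def
  proof (rule tendsto_eventually)
    have "x s = undefined" if "s < 0" for s
      using x that by (auto simp: skorokhod_space_def PiE_iff extensional_def)
    then show "eventually (\<lambda>s. x s i = x t i) (at t)"
      unfolding eventually_at using that by (intro exI[of _ "- t"]) (auto simp: dist_real_def)
  qed
  then show "continuous_on (- insert 0 {t. 0 < t \<and> \<not> isCont (\<lambda>s. x s i) t}) (\<lambda>t. x t i)"
    by (intro continuous_at_imp_continuous_on) (auto, metis linorder_neqE_linordered_idom)
qed

section \<open>Values and bounds along convergent sequences of paths\<close>

lemma skorokhod_dist_upto_less_imp_close:
  assumes fin: "finite I" and x: "x \<in> skorokhod_space I" and y: "y \<in> skorokhod_space I"
    and i: "i \<in> I" and less: "skorokhod_dist_upto I m y x < e" and e: "e \<le> 1"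
    and t: "0 \<le> t" "t + 2 \<le> real m"
  obtains s where "s \<in> {0..real m}" "\<bar>s - t\<bar> < e" "\<bar>y t i - x s i\<bar> < e"
proof -
  obtain l where l: "l \<in> time_changes m" "\<And>t. t \<in> {0..real m} \<Longrightarrow> \<bar>l t - t\<bar> < e"
    "\<And>t. t \<in> {0..real m} \<Longrightarrow>
        L2_set (\<lambda>i. cutoff m t * y t i - cutoff m (l t) * x (l t) i) I < e"
    using skorokhod_dist_upto_lessD[OF y x less] by blast
  have tm: "t \<in> {0..real m}" using t by simp
  show ?thesis
  proof (rule that[of "l t"])
    show "l t \<in> {0..real m}" using l(1) tm by (auto simp: time_changes_def)
    show lt: "\<bar>l t - t\<bar> < e" by (rule l(2)[OF tm])
    \<comment> \<open>The margin 2 below the horizon consists of 1 for the region where the cutoff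
      decreases and 1 for the displacement of \<open>t\<close>.\<close>
    have c: "cutoff m t = 1" "cutoff m (l t) = 1" using t lt e by (auto simp: cutoff_def)
    have "\<bar>y t i - x (l t) i\<bar> \<le> L2_set (\<lambda>i. \<bar>y t i - x (l t) i\<bar>) I"
      by (rule member_le_L2_set[OF fin i])
    also have "\<dots> = L2_set (\<lambda>i. cutoff m t * y t i - cutoff m (l t) * x (l t) i) I"
      by (simp add: L2_set_def c)
    also have "\<dots> < e" by (rule l(3)[OF tm])
    finally show "\<bar>y t i - x (l t) i\<bar> < e" .
  qed
qed

text \<open>The value of \<open>xn n\<close> at \<open>t\<close> is close to that of
  \<open>x\<close> at a displaced time, and continuity absorbs the displacement. At a jump of
  \<open>x\<close> the displaced time could fall on either side.\<close>

lemma skorokhod_limit_at_continuity_point: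
  assumes fin: "finite I" and x: "x \<in> skorokhod_space I" and xn: "\<And>n. xn n \<in> skorokhod_space I"
    and lim: "limitin (skorokhod_topology I) xn x sequentially" and i: "i \<in> I"
    and t: "0 \<le> t" and cont: "isCont (\<lambda>s. x s i) t"
  shows "(\<lambda>n. xn n t i) \<longlonglongrightarrow> x t i"
proof (rule tendstoI)
  fix e :: real assume e: "0 < e"
  obtain d where d: "0 < d" "\<And>s. dist s t < d \<Longrightarrow> dist (x s i) (x t i) < e / 2"
    using cont e unfolding continuous_at_eps_delta by (meson half_gt_zero)
  obtain m where m: "t + 2 \<le> real m" using real_arch_simple by blast
  define e1 where "e1 = min 1 (min d (e / 2))"
  have e1: "0 < e1" "e1 \<le> 1" "e1 \<le> d" "e1 \<le> e / 2" using d e by (auto simp: e1_def)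
  have "(\<lambda>n. skorokhod_dist_upto I (Suc m) (xn n) x) \<longlonglongrightarrow> 0"
    using lim xn limitin_skorokhod_iff[OF fin x, of xn] by simp
  then have "eventually (\<lambda>n. skorokhod_dist_upto I (Suc m) (xn n) x < e1) sequentially"
    by (rule order_tendstoD) (rule e1)
  then show "eventually (\<lambda>n. dist (xn n t i) (x t i) < e) sequentially"
  proof eventually_elim
    case (elim n)
    obtain s where s: "\<bar>s - t\<bar> < e1" "\<bar>xn n t i - x s i\<bar> < e1"
      using skorokhod_dist_upto_less_imp_close[OF fin x xn i elim e1(2) t] m by auto
    have "dist (x s i) (x t i) < e / 2" using d(2)[of s] s(1) e1 by (simp add: dist_real_def)
    then show ?case using s(2) e1 unfolding dist_real_def by linarith
  qed
qed

text \<open>Here jumps do no harm: the displaced time only has to stay in a compact interval, on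
  which \<open>x\<close> is bounded. This supplies the dominating function for window means.\<close>

lemma skorokhod_limit_bounded:
  assumes fin: "finite I" and x: "x \<in> skorokhod_space I" and xn: "\<And>n. xn n \<in> skorokhod_space I"
    and lim: "limitin (skorokhod_topology I) xn x sequentially" and i: "i \<in> I"
  obtains K where "eventually (\<lambda>n. \<forall>t\<in>{0..b}. \<bar>xn n t i\<bar> \<le> K) sequentially"
proof -
  obtain m where m: "b + 2 \<le> real m" using real_arch_simple by blast
  obtain K where K: "\<forall>t\<in>{0..real (Suc m)}. \<bar>x t i\<bar> \<le> K"
    using skorokhod_space_bounded[OF x i] by blast
  have "(\<lambda>n. skorokhod_dist_upto I (Suc m) (xn n) x) \<longlonglongrightarrow> 0"
    using lim xn limitin_skorokhod_iff[OF fin x, of xn] by simp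
  then have "eventually (\<lambda>n. skorokhod_dist_upto I (Suc m) (xn n) x < 1) sequentially"
    by (rule order_tendstoD) simp
  then have "eventually (\<lambda>n. \<forall>t\<in>{0..b}. \<bar>xn n t i\<bar> \<le> K + 1) sequentially"
  proof eventually_elim
    case (elim n)
    show ?case
    proof
      fix t assume t: "t \<in> {0..b}"
      then obtain s where s: "s \<in> {0..real (Suc m)}" "\<bar>xn n t i - x s i\<bar> < 1"
        using skorokhod_dist_upto_less_imp_close[OF fin x xn i elim order_refl, of t] m by auto
      then have "\<bar>x s i\<bar> \<le> K" using K by blast
      then show "\<bar>xn n t i\<bar> \<le> K + 1" using s(2) by linarith
    qed
  qed
  then show ?thesis by (rule that)
qed

text \<open>Evaluation at a fixed time is not continuous in the J1 topology. The average over a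
  short interval to the right is a continuous substitute, and it is still linear in the
  path.\<close>

definition window_mean :: "real \<Rightarrow> real \<Rightarrow> (real \<Rightarrow> real) \<Rightarrow> real" where
  "window_mean \<eta> s y = (\<integral>t. indicator {s..s + \<eta>} t * y t \<partial>lborel) / \<eta>"

lemma window_integrable:
  fixes y :: "real \<Rightarrow> real"
  assumes "y \<in> borel_measurable borel" and "\<And>t. t \<in> {a..b} \<Longrightarrow> \<bar>y t\<bar> \<le> K"
  shows "integrable lborel (\<lambda>t. indicator {a..b} t * y t)"
proof (rule Bochner_Integration.integrable_bound)
  have "integrable lborel (indicator {a..b} :: real \<Rightarrow> real)"
    by (rule integrable_real_indicator) (auto simp: emeasure_lborel_Icc_eq)
  then show "integrable lborel (\<lambda>t. indicator {a..b} t * K)" by (rule integrable_mult_left)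
  show "(\<lambda>t. indicator {a..b} t * y t) \<in> borel_measurable lborel" using assms(1) by simp
  show "AE t in lborel. norm (indicator {a..b} t * y t) \<le> norm (indicator {a..b} t * K)"
    using assms(2) by (intro AE_I2) (auto simp: indicator_def split: if_splits, force)
qed

lemma window_mean_const: "0 < \<eta> \<Longrightarrow> window_mean \<eta> s (\<lambda>t. c) = c"
  by (simp add: window_mean_def)

lemma window_mean_close:
  assumes \<eta>: "0 < \<eta>" and y: "y \<in> borel_measurable borel" and z: "z \<in> borel_measurable borel"
    and zK: "\<And>t. t \<in> {s..s + \<eta>} \<Longrightarrow> \<bar>z t\<bar> \<le> K"
    and close: "\<And>t. t \<in> {s..s + \<eta>} \<Longrightarrow> \<bar>y t - z t\<bar> \<le> e"
  shows "\<bar>window_mean \<eta> s y - window_mean \<eta> s z\<bar> \<le> e"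
proof -
  have yK: "\<bar>y t\<bar> \<le> K + e" if "t \<in> {s..s + \<eta>}" for t using zK[OF that] close[OF that] by linarith
  have int: "integrable lborel (\<lambda>t. indicator {s..s + \<eta>} t * y t)"
      "integrable lborel (\<lambda>t. indicator {s..s + \<eta>} t * z t)"
      "integrable lborel (\<lambda>t. indicator {s..s + \<eta>} t * (y t - z t))"
      "integrable lborel (\<lambda>t. indicator {s..s + \<eta>} t * e)"
    using window_integrable[OF y yK] window_integrable[OF z zK]
      window_integrable[of "\<lambda>t. y t - z t", OF _ close] window_integrable[of "\<lambda>_. e" s "s + \<eta>" "\<bar>e\<bar>"] y z
    by simp_all
  have "\<bar>(\<integral>t. indicator {s..s + \<eta>} t * y t \<partial>lborel) - (\<integral>t. indicator {s..s + \<eta>} t * z t \<partial>lborel)\<bar>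
      = \<bar>\<integral>t. indicator {s..s + \<eta>} t * (y t - z t) \<partial>lborel\<bar>"
    using int by (subst Bochner_Integration.integral_diff[symmetric]) (auto simp: algebra_simps)
  also have "\<dots> \<le> (\<integral>t. \<bar>indicator {s..s + \<eta>} t * (y t - z t)\<bar> \<partial>lborel)"
    using integral_norm_bound[of lborel "\<lambda>t. indicator {s..s + \<eta>} t * (y t - z t)"] by simp
  also have "\<dots> \<le> (\<integral>t. indicator {s..s + \<eta>} t * e \<partial>lborel)"
    using int close by (intro integral_mono) (auto simp: indicator_def)
  also have "\<dots> = e * \<eta>" using \<eta> by simp
  finally show ?thesis
    using \<eta> by (simp add: window_mean_def diff_divide_distrib[symmetric] pos_divide_le_eq)
qed

lemma window_mean_limitin:
  assumes fin: "finite I" and x: "x \<in> skorokhod_space I" and xn: "\<And>n. xn n \<in> skorokhod_space I"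
    and lim: "limitin (skorokhod_topology I) xn x sequentially" and i: "i \<in> I" and s: "0 \<le> s"
  shows "(\<lambda>n. window_mean \<eta> s (\<lambda>t. xn n t i)) \<longlonglongrightarrow> window_mean \<eta> s (\<lambda>t. x t i)"
proof -
  obtain K where "eventually (\<lambda>n. \<forall>t\<in>{0..s + \<eta>}. \<bar>xn n t i\<bar> \<le> K) sequentially"
    using skorokhod_limit_bounded[OF fin x xn lim i] by blast
  then obtain N where N: "\<And>n. N \<le> n \<Longrightarrow> \<forall>t\<in>{0..s + \<eta>}. \<bar>xn n t i\<bar> \<le> K"
    unfolding eventually_sequentially by blast
  note [measurable] = skorokhod_path_measurable[OF fin x i] skorokhod_path_measurable[OF fin xn i]
  \<comment> \<open>The uniform bound holds from index \<open>N\<close> on only, hence the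
    shift.\<close>
  have "(\<lambda>n. \<integral>t. indicator {s..s + \<eta>} t * xn (n + N) t i \<partial>lborel)
      \<longlonglongrightarrow> (\<integral>t. indicator {s..s + \<eta>} t * x t i \<partial>lborel)"
  proof (rule integral_dominated_convergence[where w = "\<lambda>t. indicator {s..s + \<eta>} t * K"])
    show "integrable lborel (\<lambda>t. indicator {s..s + \<eta>} t * K)"
      by (rule window_integrable[where K = "\<bar>K\<bar>"]) auto
    show "AE t in lborel. norm (indicator {s..s + \<eta>} t * xn (n + N) t i) \<le> indicator {s..s + \<eta>} t * K" for n
      using N[of "n + N"] s by (intro AE_I2) (auto simp: indicator_def)
    have "AE t in lborel. t \<notin> insert 0 {t. 0 < t \<and> \<not> isCont (\<lambda>s. x s i) t}"
      using countable_discontinuities[OF fin x i]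
      by (intro AE_not_in countable_imp_null_set_lborel) simp
    then show "AE t in lborel. (\<lambda>n. indicator {s..s + \<eta>} t * xn (n + N) t i)
        \<longlonglongrightarrow> indicator {s..s + \<eta>} t * x t i"
    proof eventually_elim
      case (elim t)
      show ?case
      proof (cases "t \<in> {s..s + \<eta>}")
        case True
        then have "(\<lambda>n. xn n t i) \<longlonglongrightarrow> x t i"
          using elim s by (intro skorokhod_limit_at_continuity_point[OF fin x xn lim i]) auto
        from LIMSEQ_ignore_initial_segment[OF this, of N] show ?thesis
          by (intro tendsto_mult tendsto_const)
      qed auto
    qed
  qed auto
  from LIMSEQ_offset[OF this] show ?thesis
    unfolding window_mean_def divide_inverse by (rule tendsto_mult_right)
qed

lemma window_mean_right_limit:
  assumes fin: "finite I" and x: "x \<in> skorokhod_space I" and i: "i \<in> I" and s: "0 \<le> s"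
  shows "(\<lambda>l. window_mean (1 / real (Suc l)) s (\<lambda>t. x t i)) \<longlonglongrightarrow> x s i"
proof (rule tendstoI)
  fix e :: real assume e: "0 < e"
  have "((\<lambda>t. x t i) \<longlongrightarrow> x s i) (at_right s)" using x i s by (auto simp: skorokhod_space_def)
  then have "eventually (\<lambda>t. dist (x t i) (x s i) < e / 2) (at_right s)"
    by (rule tendstoD) (use e in simp)
  then have "\<exists>b>s. \<forall>t>s. t < b \<longrightarrow> dist (x t i) (x s i) < e / 2"
    unfolding eventually_at_right_field .
  then obtain b where b: "s < b" "\<And>t. s < t \<Longrightarrow> t < b \<Longrightarrow> dist (x t i) (x s i) < e / 2" by blast
  have "eventually (\<lambda>l. inverse (real (Suc l)) < b - s) sequentially"
    by (rule order_tendstoD[OF LIMSEQ_inverse_real_of_nat]) (use b in simp)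
  then show "eventually (\<lambda>l. dist (window_mean (1 / real (Suc l)) s (\<lambda>t. x t i)) (x s i) < e) sequentially"
  proof eventually_elim
    case (elim l)
    have "\<bar>x t i - x s i\<bar> \<le> e / 2" if t: "t \<in> {s..s + 1 / real (Suc l)}" for t
    proof (cases "t = s")
      case False
      then have "dist (x t i) (x s i) < e / 2" using t elim by (intro b(2)) (auto simp: inverse_eq_divide)
      then show ?thesis by (simp add: dist_real_def)
    qed (use e in simp)
    then have "\<bar>window_mean (1 / real (Suc l)) s (\<lambda>t. x t i)
        - window_mean (1 / real (Suc l)) s (\<lambda>t. x s i)\<bar> \<le> e / 2"
      using skorokhod_path_measurable[OF fin x i]
      by (intro window_mean_close[where K = "\<bar>x s i\<bar>"]) auto
    then show ?case using e by (simp add: window_mean_const dist_real_def)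
  qed
qed

section \<open>Functions of finitely many window means\<close>

lemma continuous_map_skorokhod_sequential:
  assumes fin: "finite I"
    and seq: "\<And>xn x. (\<And>n. xn n \<in> skorokhod_space I) \<Longrightarrow> x \<in> skorokhod_space I \<Longrightarrow>
      limitin (skorokhod_topology I) xn x sequentially \<Longrightarrow> (\<lambda>n. F (xn n)) \<longlonglongrightarrow> (F x :: real)"
  shows "continuous_map (skorokhod_topology I) euclideanreal F"
  unfolding skorokhod_topology_def
proof (rule sequentially_continuous_imp_continuous_map[OF Metric_space_skorokhod[OF fin]])
  fix \<sigma> l assume \<sigma>: "range \<sigma> \<subseteq> skorokhod_space I"
    and lim: "limitin (Metric_space.mtopology (skorokhod_space I) (skorokhod_dist I)) \<sigma> l sequentially"
  have "l \<in> skorokhod_space I"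
    using Metric_space.limitin_mspace[OF Metric_space_skorokhod[OF fin] lim] .
  then show "limitin euclideanreal (\<lambda>n. F (\<sigma> n)) (F l) sequentially"
    using seq[of \<sigma> l] \<sigma> lim by (auto simp: skorokhod_topology_def)
qed auto

lemma continuous_map_tendsto:
  assumes "continuous_map T euclideanreal F" and "limitin T xn x sequentially"
  shows "(\<lambda>n. F (xn n)) \<longlonglongrightarrow> F x"
  using continuous_map_limit[OF assms] by (simp add: o_def)

text \<open>The truncation to a box makes continuous functions of the array uniformly continuous.\<close>

definition window_array :: "nat \<Rightarrow> nat \<Rightarrow> (real \<Rightarrow> 'i \<Rightarrow> real) \<Rightarrow> nat \<times> 'i \<Rightarrow> real" where
  "window_array k l x = (\<lambda>(j, i). max (- real (Suc l)) (min (real (Suc l))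
     (window_mean (1 / real (Suc l)) (real j / real k) (\<lambda>t. x t i))))"

definition window_path :: "'i set \<Rightarrow> nat \<Rightarrow> nat \<Rightarrow> (real \<Rightarrow> 'i \<Rightarrow> real) \<Rightarrow> real \<Rightarrow> 'i \<Rightarrow> real" where
  "window_path I k l x = step_path I (Suc k) (window_array (Suc k) l x)"

lemma window_path_in_skorokhod_space: "window_path I k l x \<in> skorokhod_space I"
  unfolding window_path_def by (rule step_path_in_skorokhod_space) simp

lemma window_array_le: "\<bar>window_array k l x ji\<bar> \<le> real (Suc l)"
  by (cases ji) (auto simp: window_array_def)

lemma continuous_map_window_path:
  assumes fin: "finite I" and F: "continuous_map (skorokhod_topology I) euclideanreal F"
  shows "continuous_map (skorokhod_topology I) euclideanreal (\<lambda>x. F (window_path I k l x))"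
proof (rule continuous_map_skorokhod_sequential[OF fin])
  fix xn x assume x: "\<And>n. xn n \<in> skorokhod_space I" "x \<in> skorokhod_space I"
    "limitin (skorokhod_topology I) xn x sequentially"
  have "(\<lambda>n. window_array (Suc k) l (xn n) (j, i)) \<longlonglongrightarrow> window_array (Suc k) l x (j, i)"
    if "i \<in> I" for i j
    unfolding window_array_def using x that
    by (auto intro!: tendsto_max tendsto_min window_mean_limitin[OF fin])
  then show "(\<lambda>n. F (window_path I k l (xn n))) \<longlonglongrightarrow> F (window_path I k l x)"
    unfolding window_path_def
    by (intro continuous_map_tendsto[OF F] step_path_limitin[OF fin]) auto
qed

lemma window_path_tendsto:
  assumes fin: "finite I" and F: "continuous_map (skorokhod_topology I) euclideanreal F"
    and x: "x \<in> skorokhod_space I"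
  shows "(\<lambda>l. F (window_path I k l x)) \<longlonglongrightarrow>
    F (step_path I (Suc k) (\<lambda>(j, i). x (real j / real (Suc k)) i))"
proof -
  have "(\<lambda>l. window_array (Suc k) l x (j, i)) \<longlonglongrightarrow> x (real j / real (Suc k)) i" if "i \<in> I" for i j
  proof -
    let ?w = "\<lambda>l. window_mean (1 / real (Suc l)) (real j / real (Suc k)) (\<lambda>t. x t i)"
    have w: "?w \<longlonglongrightarrow> x (real j / real (Suc k)) i"
      by (rule window_mean_right_limit[OF fin x that]) simp
    \<comment> \<open>The parameter \<open>l\<close> sets both the width of the window and the level
      of the clipping. A convergent sequence of means is bounded, so the clipping is eventually
      inactive.\<close>
    then obtain K where K: "\<And>l. \<bar>?w l\<bar> \<le> K"
      using convergent_imp_Bseq[OF convergentI[OF w]] unfolding Bseq_def by auto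
    obtain N where N: "K \<le> real N" using real_arch_simple by blast
    have "eventually (\<lambda>l. ?w l = window_array (Suc k) l x (j, i)) sequentially"
      using eventually_ge_at_top[of N]
    proof eventually_elim
      case (elim l)
      then have "\<bar>?w l\<bar> \<le> real (Suc l)" using K[of l] N by simp
      then show ?case by (simp add: window_array_def)
    qed
    then show ?thesis by (rule Lim_transform_eventually[OF w])
  qed
  then show ?thesis
    unfolding window_path_def
    by (intro continuous_map_tendsto[OF F] step_path_limitin[OF fin]) auto
qed

text \<open>Two arrays that both vary with n and need not converge will be compared, so plain
  continuity is not enough. In a box, a sequence of counterexamples has a subsequence along which
  both arrays tend to the same limit, against continuity of \<open>F\<close> there.\<close>

lemma step_path_uniformly_continuous:
  assumes fin: "finite I" and k: "0 < k" and F: "continuous_map (skorokhod_topology I) euclideanreal F"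
    and e: "0 < e"
  shows "\<exists>\<delta>>0. \<forall>a b. (\<forall>j\<le>k * k. \<forall>i\<in>I. \<bar>a (j, i)\<bar> \<le> R \<and> \<bar>b (j, i)\<bar> \<le> R \<and> \<bar>a (j, i) - b (j, i)\<bar> < \<delta>)
    \<longrightarrow> \<bar>F (step_path I k a) - F (step_path I k b)\<bar> < e"
proof (rule ccontr)
  define J where "J = {..k * k} \<times> I"
  define near where "near \<delta> p \<longleftrightarrow> (\<forall>j\<le>k * k. \<forall>i\<in>I. \<bar>fst p (j, i)\<bar> \<le> R \<and> \<bar>snd p (j, i)\<bar> \<le> R \<and>
      \<bar>fst p (j, i) - snd p (j, i)\<bar> < \<delta>)" for \<delta> and p :: "(nat \<times> 'a \<Rightarrow> real) \<times> (nat \<times> 'a \<Rightarrow> real)"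
  assume neg: "\<not> ?thesis"
  have "\<exists>p. near (1 / real (Suc n)) p \<and> \<not> \<bar>F (step_path I k (fst p)) - F (step_path I k (snd p))\<bar> < e" for n
  proof (rule ccontr)
    assume "\<not> ?thesis"
    then have *: "near (1 / real (Suc n)) p \<Longrightarrow> \<bar>F (step_path I k (fst p)) - F (step_path I k (snd p))\<bar> < e" for p
      by blast
    show False
      by (rule notE[OF neg], intro exI[of _ "1 / real (Suc n)"] conjI allI impI)
        (simp, rule *[of "(_, _)", unfolded near_def fst_conv snd_conv])
  qed
  then have "\<forall>n. \<exists>p. near (1 / real (Suc n)) p \<and> \<not> \<bar>F (step_path I k (fst p)) - F (step_path I k (snd p))\<bar> < e"
    by blast
  from choice[OF this] obtain p where p: "\<And>n. near (1 / real (Suc n)) (p n)"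
    and far: "\<And>n. \<not> \<bar>F (step_path I k (fst (p n))) - F (step_path I k (snd (p n)))\<bar> < e"
    by blast
  define a b where "a n = fst (p n)" and "b n = snd (p n)" for n
  have ab: "\<bar>a n (j, i)\<bar> \<le> R \<and> \<bar>b n (j, i)\<bar> \<le> R \<and> \<bar>a n (j, i) - b n (j, i)\<bar> < 1 / real (Suc n)"
    if "j \<le> k * k" "i \<in> I" for n j i
    using p[of n] that unfolding near_def a_def b_def by blast
  have "finite J" using fin by (simp add: J_def)
  \<comment> \<open>Bolzano-Weierstrass in the finitely many coordinates \<open>J\<close>;
    \<open>step_path\<close> reads no others.\<close>
  then have "\<forall>\<delta>\<subseteq>J. \<exists>c. \<exists>r. strict_mono r \<and>
      (\<forall>\<epsilon>>0. eventually (\<lambda>n. \<forall>ji\<in>\<delta>. dist (a (r n) ji) (c ji) < \<epsilon>) sequentially)"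
  proof (rule compact_lemma_general[where proj = "\<lambda>a ji. a ji" and unproj = "\<lambda>a. a"])
    fix ji assume "ji \<in> J"
    then show "bounded ((\<lambda>a. a ji) ` range a)"
      using ab unfolding bounded_iff J_def by (auto intro!: exI[of _ R])
  qed auto
  then obtain c r where r: "strict_mono r" and
    c: "\<And>\<epsilon>. \<epsilon> > 0 \<Longrightarrow> eventually (\<lambda>n. \<forall>ji\<in>J. dist (a (r n) ji) (c ji) < \<epsilon>) sequentially"
    by blast
  have alim: "(\<lambda>n. a (r n) (j, i)) \<longlonglongrightarrow> c (j, i)" if "j \<le> k * k" "i \<in> I" for j i
  proof (rule tendstoI)
    fix \<epsilon> :: real assume "0 < \<epsilon>"
    from c[OF this] show "eventually (\<lambda>n. dist (a (r n) (j, i)) (c (j, i)) < \<epsilon>) sequentially"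
      by (rule eventually_mono) (use that in \<open>auto simp: J_def\<close>)
  qed
  have blim: "(\<lambda>n. b (r n) (j, i)) \<longlonglongrightarrow> c (j, i)" if ji: "j \<le> k * k" "i \<in> I" for j i
  proof -
    have "(\<lambda>n. a n (j, i) - b n (j, i)) \<longlonglongrightarrow> 0"
    proof (rule Lim_null_comparison[OF always_eventually LIMSEQ_inverse_real_of_nat], rule allI)
      fix n show "norm (a n (j, i) - b n (j, i)) \<le> inverse (real (Suc n))"
        using ab[OF ji, of n] unfolding inverse_eq_divide by simp
    qed
    from tendsto_diff[OF alim[OF ji] LIMSEQ_subseq_LIMSEQ[OF this r]] show ?thesis by (simp add: o_def)
  qed
  have "(\<lambda>n. F (step_path I k (a (r n))) - F (step_path I k (b (r n))))
      \<longlonglongrightarrow> F (step_path I k c) - F (step_path I k c)"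
    using alim blim by (intro tendsto_diff continuous_map_tendsto[OF F] step_path_limitin[OF fin k])
  then have "eventually (\<lambda>n. dist (F (step_path I k (a (r n))) - F (step_path I k (b (r n)))) 0 < e) sequentially"
    by (intro tendstoD) (use e in auto)
  then have "eventually (\<lambda>n::nat. False) sequentially"
    by (rule eventually_mono) (use far in \<open>simp add: dist_real_def a_def b_def\<close>)
  then show False by simp
qed

text \<open>Rounding the entries of the array makes it countably valued.\<close>

lemma measurable_step_path:
  assumes fin: "finite I" and k: "0 < k" and F: "continuous_map (skorokhod_topology I) euclideanreal F"
    and a: "\<And>j i. j \<le> k * k \<Longrightarrow> i \<in> I \<Longrightarrow> (\<lambda>z. a z (j, i)) \<in> borel_measurable M"
  shows "(\<lambda>z. F (step_path I k (a z))) \<in> borel_measurable M"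
proof -
  define J where "J = {..k * k} \<times> I"
  have finJ: "finite J" using fin by (simp add: J_def)
  define g where "g n z = (\<lambda>ji\<in>J. \<lfloor>real (Suc n) * a z ji\<rfloor>)" for n :: nat and z
  define \<phi> where "\<phi> n c = F (step_path I k (\<lambda>ji. of_int (c ji) / real (Suc n)))"
    for n :: nat and c :: "nat \<times> 'a \<Rightarrow> int"
  have lim: "(\<lambda>n. \<phi> n (g n z)) \<longlonglongrightarrow> F (step_path I k (a z))" for z
  proof -
    have "(\<lambda>n. of_int (g n z (j, i)) / real (Suc n)) \<longlonglongrightarrow> a z (j, i)" if ji: "j \<le> k * k" "i \<in> I" for j i
    proof -
      have "norm (of_int (g n z (j, i)) / real (Suc n) - a z (j, i)) \<le> inverse (real (Suc n))" for n
      proof -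
        have "(j, i) \<in> J" using ji by (simp add: J_def)
        then have "of_int (g n z (j, i)) / real (Suc n) - a z (j, i)
            = (of_int \<lfloor>real (Suc n) * a z (j, i)\<rfloor> - real (Suc n) * a z (j, i)) / real (Suc n)"
          by (simp add: g_def field_simps)
        moreover have "\<bar>of_int \<lfloor>real (Suc n) * a z (j, i)\<rfloor> - real (Suc n) * a z (j, i)\<bar> \<le> 1"
          by linarith
        ultimately show ?thesis by (simp add: divide_right_mono inverse_eq_divide)
      qed
      then have "(\<lambda>n. of_int (g n z (j, i)) / real (Suc n) - a z (j, i)) \<longlonglongrightarrow> 0"
        by (intro Lim_null_comparison[OF always_eventually LIMSEQ_inverse_real_of_nat]) simp
      then show ?thesis by (simp add: LIM_zero_iff)
    qed
    then show ?thesis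
      unfolding \<phi>_def by (intro continuous_map_tendsto[OF F] step_path_limitin[OF fin k]) auto
  qed
  have cJ: "countable (J \<rightarrow>\<^sub>E (UNIV :: int set))" using finJ by (intro countable_PiE) auto
  have "(\<lambda>z. \<phi> n (g n z)) \<in> borel_measurable M" for n
  proof (rule measurable_compose_countable'[OF _ _ cJ])
    show "g n \<in> measurable M (count_space (J \<rightarrow>\<^sub>E UNIV))"
      unfolding measurable_count_space_eq_countable[OF cJ]
    proof (intro conjI ballI)
      fix c assume c: "c \<in> J \<rightarrow>\<^sub>E (UNIV :: int set)"
      have "g n -` {c} \<inter> space M = {z \<in> space M. \<forall>ji\<in>J. \<lfloor>real (Suc n) * a z ji\<rfloor> = c ji}"
        using c by (auto simp: g_def fun_eq_iff PiE_iff extensional_def restrict_def)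
      also have "\<dots> \<in> sets M"
      proof (rule sets.sets_Collect_finite_All[OF _ finJ])
        fix ji assume "ji \<in> J"
        then have [measurable]: "(\<lambda>z. a z ji) \<in> borel_measurable M" using a by (auto simp: J_def)
        show "{z \<in> space M. \<lfloor>real (Suc n) * a z ji\<rfloor> = c ji} \<in> sets M" by measurable
      qed
      finally show "g n -` {c} \<inter> space M \<in> sets M" .
    qed (auto simp: g_def)
  qed simp
  then show ?thesis by (rule borel_measurable_LIMSEQ_real[OF lim])
qed

section \<open>Weak limits under a change of density\<close>

lemma space_borel_of_topology [simp]: "space (borel_of_topology T) = topspace T"
  unfolding borel_of_topology_def by (rule space_measure_of) (use openin_subset in blast)

lemma sets_borel_of_topology: "sets (borel_of_topology T) = sigma_sets (topspace T) {U. openin T U}"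
  unfolding borel_of_topology_def by (rule sets_measure_of) (use openin_subset in blast)

lemma continuous_map_borel_measurable:
  assumes F: "continuous_map T euclideanreal F"
  shows "F \<in> borel_measurable (borel_of_topology T)"
proof (rule borel_measurableI)
  fix S :: "real set" assume "open S"
  then have "openin T {x \<in> topspace T. F x \<in> S}"
    using openin_continuous_map_preimage[OF F] by simp
  then have "{x \<in> topspace T. F x \<in> S} \<in> sigma_sets (topspace T) {U. openin T U}"
    by (intro sigma_sets.Basic) simp
  moreover have "F -` S \<inter> space (borel_of_topology T) = {x \<in> topspace T. F x \<in> S}" by auto
  ultimately show "F -` S \<inter> space (borel_of_topology T) \<in> sets (borel_of_topology T)"
    by (simp add: sets_borel_of_topology)
qed

lemma integral_diff_tendsto_0:
  fixes f :: "'a \<Rightarrow> real"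
  assumes "finite_measure M" and "f \<in> borel_measurable M" and "\<And>n. g n \<in> borel_measurable M"
    and "\<And>x. x \<in> space M \<Longrightarrow> (\<lambda>n. g n x) \<longlonglongrightarrow> f x"
    and "\<And>x. x \<in> space M \<Longrightarrow> \<bar>f x\<bar> \<le> K" and "\<And>n x. x \<in> space M \<Longrightarrow> \<bar>g n x\<bar> \<le> K"
  shows "(\<lambda>n. \<integral>x. \<bar>f x - g n x\<bar> \<partial>M) \<longlonglongrightarrow> 0"
proof -
  interpret finite_measure M by fact
  note [measurable] = assms(2,3)
  have "(\<lambda>n. \<integral>x. \<bar>f x - g n x\<bar> \<partial>M) \<longlonglongrightarrow> (\<integral>x. 0 \<partial>M)"
  proof (rule integral_dominated_convergence[where w = "\<lambda>_. 2 * K"])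
    show "AE x in M. (\<lambda>n. \<bar>f x - g n x\<bar>) \<longlonglongrightarrow> 0"
    proof (rule AE_I2)
      fix x assume "x \<in> space M"
      from tendsto_rabs[OF tendsto_diff[OF tendsto_const assms(4)[OF this], of "f x"]]
      show "(\<lambda>n. \<bar>f x - g n x\<bar>) \<longlonglongrightarrow> 0" by simp
    qed
    show "AE x in M. norm \<bar>f x - g n x\<bar> \<le> 2 * K" for n
    proof (rule AE_I2)
      fix x assume "x \<in> space M"
      from assms(5)[OF this] assms(6)[OF this, of n] show "norm \<bar>f x - g n x\<bar> \<le> 2 * K" by simp
    qed
  qed auto
  then show ?thesis by simp
qed

text \<open>Two nested limits, each by dominated convergence with the common bound \<open>K\<close>:
  first \<open>k\<close> is chosen so that the discretised path is good enough, then
  \<open>l\<close> so that window means replace the values on that grid.\<close>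

lemma window_path_L1_approx:
  assumes fin: "finite I" and P: "prob_space P" and sP: "sets P = sets (borel_of_topology (skorokhod_topology I))"
    and F: "continuous_map (skorokhod_topology I) euclideanreal F"
    and bd: "\<And>x. x \<in> skorokhod_space I \<Longrightarrow> \<bar>F x\<bar> \<le> K" and e: "0 < e"
  shows "\<exists>k l. (\<integral>x. \<bar>F x - F (window_path I k l x)\<bar> \<partial>P) < e"
proof -
  interpret prob_space P by fact
  have spP: "space P = skorokhod_space I"
    using sets_eq_imp_space_eq[OF sP] fin by simp
  have meas: "G \<in> borel_measurable P" if "continuous_map (skorokhod_topology I) euclideanreal G" for G
    using continuous_map_borel_measurable[OF that] measurable_cong_sets[OF sP refl] by blast
  define G where "G k x = F (step_path I (Suc k) (\<lambda>(j, i). x (real j / real (Suc k)) i))" for k x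
  define H where "H k l x = F (window_path I k l x)" for k l x
  have [measurable]: "H k l \<in> borel_measurable P" for k l
    unfolding H_def by (rule meas[OF continuous_map_window_path[OF fin F]])
  have HG: "(\<lambda>l. H k l x) \<longlonglongrightarrow> G k x" if "x \<in> space P" for k x
    unfolding H_def G_def using that spP by (intro window_path_tendsto[OF fin F]) simp
  \<comment> \<open>\<open>G k\<close> reads the path at fixed times and need not be continuous; it
    is measurable as a pointwise limit of the continuous functions \<open>H k l\<close>.\<close>
  have [measurable]: "G k \<in> borel_measurable P" for k
    by (rule borel_measurable_LIMSEQ_real[OF HG]) auto
  have GF: "(\<lambda>k. G k x) \<longlonglongrightarrow> F x" if "x \<in> space P" for x
    unfolding G_def using that spP by (intro continuous_map_tendsto[OF F] discretisation_limitin[OF fin]) simp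
  have [measurable]: "F \<in> borel_measurable P" by (rule meas[OF F])
  have Hb: "\<bar>H k l x\<bar> \<le> K" for k l x
    unfolding H_def by (intro bd window_path_in_skorokhod_space)
  have Gb: "\<bar>G k x\<bar> \<le> K" for k x
    unfolding G_def by (intro bd step_path_in_skorokhod_space) simp
  have Fb: "\<bar>F x\<bar> \<le> K" if "x \<in> space P" for x using bd that spP by simp
  have "(\<lambda>k. \<integral>x. \<bar>F x - G k x\<bar> \<partial>P) \<longlonglongrightarrow> 0"
    by (rule integral_diff_tendsto_0[where K = K]) (auto intro: GF Gb Fb finite_measure_axioms)
  then have "eventually (\<lambda>k. (\<integral>x. \<bar>F x - G k x\<bar> \<partial>P) < e / 2) sequentially"
    by (rule order_tendstoD) (use e in simp)
  then obtain k where k: "(\<integral>x. \<bar>F x - G k x\<bar> \<partial>P) < e / 2"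
    by (auto simp: eventually_sequentially)
  have "(\<lambda>l. \<integral>x. \<bar>G k x - H k l x\<bar> \<partial>P) \<longlonglongrightarrow> 0"
    by (rule integral_diff_tendsto_0[where K = K]) (auto intro: HG Gb Hb finite_measure_axioms)
  then have "eventually (\<lambda>l. (\<integral>x. \<bar>G k x - H k l x\<bar> \<partial>P) < e / 2) sequentially"
    by (rule order_tendstoD) (use e in simp)
  then obtain l where l: "(\<integral>x. \<bar>G k x - H k l x\<bar> \<partial>P) < e / 2"
    by (auto simp: eventually_sequentially)
  have int: "integrable P (\<lambda>x. \<bar>F x - G k x\<bar>)" "integrable P (\<lambda>x. \<bar>G k x - H k l x\<bar>)"
      "integrable P (\<lambda>x. \<bar>F x - H k l x\<bar>)"
  proof -
    have *: "integrable P (\<lambda>x. \<bar>u x - v x\<bar>)"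
      if [measurable]: "u \<in> borel_measurable P" "v \<in> borel_measurable P"
        and "\<And>x. x \<in> space P \<Longrightarrow> \<bar>u x\<bar> \<le> K" "\<And>x. x \<in> space P \<Longrightarrow> \<bar>v x\<bar> \<le> K" for u v
    proof (rule integrable_const_bound[where B = "2 * K"])
      show "AE x in P. norm \<bar>u x - v x\<bar> \<le> 2 * K"
      proof (rule AE_I2)
        fix x assume "x \<in> space P"
        from that(3)[OF this] that(4)[OF this] show "norm \<bar>u x - v x\<bar> \<le> 2 * K" by simp
      qed
    qed simp
    show "integrable P (\<lambda>x. \<bar>F x - G k x\<bar>)" "integrable P (\<lambda>x. \<bar>G k x - H k l x\<bar>)"
      "integrable P (\<lambda>x. \<bar>F x - H k l x\<bar>)"
      by (rule *; simp add: Fb Gb Hb)+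
  qed
  have "(\<integral>x. \<bar>F x - H k l x\<bar> \<partial>P) \<le> (\<integral>x. \<bar>F x - G k x\<bar> + \<bar>G k x - H k l x\<bar> \<partial>P)"
    using int by (intro integral_mono) auto
  also have "\<dots> = (\<integral>x. \<bar>F x - G k x\<bar> \<partial>P) + (\<integral>x. \<bar>G k x - H k l x\<bar> \<partial>P)"
    using int by simp
  also have "\<dots> < e" using k l by simp
  finally show ?thesis unfolding H_def by blast
qed

text \<open>Off a set of small \<open>\<beta>\<close>-mass the density \<open>\<beta>\<close> is dominated by a multiple of \<open>\<alpha>\<close>, so
  closeness in \<open>L\<^sup>1(P)\<close> controls the \<open>\<beta>\<close>-integrals as well, without any tightness.\<close>

lemma weak_limit_change_density:
  fixes V :: "nat \<Rightarrow> 'e \<Rightarrow> real \<Rightarrow> 'i \<Rightarrow> real" and \<alpha> \<beta> :: "'e \<Rightarrow> real"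
  assumes fin: "finite I" and P: "prob_space P" and sP: "sets P = sets (borel_of_topology (skorokhod_topology I))"
    and V: "\<And>n. V n \<in> M \<rightarrow>\<^sub>M borel_of_topology (skorokhod_topology I)"
    and \<alpha>: "integrable M \<alpha>" "AE x in M. 0 < \<alpha> x" and \<beta>: "integrable M \<beta>" "AE x in M. 0 \<le> \<beta> x"
    and conv: "\<And>F. continuous_map (skorokhod_topology I) euclideanreal F \<Longrightarrow> bounded (F ` skorokhod_space I) \<Longrightarrow>
      (\<lambda>n. \<integral>x. F (V n x) * \<alpha> x \<partial>M) \<longlonglongrightarrow> (\<integral>y. F y \<partial>P)"
    and decor: "\<And>F k l. continuous_map (skorokhod_topology I) euclideanreal F \<Longrightarrow> bounded (F ` skorokhod_space I) \<Longrightarrow>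
      (\<lambda>n. \<integral>x. F (window_path I k l (V n x)) * (\<beta> x - \<alpha> x) \<partial>M) \<longlonglongrightarrow> 0"
    and F: "continuous_map (skorokhod_topology I) euclideanreal F" "bounded (F ` skorokhod_space I)"
  shows "(\<lambda>n. \<integral>x. F (V n x) * \<beta> x \<partial>M) \<longlonglongrightarrow> (\<integral>y. F y \<partial>P)"
proof (rule tendstoI)
  fix e :: real assume e: "0 < e"
  obtain K where K: "\<And>y. y \<in> skorokhod_space I \<Longrightarrow> \<bar>F y\<bar> \<le> K"
    using F(2) unfolding bounded_iff by auto
  note [measurable] = borel_measurable_integrable[OF \<alpha>(1)] borel_measurable_integrable[OF \<beta>(1)]
  have Vsp: "V n x \<in> skorokhod_space I" if "x \<in> space M" for n x
    using measurable_space[OF V that] fin by simp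
  have meas: "(\<lambda>x. H (V n x)) \<in> borel_measurable M"
    if "continuous_map (skorokhod_topology I) euclideanreal H" for H n
    using measurable_compose[OF V continuous_map_borel_measurable[OF that]] .
  \<comment> \<open>The part of \<beta> where it exceeds \<open>c\<close> times \<alpha>. Its mass
    tends to 0 because \<alpha> is positive almost everywhere and \<beta> is integrable.\<close>
  define b where "b c x = \<beta> x * indicator {x. real c * \<alpha> x < \<beta> x} x" for c x
  have "(\<lambda>c. \<integral>x. b c x \<partial>M) \<longlonglongrightarrow> (\<integral>x. 0 \<partial>M)"
  proof (rule integral_dominated_convergence[where w = "\<lambda>x. \<bar>\<beta> x\<bar>"])
    have "{x \<in> space M. real c * \<alpha> x < \<beta> x} \<in> sets M" for c by measurable
    then show [measurable]: "b c \<in> borel_measurable M" for c unfolding b_def by measurable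
    show "AE x in M. (\<lambda>c. b c x) \<longlonglongrightarrow> 0"
      using \<alpha>(2)
    proof eventually_elim
      case (elim x)
      obtain c0 where c0: "\<beta> x / \<alpha> x \<le> real c0" using real_arch_simple by blast
      have "eventually (\<lambda>c. b c x = 0) sequentially"
        using eventually_ge_at_top[of c0]
      proof eventually_elim
        case (elim c)
        then have "\<beta> x / \<alpha> x \<le> real c" using c0 by (meson of_nat_le_iff order_trans)
        then show ?case using \<open>0 < \<alpha> x\<close> by (simp add: b_def pos_divide_le_eq)
      qed
      then show ?case by (rule tendsto_eventually)
    qed
    show "AE x in M. norm (b c x) \<le> \<bar>\<beta> x\<bar>" for c
      by (auto simp: b_def indicator_def)
  qed (use \<beta> in auto)
  then have "(\<lambda>c. 2 * K * (\<integral>x. b c x \<partial>M)) \<longlonglongrightarrow> 0"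
    by (intro tendsto_mult_right_zero) simp
  then have "eventually (\<lambda>c. 2 * K * (\<integral>x. b c x \<partial>M) < e / 4) sequentially"
    by (rule order_tendstoD) (use e in simp)
  then obtain c where c: "2 * K * (\<integral>x. b c x \<partial>M) < e / 4"
    by (auto simp: eventually_sequentially)
  \<comment> \<open>The precision under P must beat the factor \<open>c + 1\<close> of the estimate
    below, so \<open>c\<close> is fixed before \<open>k\<close> and \<open>l\<close>.\<close>
  have "0 < e / (4 * (real c + 1))" using e by simp
  from window_path_L1_approx[OF fin P sP F(1) K this]
  obtain k l where kl: "(\<integral>y. \<bar>F y - F (window_path I k l y)\<bar> \<partial>P) < e / (4 * (real c + 1))" by blast
  define G where "G y = F (window_path I k l y)" for y
  define H where "H y = \<bar>F y - G y\<bar>" for y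
  have G: "continuous_map (skorokhod_topology I) euclideanreal G"
    unfolding G_def by (rule continuous_map_window_path[OF fin F(1)])
  have H: "continuous_map (skorokhod_topology I) euclideanreal H"
    unfolding H_def by (intro continuous_map_real_abs continuous_map_diff F(1) G)
  have Gb: "\<bar>G y\<bar> \<le> K" for y
    unfolding G_def by (intro K window_path_in_skorokhod_space)
  have Hb: "\<bar>H y\<bar> \<le> 2 * K" if "y \<in> skorokhod_space I" for y
    using K[OF that] Gb[of y] unfolding H_def by linarith
  have Hbdd: "bounded (H ` skorokhod_space I)" using Hb unfolding bounded_iff by auto
  note [measurable] = meas[OF F(1)] meas[OF G] meas[OF H]
  have int: "integrable M (\<lambda>x. f (V n x) * \<gamma> x)"
    if "continuous_map (skorokhod_topology I) euclideanreal f" "\<And>y. y \<in> skorokhod_space I \<Longrightarrow> \<bar>f y\<bar> \<le> K'"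
      "integrable M \<gamma>" for f n \<gamma> K'
  proof (rule Bochner_Integration.integrable_bound)
    show "integrable M (\<lambda>x. K' * \<gamma> x)" using that(3) by simp
    show "(\<lambda>x. f (V n x) * \<gamma> x) \<in> borel_measurable M"
      using meas[OF that(1)] borel_measurable_integrable[OF that(3)] by simp
    show "AE x in M. norm (f (V n x) * \<gamma> x) \<le> norm (K' * \<gamma> x)"
    proof (rule AE_I2)
      fix x assume "x \<in> space M"
      from that(2)[OF Vsp[OF this]] have "\<bar>f (V n x)\<bar> \<le> \<bar>K'\<bar>" by (rule order_trans) simp
      then show "norm (f (V n x) * \<gamma> x) \<le> norm (K' * \<gamma> x)"
        by (simp add: abs_mult mult_right_mono)
    qed
  qed
  have bint: "integrable M (b c)"
  proof (rule Bochner_Integration.integrable_bound[OF \<beta>(1)])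
    have "{x \<in> space M. real c * \<alpha> x < \<beta> x} \<in> sets M" by measurable
    then show "b c \<in> borel_measurable M" unfolding b_def by measurable
  qed (auto simp: b_def indicator_def)
  \<comment> \<open>Decorrelation takes care of \<open>G\<close>. The remainder is at most
    \<open>H\<close> times \<alpha> + \<beta>: where \<beta> is at most \<open>c\<close> times
    \<alpha> this is within \<open>(c + 1)\<close> times \<open>H\<close> times \<alpha>, and
    elsewhere the crude bound \<open>2 * K\<close> for \<open>H\<close> meets the small mass of
    \<open>b c\<close>.\<close>
  have split: "\<bar>(\<integral>x. F (V n x) * \<beta> x \<partial>M) - (\<integral>x. F (V n x) * \<alpha> x \<partial>M)\<bar>
      \<le> \<bar>\<integral>x. G (V n x) * (\<beta> x - \<alpha> x) \<partial>M\<bar> + ((real c + 1) * (\<integral>x. H (V n x) * \<alpha> x \<partial>M) + 2 * K * (\<integral>x. b c x \<partial>M))"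
    for n
  proof -
    have i1: "integrable M (\<lambda>x. F (V n x) * \<beta> x)" "integrable M (\<lambda>x. F (V n x) * \<alpha> x)"
        "integrable M (\<lambda>x. G (V n x) * (\<beta> x - \<alpha> x))" "integrable M (\<lambda>x. F (V n x) * (\<beta> x - \<alpha> x))"
        "integrable M (\<lambda>x. H (V n x) * \<alpha> x)"
      using \<alpha>(1) \<beta>(1) by (auto intro: int[OF F(1) K] int[OF G Gb] int[OF H Hb])
    have i2: "integrable M (\<lambda>x. (F (V n x) - G (V n x)) * (\<beta> x - \<alpha> x))"
      using Bochner_Integration.integrable_diff[OF i1(4) i1(3)] by (simp add: left_diff_distrib)
    have "(\<integral>x. F (V n x) * \<beta> x \<partial>M) - (\<integral>x. F (V n x) * \<alpha> x \<partial>M)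
        = (\<integral>x. F (V n x) * (\<beta> x - \<alpha> x) \<partial>M)"
      using i1 by (simp add: right_diff_distrib)
    also have "\<dots> = (\<integral>x. G (V n x) * (\<beta> x - \<alpha> x) + (F (V n x) - G (V n x)) * (\<beta> x - \<alpha> x) \<partial>M)"
      by (simp add: algebra_simps)
    also have "\<dots> = (\<integral>x. G (V n x) * (\<beta> x - \<alpha> x) \<partial>M) + (\<integral>x. (F (V n x) - G (V n x)) * (\<beta> x - \<alpha> x) \<partial>M)"
      by (rule Bochner_Integration.integral_add[OF i1(3) i2])
    finally have "\<bar>(\<integral>x. F (V n x) * \<beta> x \<partial>M) - (\<integral>x. F (V n x) * \<alpha> x \<partial>M)\<bar>
        \<le> \<bar>\<integral>x. G (V n x) * (\<beta> x - \<alpha> x) \<partial>M\<bar> + \<bar>\<integral>x. (F (V n x) - G (V n x)) * (\<beta> x - \<alpha> x) \<partial>M\<bar>"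
      by linarith
    moreover have "\<bar>\<integral>x. (F (V n x) - G (V n x)) * (\<beta> x - \<alpha> x) \<partial>M\<bar>
        \<le> (\<integral>x. \<bar>(F (V n x) - G (V n x)) * (\<beta> x - \<alpha> x)\<bar> \<partial>M)"
      using integral_norm_bound[of M "\<lambda>x. (F (V n x) - G (V n x)) * (\<beta> x - \<alpha> x)"] by simp
    moreover have "\<dots> \<le> (\<integral>x. (real c + 1) * (H (V n x) * \<alpha> x) + 2 * K * b c x \<partial>M)"
    proof (rule integral_mono_AE)
      show "integrable M (\<lambda>x. \<bar>(F (V n x) - G (V n x)) * (\<beta> x - \<alpha> x)\<bar>)" using i2 by simp
      show "integrable M (\<lambda>x. (real c + 1) * (H (V n x) * \<alpha> x) + 2 * K * b c x)"
        using i1(5) bint by (intro Bochner_Integration.integrable_add integrable_mult_right)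
      show "AE x in M. \<bar>(F (V n x) - G (V n x)) * (\<beta> x - \<alpha> x)\<bar> \<le> (real c + 1) * (H (V n x) * \<alpha> x) + 2 * K * b c x"
        using \<alpha>(2) \<beta>(2) AE_space
      proof eventually_elim
        case (elim x)
        have H0: "0 \<le> H (V n x)" "H (V n x) \<le> 2 * K"
          using Hb[OF Vsp[OF elim(3)], of n] by (auto simp: H_def)
        have "\<bar>\<beta> x - \<alpha> x\<bar> \<le> \<beta> x + \<alpha> x" using elim by simp
        then have "\<bar>(F (V n x) - G (V n x)) * (\<beta> x - \<alpha> x)\<bar> \<le> H (V n x) * (\<beta> x + \<alpha> x)"
          unfolding abs_mult H_def by (intro mult_left_mono) auto
        moreover have "H (V n x) * \<beta> x \<le> real c * (H (V n x) * \<alpha> x) + 2 * K * b c x"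
        proof (cases "real c * \<alpha> x < \<beta> x")
          case True
          then have "b c x = \<beta> x" by (simp add: b_def)
          moreover have "H (V n x) * \<beta> x \<le> 2 * K * \<beta> x" using H0 elim by (intro mult_right_mono) auto
          ultimately show ?thesis using H0 elim by (simp add: add_increasing)
        next
          case False
          then have "b c x = 0" by (simp add: b_def)
          moreover have "H (V n x) * \<beta> x \<le> H (V n x) * (real c * \<alpha> x)"
            using False H0 by (intro mult_left_mono) auto
          ultimately show ?thesis by (simp add: mult_ac)
        qed
        ultimately show ?case by (simp add: algebra_simps)
      qed
    qed
    moreover have "\<dots> = (real c + 1) * (\<integral>x. H (V n x) * \<alpha> x \<partial>M) + 2 * K * (\<integral>x. b c x \<partial>M)"
      using i1(5) bint by simp
    ultimately show ?thesis by linarith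
  qed
  have "(\<lambda>n. (real c + 1) * (\<integral>x. H (V n x) * \<alpha> x \<partial>M)) \<longlonglongrightarrow> (real c + 1) * (\<integral>y. H y \<partial>P)"
    by (intro tendsto_mult tendsto_const conv[OF H Hbdd])
  moreover have "(real c + 1) * (\<integral>y. H y \<partial>P) < e / 4"
    using kl by (simp add: H_def G_def field_simps)
  ultimately have E1: "eventually (\<lambda>n. (real c + 1) * (\<integral>x. H (V n x) * \<alpha> x \<partial>M) < e / 4) sequentially"
    by (rule order_tendstoD)
  have E2: "eventually (\<lambda>n. dist (\<integral>x. G (V n x) * (\<beta> x - \<alpha> x) \<partial>M) 0 < e / 4) sequentially"
    unfolding G_def by (rule tendstoD[OF decor[OF F]]) (use e in simp)
  have E3: "eventually (\<lambda>n. dist (\<integral>x. F (V n x) * \<alpha> x \<partial>M) (\<integral>y. F y \<partial>P) < e / 4) sequentially"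
    by (rule tendstoD[OF conv[OF F]]) (use e in simp)
  show "eventually (\<lambda>n. dist (\<integral>x. F (V n x) * \<beta> x \<partial>M) (\<integral>y. F y \<partial>P) < e) sequentially"
    using E1 E2 E3
  proof eventually_elim
    case (elim n)
    then show ?case using split[of n] c unfolding dist_real_def by linarith
  qed
qed

section \<open>The truncated processes\<close>

lemma nn_integral_le_Lp_norm:
  fixes f :: "'a \<Rightarrow> real"
  assumes "prob_space M" and f: "f \<in> borel_measurable M" and p: "1 \<le> p" and c: "0 < c"
    and le: "Lp_norm M p f \<le> ennreal c"
  shows "(\<integral>\<^sup>+x. ennreal \<bar>f x\<bar> \<partial>M) \<le> ennreal (2 * c)"
proof (cases "p = \<infinity>")
  interpret prob_space M by fact
  case True
  have "AE x in M. ennreal \<bar>f x\<bar> \<le> esssup M (\<lambda>x. ennreal \<bar>f x\<bar>)" by (rule esssup_AE)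
  then have "AE x in M. ennreal \<bar>f x\<bar> \<le> ennreal c"
    by eventually_elim (use le True in \<open>auto simp: Lp_norm_def\<close>)
  then have "(\<integral>\<^sup>+x. ennreal \<bar>f x\<bar> \<partial>M) \<le> (\<integral>\<^sup>+x. ennreal c \<partial>M)" by (rule nn_integral_mono_AE)
  also have "\<dots> \<le> ennreal (2 * c)" using c by (simp add: emeasure_space_1 ennreal_leI)
  finally show ?thesis .
next
  interpret prob_space M by fact
  note [measurable] = f
  case False
  define P where "P = enn2real p"
  have P: "1 \<le> P"
    using p False enn2real_mono[of 1 p] unfolding P_def by (simp add: top.not_eq_extremum)
  define J where "J = (\<integral>\<^sup>+x. ennreal (\<bar>f x\<bar> powr P) \<partial>M)"
  \<comment> \<open>\<open>Lp_norm\<close> is infinite by definition when the integral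
    \<open>J\<close> is, so a finite norm makes \<open>enn2real J\<close> the true value.\<close>
  have J: "J \<noteq> \<infinity>" and root: "enn2real J powr (1 / P) \<le> c"
    using le False c unfolding Lp_norm_def J_def P_def Let_def by (auto split: if_splits simp: top_unique)
  have "enn2real J = (enn2real J powr (1 / P)) powr P" using P by (simp add: powr_powr)
  also have "\<dots> \<le> c powr P" using root P by (intro powr_mono2) auto
  finally have Jle: "J \<le> ennreal (c powr P)"
    using J by (metis ennreal_enn2real ennreal_leI infinity_ennreal_def top.not_eq_extremum)
  \<comment> \<open>Where \<open>\<bar>f x\<bar> / c\<close> exceeds 1, raising it to the power
    \<open>P \<ge> 1\<close> increases it. This elementary bound replaces Jensen's inequality and
    costs only a factor 2.\<close>
  have "ennreal \<bar>f x\<bar> \<le> ennreal c + ennreal (c / c powr P) * ennreal (\<bar>f x\<bar> powr P)" for x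
  proof -
    have "\<bar>f x\<bar> \<le> c + c / c powr P * \<bar>f x\<bar> powr P"
    proof (cases "\<bar>f x\<bar> \<le> c")
      case True
      then show ?thesis using c by (simp add: add_increasing2)
    next
      case False
      then have "1 \<le> \<bar>f x\<bar> / c" using c by simp
      then have "(\<bar>f x\<bar> / c) powr 1 \<le> (\<bar>f x\<bar> / c) powr P" using P by (intro powr_mono) auto
      then have "c * (\<bar>f x\<bar> / c) \<le> c * (\<bar>f x\<bar> / c) powr P"
        using c by (intro mult_left_mono) auto
      also have "(\<bar>f x\<bar> / c) powr P = \<bar>f x\<bar> powr P / c powr P" using c by (simp add: powr_divide)
      finally show ?thesis using c by simp
    qed
    then have "ennreal \<bar>f x\<bar> \<le> ennreal (c + c / c powr P * \<bar>f x\<bar> powr P)" by (rule ennreal_leI)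
    also have "\<dots> = ennreal c + ennreal (c / c powr P) * ennreal (\<bar>f x\<bar> powr P)"
      using c by (subst ennreal_plus, simp, simp, subst ennreal_mult) auto
    finally show ?thesis .
  qed
  then have "(\<integral>\<^sup>+x. ennreal \<bar>f x\<bar> \<partial>M) \<le>
      (\<integral>\<^sup>+x. ennreal c + ennreal (c / c powr P) * ennreal (\<bar>f x\<bar> powr P) \<partial>M)"
    by (intro nn_integral_mono)
  also have "\<dots> = ennreal c + ennreal (c / c powr P) * J"
    unfolding J_def by (subst nn_integral_add) (auto simp: nn_integral_cmult emeasure_space_1)
  also have "\<dots> \<le> ennreal c + ennreal (c / c powr P) * ennreal (c powr P)"
    using Jle by (intro add_left_mono mult_left_mono) auto
  also have "\<dots> = ennreal (2 * c)"
    using c by (simp add: ennreal_mult[symmetric] ennreal_plus[symmetric] del: ennreal_plus)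
  finally show ?thesis .
qed

lemma Lp_norm_imp_integrable:
  fixes f :: "'a \<Rightarrow> real"
  assumes "prob_space M" and "f \<in> borel_measurable M" and "1 \<le> p" and "0 < c"
    and "Lp_norm M p f \<le> ennreal c"
  shows "integrable M f" and "(\<integral>x. \<bar>f x\<bar> \<partial>M) \<le> 2 * c"
proof -
  have le: "(\<integral>\<^sup>+x. ennreal \<bar>f x\<bar> \<partial>M) \<le> ennreal (2 * c)" by (rule nn_integral_le_Lp_norm[OF assms])
  then have "(\<integral>\<^sup>+x. ennreal (norm (f x)) \<partial>M) < \<infinity>"
    using order_le_less_trans[OF le ennreal_less_top] by simp
  then show int: "integrable M f" using assms(2) by (simp add: integrable_iff_bounded)
  have "ennreal (\<integral>x. \<bar>f x\<bar> \<partial>M) = (\<integral>\<^sup>+x. ennreal \<bar>f x\<bar> \<partial>M)"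
    using int by (intro nn_integral_eq_integral[symmetric]) auto
  then have "ennreal (\<integral>x. \<bar>f x\<bar> \<partial>M) \<le> ennreal (2 * c)" using le by (simp only:)
  then show "(\<integral>x. \<bar>f x\<bar> \<partial>M) \<le> 2 * c" using assms(4) by (subst (asm) ennreal_le_iff) auto
qed

section \<open>Window means as weighted sums over the discrete time\<close>

lemma window_mean_cong:
  assumes "\<And>t. t \<in> {s..s + \<eta>} \<Longrightarrow> y t = z t"
  shows "window_mean \<eta> s y = window_mean \<eta> s z"
proof -
  have "indicator {s..s + \<eta>} t * y t = indicator {s..s + \<eta>} t * z t" for t
    using assms[of t] by (cases "t \<in> {s..s + \<eta>}") auto
  then show ?thesis unfolding window_mean_def by (simp only:)
qed

text \<open>The share of the window during which the discrete time equals \<open>r\<close>. These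
  are probability weights free of the sample point, so the window mean of a process is a finite sum:
  measurability is immediate and expectations pass to the terms.\<close>

definition window_weight :: "real \<Rightarrow> real \<Rightarrow> nat \<Rightarrow> nat \<Rightarrow> real" where
  "window_weight \<eta> s n r = window_mean \<eta> s (\<lambda>t. indicator {r} (nat \<lfloor>real n * t\<rfloor>))"

lemma measurable_floor_indicator:
  "(\<lambda>t. indicator {r} (nat \<lfloor>real n * t\<rfloor>) :: real) \<in> borel_measurable borel"
proof -
  have "(\<lambda>t. indicator {r} (nat \<lfloor>real n * t\<rfloor>) :: real) = indicator {t. nat \<lfloor>real n * t\<rfloor> = r}"
    by (auto simp: indicator_def fun_eq_iff)
  moreover have "{t \<in> space borel. nat \<lfloor>real n * t\<rfloor> = r} \<in> sets borel" by measurable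
  ultimately show ?thesis by simp
qed

lemma window_weight_nonneg: "0 < \<eta> \<Longrightarrow> 0 \<le> window_weight \<eta> s n r"
  unfolding window_weight_def window_mean_def by (intro divide_nonneg_pos Bochner_Integration.integral_nonneg) auto

lemma window_mean_floor:
  assumes s: "0 \<le> s" and \<eta>: "0 < \<eta>"
  shows "window_mean \<eta> s (\<lambda>t. w (nat \<lfloor>real n * t\<rfloor>))
    = (\<Sum>r\<le>nat \<lfloor>real n * (s + \<eta>)\<rfloor>. window_weight \<eta> s n r * w r)"
proof -
  define R where "R = nat \<lfloor>real n * (s + \<eta>)\<rfloor>"
  have "window_mean \<eta> s (\<lambda>t. w (nat \<lfloor>real n * t\<rfloor>))
      = window_mean \<eta> s (\<lambda>t. \<Sum>r\<le>R. w r * indicator {r} (nat \<lfloor>real n * t\<rfloor>))"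
  proof (rule window_mean_cong)
    fix t assume t: "t \<in> {s..s + \<eta>}"
    then have "nat \<lfloor>real n * t\<rfloor> \<le> R"
      unfolding R_def by (intro nat_mono floor_mono mult_left_mono) auto
    then have "w (nat \<lfloor>real n * t\<rfloor>) = (\<Sum>r\<le>R. if r = nat \<lfloor>real n * t\<rfloor> then w r else 0)" by simp
    also have "\<dots> = (\<Sum>r\<le>R. w r * indicator {r} (nat \<lfloor>real n * t\<rfloor>))"
      by (intro sum.cong) (auto simp: indicator_def)
    finally show "w (nat \<lfloor>real n * t\<rfloor>) = (\<Sum>r\<le>R. w r * indicator {r} (nat \<lfloor>real n * t\<rfloor>))" .
  qed
  also have "\<dots> = (\<Sum>r\<le>R. window_weight \<eta> s n r * w r)"
  proof -
    have int: "integrable lborel (\<lambda>t. indicator {s..s + \<eta>} t * indicator {r} (nat \<lfloor>real n * t\<rfloor>) :: real)" for r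
      by (rule window_integrable[where K = 1]) (auto simp: measurable_floor_indicator indicator_def)
    have "(\<integral>t. indicator {s..s + \<eta>} t * (\<Sum>r\<le>R. w r * indicator {r} (nat \<lfloor>real n * t\<rfloor>)) \<partial>lborel)
        = (\<integral>t. (\<Sum>r\<le>R. w r * (indicator {s..s + \<eta>} t * indicator {r} (nat \<lfloor>real n * t\<rfloor>))) \<partial>lborel)"
      by (simp only: sum_distrib_left mult.left_commute)
    also have "\<dots> = (\<Sum>r\<le>R. w r * (\<integral>t. indicator {s..s + \<eta>} t * indicator {r} (nat \<lfloor>real n * t\<rfloor>) \<partial>lborel))"
      using int by (subst Bochner_Integration.integral_sum) auto
    finally show ?thesis
      by (simp add: window_mean_def window_weight_def sum_divide_distrib mult_ac)
  qed
  finally show ?thesis by (simp add: R_def)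
qed

lemma sum_window_weight:
  assumes "0 \<le> s" and "0 < \<eta>"
  shows "(\<Sum>r\<le>nat \<lfloor>real n * (s + \<eta>)\<rfloor>. window_weight \<eta> s n r) = 1"
  using window_mean_floor[OF assms, of "\<lambda>_. 1" n] window_mean_const[OF assms(2), of s 1] by simp

text \<open>The result depends on \<open>X\<^sub>N, X\<^sub>N\<^sub>+\<^sub>1, \<dots>\<close> only; \<open>h\<close> needs no truncation, since \<open>i \<ge> N\<close> and \<open>j > i\<close>
  give \<open>j \<ge> N\<close>.\<close>

definition coord_value ::
  "(nat \<Rightarrow> 'e \<Rightarrow> 'x) \<Rightarrow> (nat \<Rightarrow> nat \<Rightarrow> (nat \<Rightarrow> 'x) \<Rightarrow> nat \<Rightarrow> real) \<Rightarrow>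
   (nat \<Rightarrow> nat \<Rightarrow> nat \<Rightarrow> (nat \<Rightarrow> 'x) \<Rightarrow> real) \<Rightarrow> (nat \<Rightarrow> nat \<Rightarrow> nat \<Rightarrow> (nat \<Rightarrow> 'x) \<Rightarrow> real) \<Rightarrow>
   nat \<Rightarrow> nat \<Rightarrow> coord \<Rightarrow> nat \<Rightarrow> 'e \<Rightarrow> real" where
  "coord_value X g f h N n c r x = (case c of
      LCoord i a \<Rightarrow> birkhoff_sum X (\<lambda>j y. if j < N then 0 else g i j y a) r x / sqrt (real n)
    | RCoord k u v \<Rightarrow> iterated_sum X (\<lambda>j y. if j < N then 0 else f k u j y) (h k v) r x / real n)"

definition tail_process ::
  "(nat \<Rightarrow> 'e \<Rightarrow> 'x) \<Rightarrow> coord set \<Rightarrow> (nat \<Rightarrow> nat \<Rightarrow> (nat \<Rightarrow> 'x) \<Rightarrow> nat \<Rightarrow> real) \<Rightarrow>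
   (nat \<Rightarrow> nat \<Rightarrow> nat \<Rightarrow> (nat \<Rightarrow> 'x) \<Rightarrow> real) \<Rightarrow> (nat \<Rightarrow> nat \<Rightarrow> nat \<Rightarrow> (nat \<Rightarrow> 'x) \<Rightarrow> real) \<Rightarrow>
   nat \<Rightarrow> nat \<Rightarrow> 'e \<Rightarrow> real \<Rightarrow> coord \<Rightarrow> real" where
  "tail_process X I g f h N n x =
    (\<lambda>t\<in>{0..}. \<lambda>c\<in>I. coord_value X g f h N n c (nat \<lfloor>real n * t\<rfloor>) x)"

lemma tail_process_0:
  "tail_process X (coords d m dims p q) g f h 0 = V_process X d m dims p q g f h"
  by (simp add: tail_process_def V_process_def coord_value_def fun_eq_iff)

lemma window_array_tail_process:
  assumes "c \<in> I"
  shows "window_array K l (tail_process X I g f h N n x) (j, c) =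
    max (- real (Suc l)) (min (real (Suc l))
      (\<Sum>r\<le>nat \<lfloor>real n * (real j / real K + 1 / real (Suc l))\<rfloor>.
        window_weight (1 / real (Suc l)) (real j / real K) n r * coord_value X g f h N n c r x))"
proof -
  have "window_mean (1 / real (Suc l)) (real j / real K) (\<lambda>t. tail_process X I g f h N n x t c)
      = window_mean (1 / real (Suc l)) (real j / real K) (\<lambda>t. coord_value X g f h N n c (nat \<lfloor>real n * t\<rfloor>) x)"
  proof (rule window_mean_cong)
    fix t assume "t \<in> {real j / real K..real j / real K + 1 / real (Suc l)}"
    then have "real j / real K \<le> t" by simp
    moreover have "0 \<le> real j / real K" by simp
    ultimately have "0 \<le> t" by linarith
    then show "tail_process X I g f h N n x t c = coord_value X g f h N n c (nat \<lfloor>real n * t\<rfloor>) x"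
      using assms by (simp add: tail_process_def)
  qed
  then show ?thesis
    by (simp add: window_array_def window_mean_floor[of _ _ "\<lambda>r. coord_value X g f h N n c r x"])
qed

section \<open>Truncated processes as functions of the future\<close>

lemma coord_value_future:
  "coord_value X g f h N n c r x = coord_value (\<lambda>j z. z j) g f h N n c r (future X N x)"
proof -
  \<comment> \<open>With the coordinate projections in place of \<open>X\<close>, the same formula
    defines a function on sequences indexed from \<open>N\<close> on. Later futures can be recovered
    from such a sequence, and the truncated sums ask for no earlier ones.\<close>
  have fut: "future (\<lambda>j z. z j) j (future X N x) = future X j x" if "N \<le> j" for j
    using that by (auto simp: future_def restrict_def fun_eq_iff)
  show ?thesis
  proof (cases c)
    case (LCoord i a)
    then show ?thesis
      by (auto simp: coord_value_def birkhoff_sum_def fut intro!: arg_cong2[where f = "(/)"] sum.cong)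
  next
    case (RCoord k u v)
    then show ?thesis
      by (auto simp: coord_value_def iterated_sum_def fut intro!: arg_cong2[where f = "(/)"] sum.cong)
  qed
qed

lemma tail_process_future:
  "tail_process X I g f h N n x = tail_process (\<lambda>j z. z j) I g f h N n (future X N x)"
  unfolding tail_process_def using coord_value_future[of X g f h N n] by (simp add: fun_eq_iff)

lemma future_measurable:
  assumes "\<And>j. X j \<in> M \<rightarrow>\<^sub>M MX j"
  shows "future X j \<in> M \<rightarrow>\<^sub>M future_space MX j"
  unfolding future_def[abs_def] future_space_def by (rule measurable_restrict) (rule assms)

lemma future_space_measurable:
  assumes "N \<le> j"
  shows "future (\<lambda>j z. z j) j \<in> future_space MX N \<rightarrow>\<^sub>M future_space MX j"
  unfolding future_def[abs_def] future_space_def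
  by (rule measurable_restrict_subset) (use assms in auto)

text \<open>Measurability is required of the futures from \<open>N\<close> on only, so that \<Omega>
  may be \<open>future_space MX N\<close> with the coordinate projections.\<close>

lemma coord_value_measurable:
  assumes fut: "\<And>j. N \<le> j \<Longrightarrow> future X j \<in> \<Omega> \<rightarrow>\<^sub>M future_space MX j"
    and g: "\<And>i j. i \<in> {1..d} \<Longrightarrow> g i j \<in> future_space MX j \<rightarrow>\<^sub>M (\<Pi>\<^sub>M a\<in>{1..dims i}. borel)"
    and f: "\<And>k u j. k \<in> {d+1..d+m} \<Longrightarrow> u \<in> {1..p k} \<Longrightarrow> f k u j \<in> borel_measurable (future_space MX j)"
    and h: "\<And>k v j. k \<in> {d+1..d+m} \<Longrightarrow> v \<in> {1..q k} \<Longrightarrow> h k v j \<in> borel_measurable (future_space MX j)"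
    and c: "c \<in> coords d m dims p q"
  shows "coord_value X g f h N n c r \<in> borel_measurable \<Omega>"
proof (cases c)
  case (LCoord i a)
  then have ia: "i \<in> {1..d}" "a \<in> {1..dims i}" using c by (auto simp: coords_def)
  have "(\<lambda>x. if j < N then 0 else g i j (future X j x) a) \<in> borel_measurable \<Omega>" for j
  proof (cases "j < N")
    case False
    have "(\<lambda>y. g i j y a) \<in> borel_measurable (future_space MX j)"
      by (rule measurable_compose[OF g[OF ia(1)] measurable_component_singleton[OF ia(2)]])
    from measurable_compose[OF fut this] show ?thesis using False by simp
  qed simp
  then show ?thesis unfolding coord_value_def birkhoff_sum_def LCoord by simp
next
  case (RCoord k u v)
  then have kuv: "k \<in> {d+1..d+m}" "u \<in> {1..p k}" "v \<in> {1..q k}" using c by (auto simp: coords_def)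
  have "(\<lambda>x. (if i < N then 0 else f k u i (future X i x)) * h k v j (future X j x)) \<in> borel_measurable \<Omega>"
    if "i < j" for i j
  proof (cases "i < N")
    case False
    then have "N \<le> i" "N \<le> j" using that by auto
    then show ?thesis
      using measurable_compose[OF fut f[OF kuv(1,2)]] measurable_compose[OF fut h[OF kuv(1,3)]] False
      by simp
  qed simp
  then show ?thesis
    unfolding coord_value_def iterated_sum_def RCoord by (auto intro!: borel_measurable_sum borel_measurable_divide)
qed

lemma window_array_measurable:
  assumes "\<And>r. coord_value X g f h N n c r \<in> borel_measurable \<Omega>" and "c \<in> I"
  shows "(\<lambda>x. window_array K l (tail_process X I g f h N n x) (j, c)) \<in> borel_measurable \<Omega>"
proof -
  note [measurable] = assms(1)
  show ?thesis unfolding window_array_tail_process[OF assms(2)] by measurable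
qed

section \<open>Pointwise cost of the truncation\<close>

definition head_bound ::
  "(nat \<Rightarrow> 'e \<Rightarrow> 'x) \<Rightarrow> (nat \<Rightarrow> nat \<Rightarrow> (nat \<Rightarrow> 'x) \<Rightarrow> nat \<Rightarrow> real) \<Rightarrow>
   (nat \<Rightarrow> nat \<Rightarrow> nat \<Rightarrow> (nat \<Rightarrow> 'x) \<Rightarrow> real) \<Rightarrow> (nat \<Rightarrow> nat \<Rightarrow> nat \<Rightarrow> (nat \<Rightarrow> 'x) \<Rightarrow> real) \<Rightarrow>
   nat \<Rightarrow> coord \<Rightarrow> 'e \<Rightarrow> real" where
  "head_bound X g f h N c x = (case c of
      LCoord i a \<Rightarrow> \<Sum>j<N. \<bar>g i j (future X j x) a\<bar>
    | RCoord k u v \<Rightarrow> \<Sum>i<N. \<bar>f k u i (future X i x)\<bar> * (1 + \<bar>birkhoff_sum X (h k v) (Suc i) x\<bar>))"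

text \<open>It is 0 for \<open>LCoord\<close> because removing the first \<open>N\<close> terms of a
  Birkhoff sum leaves an error that does not grow with \<open>r\<close>.\<close>

definition second_sum ::
  "(nat \<Rightarrow> 'e \<Rightarrow> 'x) \<Rightarrow> (nat \<Rightarrow> nat \<Rightarrow> nat \<Rightarrow> (nat \<Rightarrow> 'x) \<Rightarrow> real) \<Rightarrow> coord \<Rightarrow> nat \<Rightarrow> 'e \<Rightarrow> real" where
  "second_sum X h c r x = (case c of LCoord i a \<Rightarrow> 0 | RCoord k u v \<Rightarrow> \<bar>birkhoff_sum X (h k v) r x\<bar>)"

lemma head_bound_nonneg: "0 \<le> head_bound X g f h N c x"
  by (auto simp: head_bound_def intro!: sum_nonneg split: coord.split)

text \<open>The point is the product form: \<open>head_bound\<close> depends on neither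
  \<open>n\<close> nor \<open>r\<close>. For the iterated sums, a removed term carries the factor
  \<open>S r - S (Suc i)\<close>, and \<bar>a\<bar> + \<bar>b\<bar> \<le> (1 + \<bar>a\<bar>) (1 +
  \<bar>b\<bar>) separates the two sums; this is where the summand 1 in \<open>head_bound\<close>
  comes from.\<close>

lemma coord_value_diff_le:
  "\<bar>coord_value X g f h 0 n c r x - coord_value X g f h N n c r x\<bar>
    \<le> head_bound X g f h N c x * (1 / sqrt (real n) + second_sum X h c r x / real n)"
proof (cases c)
  case (LCoord i a)
  have "birkhoff_sum X (\<lambda>j y. if j < 0 then 0 else g i j y a) r x
      - birkhoff_sum X (\<lambda>j y. if j < N then 0 else g i j y a) r x
      = (\<Sum>j<r. if j < N then g i j (future X j x) a else 0)"
    unfolding birkhoff_sum_def sum_subtractf[symmetric] by (intro sum.cong) auto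
  also have "\<bar>\<dots>\<bar> \<le> (\<Sum>j<r. \<bar>if j < N then g i j (future X j x) a else 0\<bar>)" by (rule sum_abs)
  also have "\<dots> = (\<Sum>j\<in>{..<r} \<inter> {..<N}. \<bar>g i j (future X j x) a\<bar>)"
    by (subst sum.inter_restrict) (auto intro!: sum.cong)
  also have "\<dots> \<le> (\<Sum>j<N. \<bar>g i j (future X j x) a\<bar>)" by (intro sum_mono2) auto
  finally have "\<bar>birkhoff_sum X (\<lambda>j y. if j < 0 then 0 else g i j y a) r x
      - birkhoff_sum X (\<lambda>j y. if j < N then 0 else g i j y a) r x\<bar> / sqrt (real n)
      \<le> (\<Sum>j<N. \<bar>g i j (future X j x) a\<bar>) / sqrt (real n)"
    by (rule divide_right_mono) simp
  then show ?thesis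
    by (simp add: LCoord coord_value_def head_bound_def second_sum_def diff_divide_distrib[symmetric])
next
  case (RCoord k u v)
  define S where "S r = birkhoff_sum X (h k v) r x" for r
  define \<phi> where "\<phi> i = f k u i (future X i x)" for i
  \<comment> \<open>The inner index starts at \<open>i + 1\<close>, so the sum up to and including
    \<open>i\<close> is subtracted.\<close>
  have inner: "(\<Sum>j\<in>{i+1..<r}. h k v j (future X j x)) = S r - S (Suc i)" if "i < r" for i
  proof -
    have "{..<r} = {..<Suc i} \<union> {i+1..<r}" using that by auto
    moreover have "(\<Sum>j\<in>{..<Suc i} \<union> {i+1..<r}. h k v j (future X j x)) =
        S (Suc i) + (\<Sum>j\<in>{i+1..<r}. h k v j (future X j x))"
      unfolding S_def birkhoff_sum_def by (rule sum.union_disjoint) auto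
    ultimately show ?thesis by (simp add: S_def birkhoff_sum_def)
  qed
  have "iterated_sum X (\<lambda>j y. if j < 0 then 0 else f k u j y) (h k v) r x
      - iterated_sum X (\<lambda>j y. if j < N then 0 else f k u j y) (h k v) r x
      = (\<Sum>i<r. if i < N then \<phi> i * (S r - S (Suc i)) else 0)"
    unfolding iterated_sum_def sum_subtractf[symmetric]
  proof (intro sum.cong refl)
    fix i assume "i \<in> {..<r}"
    then show "(\<Sum>j\<in>{i+1..<r}. (if i < 0 then 0 else f k u i (future X i x)) * h k v j (future X j x)
        - (if i < N then 0 else f k u i (future X i x)) * h k v j (future X j x))
        = (if i < N then \<phi> i * (S r - S (Suc i)) else 0)"
      using inner[of i] by (simp add: \<phi>_def sum_distrib_left[symmetric])
  qed
  also have "\<bar>\<dots>\<bar> \<le> (\<Sum>i<r. \<bar>if i < N then \<phi> i * (S r - S (Suc i)) else 0\<bar>)" by (rule sum_abs)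
  also have "\<dots> = (\<Sum>i\<in>{..<r} \<inter> {..<N}. \<bar>\<phi> i * (S r - S (Suc i))\<bar>)"
    by (subst sum.inter_restrict) (auto intro!: sum.cong)
  also have "\<dots> \<le> (\<Sum>i<N. \<bar>\<phi> i * (S r - S (Suc i))\<bar>)" by (intro sum_mono2) auto
  also have "\<dots> \<le> (\<Sum>i<N. \<bar>\<phi> i\<bar> * (1 + \<bar>S (Suc i)\<bar>) * (1 + \<bar>S r\<bar>))"
  proof (rule sum_mono)
    fix i
    have "\<bar>S r - S (Suc i)\<bar> \<le> \<bar>S r\<bar> + \<bar>S (Suc i)\<bar>" by linarith
    also have "\<dots> \<le> (1 + \<bar>S (Suc i)\<bar>) * (1 + \<bar>S r\<bar>)" by (simp add: algebra_simps)
    finally show "\<bar>\<phi> i * (S r - S (Suc i))\<bar> \<le> \<bar>\<phi> i\<bar> * (1 + \<bar>S (Suc i)\<bar>) * (1 + \<bar>S r\<bar>)"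
      unfolding abs_mult mult.assoc by (intro mult_left_mono) auto
  qed
  also have "\<dots> = (1 + \<bar>S r\<bar>) * head_bound X g f h N c x"
    by (simp add: RCoord head_bound_def S_def \<phi>_def sum_distrib_left mult_ac)
  finally have "\<bar>iterated_sum X (\<lambda>j y. if j < 0 then 0 else f k u j y) (h k v) r x
      - iterated_sum X (\<lambda>j y. if j < N then 0 else f k u j y) (h k v) r x\<bar> / real n
      \<le> (1 + \<bar>S r\<bar>) * head_bound X g f h N c x / real n"
    by (rule divide_right_mono) simp
  also have "\<dots> = head_bound X g f h N c x * (1 / real n + \<bar>S r\<bar> / real n)"
    by (simp add: add_divide_distrib distrib_left distrib_right mult.commute)
  also have "\<dots> \<le> head_bound X g f h N c x * (1 / sqrt (real n) + \<bar>S r\<bar> / real n)"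
  proof (intro mult_left_mono add_right_mono head_bound_nonneg)
    \<comment> \<open>The faster rate is given up so that both kinds of coordinates share one bound;
      for \<open>n = 0\<close> both quotients are 0 by convention.\<close>
    show "1 / real n \<le> 1 / sqrt (real n)"
    proof (cases "n = 0")
      case False
      then have "sqrt (real n) \<le> real n" by (simp add: real_sqrt_le_iff real_le_lsqrt power2_eq_square)
      then show ?thesis using False by (intro divide_left_mono) auto
    qed simp
  qed
  finally show ?thesis
    by (simp add: RCoord coord_value_def second_sum_def S_def diff_divide_distrib[symmetric])
qed

text \<open>Clipping is 1-Lipschitz, and the weights sum to 1, so the part of the error that is
  constant in \<open>r\<close> passes through the average unchanged.\<close>

lemma window_array_diff_le:
  assumes c: "c \<in> I"
  shows "\<bar>window_array K l (tail_process X I g f h 0 n x) (j, c)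
      - window_array K l (tail_process X I g f h N n x) (j, c)\<bar>
    \<le> head_bound X g f h N c x * (1 / sqrt (real n) +
      (\<Sum>r\<le>nat \<lfloor>real n * (real j / real K + 1 / real (Suc l))\<rfloor>.
        window_weight (1 / real (Suc l)) (real j / real K) n r * second_sum X h c r x) / real n)"
proof -
  define \<omega> where "\<omega> = window_weight (1 / real (Suc l)) (real j / real K) n"
  define R where "R = nat \<lfloor>real n * (real j / real K + 1 / real (Suc l))\<rfloor>"
  define E where "E = head_bound X g f h N c x"
  have \<omega>: "0 \<le> \<omega> r" for r unfolding \<omega>_def by (rule window_weight_nonneg) simp
  have one: "(\<Sum>r\<le>R. \<omega> r) = 1" unfolding \<omega>_def R_def by (rule sum_window_weight) auto
  let ?v = "\<lambda>N r. coord_value X g f h N n c r x"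
  have "\<bar>max (- L) (min L a) - max (- L) (min L b)\<bar> \<le> \<bar>a - b\<bar>" for L a b :: real
    by (auto simp: max_def min_def)
  then have "\<bar>window_array K l (tail_process X I g f h 0 n x) (j, c)
      - window_array K l (tail_process X I g f h N n x) (j, c)\<bar>
      \<le> \<bar>(\<Sum>r\<le>R. \<omega> r * ?v 0 r) - (\<Sum>r\<le>R. \<omega> r * ?v N r)\<bar>"
    unfolding window_array_tail_process[OF c] \<omega>_def R_def .
  also have "\<dots> = \<bar>\<Sum>r\<le>R. \<omega> r * (?v 0 r - ?v N r)\<bar>"
    by (simp add: right_diff_distrib sum_subtractf)
  also have "\<dots> \<le> (\<Sum>r\<le>R. \<bar>\<omega> r * (?v 0 r - ?v N r)\<bar>)" by (rule sum_abs)
  also have "\<dots> \<le> (\<Sum>r\<le>R. \<omega> r * (E * (1 / sqrt (real n) + second_sum X h c r x / real n)))"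
    using \<omega> coord_value_diff_le[of X g f h n c _ x N]
    by (intro sum_mono) (simp add: abs_mult E_def mult_left_mono)
  also have "\<dots> = E * ((\<Sum>r\<le>R. \<omega> r) * (1 / sqrt (real n)) + (\<Sum>r\<le>R. \<omega> r * second_sum X h c r x) / real n)"
    by (simp add: sum_distrib_left sum_distrib_right sum_divide_distrib sum.distrib algebra_simps)
  finally show ?thesis unfolding one mult_1 by (simp only: \<omega>_def R_def E_def)
qed

section \<open>Decorrelation\<close>

lemma tendsto_0_subseq:
  fixes u :: "nat \<Rightarrow> real"
  assumes sub: "\<And>r :: nat \<Rightarrow> nat. strict_mono r \<Longrightarrow> \<exists>r' :: nat \<Rightarrow> nat. strict_mono r' \<and> (\<lambda>n. u (r (r' n))) \<longlonglongrightarrow> 0"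
  shows "u \<longlonglongrightarrow> 0"
proof (rule ccontr)
  assume "\<not> u \<longlonglongrightarrow> 0"
  then obtain e where e: "0 < e" "\<not> eventually (\<lambda>n. dist (u n) 0 < e) sequentially"
    unfolding tendsto_iff by blast
  define A where "A = {n. \<not> dist (u n) 0 < e}"
  have "infinite A"
    using e(2) unfolding A_def cofinite_eq_sequentially[symmetric] eventually_cofinite .
  then have r: "strict_mono (enumerate A)" "\<And>n. enumerate A n \<in> A"
    by (auto simp: strict_mono_enumerate enumerate_in_set)
  from sub[OF r(1)] obtain r' :: "nat \<Rightarrow> nat" where "(\<lambda>n. u (enumerate A (r' n))) \<longlonglongrightarrow> 0" by blast
  then have "eventually (\<lambda>n. dist (u (enumerate A (r' n))) 0 < e) sequentially"
    by (rule tendstoD) (rule e)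
  then obtain n where "dist (u (enumerate A (r' n))) 0 < e" by (auto simp: eventually_sequentially)
  then show False using r(2)[of "r' n"] by (simp add: A_def)
qed

text \<open>Convergence in probability is phrased by subsequences, so that dominated convergence,
  with \<open>K * \<bar>s x\<bar>\<close> as majorant, applies along each of them.\<close>

lemma integral_tendsto_0_AE_subseq:
  fixes Z :: "nat \<Rightarrow> 'a \<Rightarrow> real"
  assumes s: "integrable M s" and Z: "\<And>n. Z n \<in> borel_measurable M"
    and K: "\<And>n x. x \<in> space M \<Longrightarrow> \<bar>Z n x\<bar> \<le> K"
    and sub: "\<And>r :: nat \<Rightarrow> nat. strict_mono r \<Longrightarrow>
      \<exists>r' :: nat \<Rightarrow> nat. strict_mono r' \<and> (AE x in M. (\<lambda>n. Z (r (r' n)) x) \<longlonglongrightarrow> 0)"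
  shows "(\<lambda>n. \<integral>x. Z n x * s x \<partial>M) \<longlonglongrightarrow> 0"
proof (rule tendsto_0_subseq)
  fix r :: "nat \<Rightarrow> nat" assume "strict_mono r"
  from sub[OF this] obtain r' :: "nat \<Rightarrow> nat" where r': "strict_mono r'"
    and ae: "AE x in M. (\<lambda>n. Z (r (r' n)) x) \<longlonglongrightarrow> 0" by blast
  note [measurable] = Z borel_measurable_integrable[OF s]
  have "(\<lambda>n. \<integral>x. Z (r (r' n)) x * s x \<partial>M) \<longlonglongrightarrow> (\<integral>x. 0 \<partial>M)"
  proof (rule integral_dominated_convergence[where w = "\<lambda>x. K * \<bar>s x\<bar>"])
    show "AE x in M. (\<lambda>n. Z (r (r' n)) x * s x) \<longlonglongrightarrow> 0"
      using ae by eventually_elim (rule tendsto_mult_left_zero)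
    show "AE x in M. norm (Z (r (r' n)) x * s x) \<le> K * \<bar>s x\<bar>" for n
      by (rule AE_I2) (simp add: abs_mult mult_right_mono K)
  qed (use s in auto)
  then show "\<exists>r' :: nat \<Rightarrow> nat. strict_mono r' \<and> (\<lambda>n. \<integral>x. Z (r (r' n)) x * s x \<partial>M) \<longlonglongrightarrow> 0"
    using r' by auto
qed

text \<open>Summing over all entries of the array gives a single sequence, hence a single
  subsequence that serves every entry at once.\<close>

definition mean_second_sum ::
  "(nat \<Rightarrow> 'e \<Rightarrow> 'x) \<Rightarrow> coord set \<Rightarrow> (nat \<Rightarrow> nat \<Rightarrow> nat \<Rightarrow> (nat \<Rightarrow> 'x) \<Rightarrow> real) \<Rightarrow> nat \<Rightarrow> nat \<Rightarrow> nat \<Rightarrow> 'e \<Rightarrow> real"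
  where "mean_second_sum X I h K l n x = (\<Sum>c\<in>I. \<Sum>j\<le>K * K.
    (\<Sum>r\<le>nat \<lfloor>real n * (real j / real K + 1 / real (Suc l))\<rfloor>.
        window_weight (1 / real (Suc l)) (real j / real K) n r * second_sum X h c r x) / real n)"

lemma second_sum_nonneg: "0 \<le> second_sum X h c r x"
  by (auto simp: second_sum_def split: coord.split)

text \<open>Every \<open>r\<close> in a window is at most \<open>n * L\<close>, so after division by
  \<open>n\<close> the expectation is of order
  \<open>A * L powr (1 - \<epsilon>) * n powr (- \<epsilon>)\<close>.\<close>

lemma mean_second_sum_tendsto_0:
  assumes fin: "finite I" and K: "0 < K" and \<epsilon>: "0 < \<epsilon>" "\<epsilon> < 1" and A: "0 \<le> A"
    and int: "\<And>c r. c \<in> I \<Longrightarrow> integrable M (second_sum X h c r)"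
    and le: "\<And>c r. c \<in> I \<Longrightarrow> (\<integral>x. second_sum X h c r x \<partial>M) \<le> A * real r powr (1 - \<epsilon>)"
  shows "integrable M (mean_second_sum X I h K l n)"
    and "(\<lambda>n. \<integral>x. \<bar>mean_second_sum X I h K l n x\<bar> \<partial>M) \<longlonglongrightarrow> 0"
proof -
  let ?\<omega> = "\<lambda>n j. window_weight (1 / real (Suc l)) (real j / real K) n"
  let ?R = "\<lambda>n j. nat \<lfloor>real n * (real j / real K + 1 / real (Suc l))\<rfloor>"
  have \<omega>: "0 \<le> ?\<omega> n j r" for n j r by (rule window_weight_nonneg) simp
  show integr: "integrable M (mean_second_sum X I h K l n)" for n
    unfolding mean_second_sum_def[abs_def]
    by (intro Bochner_Integration.integrable_sum integrable_divide integrable_mult_right int)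
  have nn: "0 \<le> mean_second_sum X I h K l n x" for n x
    unfolding mean_second_sum_def
    by (intro sum_nonneg divide_nonneg_nonneg mult_nonneg_nonneg second_sum_nonneg \<omega>) auto
  \<comment> \<open>A window starts at most at \<open>K\<close>, since \<open>j \<le> K * K\<close>,
    and has length at most 1.\<close>
  define L where "L = real K + 1"
  have upper: "(\<integral>x. \<bar>mean_second_sum X I h K l n x\<bar> \<partial>M)
      \<le> real (card I) * real (Suc (K * K)) * (A * (real n * L) powr (1 - \<epsilon>) / real n)" for n
  proof -
    have "(\<integral>x. \<bar>mean_second_sum X I h K l n x\<bar> \<partial>M)
        = (\<Sum>c\<in>I. \<Sum>j\<le>K * K. (\<Sum>r\<le>?R n j. ?\<omega> n j r * (\<integral>x. second_sum X h c r x \<partial>M)) / real n)"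
      using nn unfolding mean_second_sum_def
      by (simp add: Bochner_Integration.integral_sum int integrable_divide integrable_mult_right)
    also have "\<dots> \<le> (\<Sum>c\<in>I. \<Sum>j\<le>K * K. A * (real n * L) powr (1 - \<epsilon>) / real n)"
    proof (intro sum_mono divide_right_mono)
      fix c j assume c: "c \<in> I" and j: "j \<in> {..K * K}"
      have "real j / real K \<le> real K"
        using j K by (simp add: pos_divide_le_eq flip: of_nat_mult)
      moreover have "1 / real (Suc l) \<le> 1" by simp
      ultimately have *: "real j / real K + 1 / real (Suc l) \<le> L" by (simp only: L_def add_mono)
      have "(\<Sum>r\<le>?R n j. ?\<omega> n j r * (\<integral>x. second_sum X h c r x \<partial>M))
          \<le> (\<Sum>r\<le>?R n j. ?\<omega> n j r * (A * (real n * L) powr (1 - \<epsilon>)))"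
      proof (intro sum_mono mult_left_mono \<omega>)
        fix r assume "r \<in> {..?R n j}"
        then have "real r \<le> real (?R n j)" by (simp only: atMost_iff of_nat_le_iff)
        also have "\<dots> \<le> real n * (real j / real K + 1 / real (Suc l))"
          by (intro of_nat_floor mult_nonneg_nonneg add_nonneg_nonneg) auto
        also have "\<dots> \<le> real n * L" using * by (intro mult_left_mono) auto
        finally have "real r powr (1 - \<epsilon>) \<le> (real n * L) powr (1 - \<epsilon>)"
          using \<epsilon> by (intro powr_mono2) auto
        then have "A * real r powr (1 - \<epsilon>) \<le> A * (real n * L) powr (1 - \<epsilon>)"
          using A by (rule mult_left_mono)
        then show "(\<integral>x. second_sum X h c r x \<partial>M) \<le> A * (real n * L) powr (1 - \<epsilon>)"
          using le[OF c, of r] by linarith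
      qed
      also have "\<dots> = A * (real n * L) powr (1 - \<epsilon>)"
        unfolding sum_distrib_right[symmetric] by (subst sum_window_weight) auto
      finally show "(\<Sum>r\<le>?R n j. ?\<omega> n j r * (\<integral>x. second_sum X h c r x \<partial>M))
          \<le> A * (real n * L) powr (1 - \<epsilon>)" .
    qed simp
    also have "\<dots> = real (card I) * real (Suc (K * K)) * (A * (real n * L) powr (1 - \<epsilon>) / real n)"
      by simp
    finally show ?thesis .
  qed
  have "(\<lambda>n. real (card I) * real (Suc (K * K)) * (A * (real n * L) powr (1 - \<epsilon>) / real n)) \<longlonglongrightarrow> 0"
  proof (rule tendsto_mult_right_zero)
    have "(\<lambda>n. A * L powr (1 - \<epsilon>) * real n powr (- \<epsilon>)) \<longlonglongrightarrow> 0"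
      using \<epsilon> by (intro tendsto_mult_right_zero tendsto_neg_powr filterlim_real_sequentially) auto
    moreover have "eventually (\<lambda>n. A * L powr (1 - \<epsilon>) * real n powr (- \<epsilon>)
        = A * (real n * L) powr (1 - \<epsilon>) / real n) sequentially"
      using eventually_gt_at_top[of 0]
    proof eventually_elim
      case (elim n)
      have "(real n * L) powr (1 - \<epsilon>) = real n powr (1 - \<epsilon>) * L powr (1 - \<epsilon>)"
        by (rule powr_mult)
      moreover have "real n powr (1 - \<epsilon>) = real n * real n powr (- \<epsilon>)"
        using elim powr_add[of "real n" 1 "- \<epsilon>"] by simp
      ultimately show ?case using elim by simp
    qed
    ultimately show "(\<lambda>n. A * (real n * L) powr (1 - \<epsilon>) / real n) \<longlonglongrightarrow> 0"
      by (rule Lim_transform_eventually)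
  qed
  from tendsto_sandwich[OF always_eventually always_eventually tendsto_const this]
  show "(\<lambda>n. \<integral>x. \<bar>mean_second_sum X I h K l n x\<bar> \<partial>M) \<longlonglongrightarrow> 0"
    using upper by (simp del: of_nat_Suc)
qed

text \<open>Along a subsequence the averaged sums of \<open>h\<close> tend to 0 almost everywhere.
  At such a point the total head bound \<open>E\<close> is one fixed number, so the two arrays
  approach each other, and uniform continuity on the box of clipped arrays carries this over to
  \<open>F\<close>.\<close>

lemma window_path_diff_tendsto_0:
  assumes fin: "finite I" and \<epsilon>: "0 < \<epsilon>" "\<epsilon> < 1" and A: "0 \<le> A"
    and int: "\<And>c r. c \<in> I \<Longrightarrow> integrable M (second_sum X h c r)"
    and le: "\<And>c r. c \<in> I \<Longrightarrow> (\<integral>x. second_sum X h c r x \<partial>M) \<le> A * real r powr (1 - \<epsilon>)"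
    and F: "continuous_map (skorokhod_topology I) euclideanreal F"
    and r: "strict_mono (r :: nat \<Rightarrow> nat)"
  shows "\<exists>r' :: nat \<Rightarrow> nat. strict_mono r' \<and> (AE x in M. (\<lambda>n.
    F (window_path I k l (tail_process X I g f h 0 (r (r' n)) x))
    - F (window_path I k l (tail_process X I g f h N (r (r' n)) x))) \<longlonglongrightarrow> 0)"
proof -
  let ?U = "mean_second_sum X I h (Suc k) l"
  note mss = mean_second_sum_tendsto_0[OF fin zero_less_Suc[of k] \<epsilon> A int le, of l]
  have "(\<lambda>n. \<integral>x. norm (?U (r n) x) \<partial>M) \<longlonglongrightarrow> 0"
    using LIMSEQ_subseq_LIMSEQ[OF mss(2) r] by (simp add: o_def)
  from tendsto_L1_AE_subseq[OF _ this] obtain r' :: "nat \<Rightarrow> nat" where r': "strict_mono r'"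
    and ae: "AE x in M. (\<lambda>n. ?U (r (r' n)) x) \<longlonglongrightarrow> 0"
    using mss(1) by blast
  have rr: "strict_mono (\<lambda>n. r (r' n))" using r r' by (simp add: strict_mono_def)
  have sq: "(\<lambda>n. 1 / sqrt (real (r (r' n)))) \<longlonglongrightarrow> 0"
  proof -
    have "(\<lambda>n. inverse (sqrt (real n))) \<longlonglongrightarrow> 0"
      by (intro tendsto_inverse_0_at_top filterlim_compose[OF sqrt_at_top filterlim_real_sequentially])
    from LIMSEQ_subseq_LIMSEQ[OF this rr] show ?thesis by (simp add: o_def inverse_eq_divide)
  qed
  have "AE x in M. (\<lambda>n.
    F (window_path I k l (tail_process X I g f h 0 (r (r' n)) x))
    - F (window_path I k l (tail_process X I g f h N (r (r' n)) x))) \<longlonglongrightarrow> 0"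
    using ae
  proof eventually_elim
    case (elim x)
    define E where "E = (\<Sum>c\<in>I. head_bound X g f h N c x)"
    define D where "D n = E * (1 / sqrt (real n) + ?U n x)" for n
    have "(\<lambda>n. E * (1 / sqrt (real (r (r' n))) + ?U (r (r' n)) x)) \<longlonglongrightarrow> E * (0 + 0)"
      by (intro tendsto_mult tendsto_add tendsto_const sq elim)
    then have D: "(\<lambda>n. D (r (r' n))) \<longlonglongrightarrow> 0" by (simp add: D_def)
    have diff: "\<bar>window_array (Suc k) l (tail_process X I g f h 0 n x) (j, c)
        - window_array (Suc k) l (tail_process X I g f h N n x) (j, c)\<bar> \<le> D n"
      if c: "c \<in> I" and j: "j \<le> Suc k * Suc k" for n j c
    proof -
      define T where "T c j = (\<Sum>r\<le>nat \<lfloor>real n * (real j / real (Suc k) + 1 / real (Suc l))\<rfloor>.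
        window_weight (1 / real (Suc l)) (real j / real (Suc k)) n r * second_sum X h c r x) / real n" for c j
      have T0: "0 \<le> T c j" for c j
        unfolding T_def
        by (intro divide_nonneg_nonneg sum_nonneg mult_nonneg_nonneg window_weight_nonneg second_sum_nonneg) auto
      have "T c j \<le> (\<Sum>j\<le>Suc k * Suc k. T c j)"
        using j T0 by (intro member_le_sum) auto
      also have "\<dots> \<le> (\<Sum>c\<in>I. \<Sum>j\<le>Suc k * Suc k. T c j)"
        by (rule member_le_sum[OF c, of "\<lambda>c. \<Sum>j\<le>Suc k * Suc k. T c j"]) (rule sum_nonneg T0 fin)+
      also have "\<dots> = ?U n x" by (simp only: mean_second_sum_def T_def)
      finally have TU: "T c j \<le> ?U n x" .
      have HE: "head_bound X g f h N c x \<le> E"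
        unfolding E_def by (rule member_le_sum[OF c]) (auto intro: head_bound_nonneg fin)
      have "\<bar>window_array (Suc k) l (tail_process X I g f h 0 n x) (j, c)
          - window_array (Suc k) l (tail_process X I g f h N n x) (j, c)\<bar>
          \<le> head_bound X g f h N c x * (1 / sqrt (real n) + T c j)"
        unfolding T_def by (rule window_array_diff_le[OF c])
      also have "\<dots> \<le> D n"
        unfolding D_def using HE TU T0[of c j] head_bound_nonneg[of X g f h N c x]
        by (intro mult_mono add_left_mono) auto
      finally show ?thesis .
    qed
    show ?case
    proof (rule tendstoI)
      fix e :: real assume "0 < e"
      from step_path_uniformly_continuous[OF fin zero_less_Suc F this, of k "real (Suc l)"]
      obtain \<delta> where \<delta>: "0 < \<delta>" and uc: "\<And>a b. (\<forall>j\<le>Suc k * Suc k. \<forall>i\<in>I. \<bar>a (j, i)\<bar> \<le> real (Suc l) \<and>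
          \<bar>b (j, i)\<bar> \<le> real (Suc l) \<and> \<bar>a (j, i) - b (j, i)\<bar> < \<delta>) \<Longrightarrow>
          \<bar>F (step_path I (Suc k) a) - F (step_path I (Suc k) b)\<bar> < e" by blast
      have "eventually (\<lambda>n. D (r (r' n)) < \<delta>) sequentially"
        by (rule order_tendstoD[OF D]) (rule \<delta>)
      then show "eventually (\<lambda>n. dist (F (window_path I k l (tail_process X I g f h 0 (r (r' n)) x))
          - F (window_path I k l (tail_process X I g f h N (r (r' n)) x))) 0 < e) sequentially"
      proof eventually_elim
        case (elim n)
        show ?case
          unfolding window_path_def dist_real_def diff_0_right
          by (rule uc) (use diff elim window_array_le in \<open>blast intro: le_less_trans\<close>)
      qed
    qed
  qed
  then show ?thesis using r' by blast
qed

text \<open>For the truncated process the error of decorrelation is at most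
  \<open>nrm s * K * \<bar>\<delta> N\<bar>\<close>, uniformly in \<open>n\<close>. So
  \<open>N\<close> is fixed first, and the truncation error vanishes afterwards as \<open>n\<close>
  grows.\<close>

lemma decorrelation:
  fixes X :: "nat \<Rightarrow> 'e \<Rightarrow> 'x"
  assumes I_def: "I = coords d m dims p q" and "prob_space \<mu>"
    and X: "\<And>j. X j \<in> \<mu> \<rightarrow>\<^sub>M MX j"
    and g: "\<And>i j. i \<in> {1..d} \<Longrightarrow> g i j \<in> future_space MX j \<rightarrow>\<^sub>M (\<Pi>\<^sub>M a\<in>{1..dims i}. borel)"
    and f: "\<And>k u j. k \<in> {d+1..d+m} \<Longrightarrow> u \<in> {1..p k} \<Longrightarrow> f k u j \<in> borel_measurable (future_space MX j)"
    and h: "\<And>k v j. k \<in> {d+1..d+m} \<Longrightarrow> v \<in> {1..q k} \<Longrightarrow> h k v j \<in> borel_measurable (future_space MX j)"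
    and DC: "decay_of_correlations \<mu> MX X B nrm \<delta>"
    and \<epsilon>: "0 < \<epsilon>" "\<epsilon> < 1" and A: "0 \<le> A"
    and int: "\<And>c r. c \<in> I \<Longrightarrow> integrable \<mu> (second_sum X h c r)"
    and le: "\<And>c r. c \<in> I \<Longrightarrow> (\<integral>x. second_sum X h c r x \<partial>\<mu>) \<le> A * real r powr (1 - \<epsilon>)"
    and F: "continuous_map (skorokhod_topology I) euclideanreal F"
    and K: "\<And>y. y \<in> skorokhod_space I \<Longrightarrow> \<bar>F y\<bar> \<le> K"
    and s: "s \<in> B"
  shows "(\<lambda>n. (\<integral>x. F (window_path I k l (tail_process X I g f h 0 n x)) * s x \<partial>\<mu>)
    - (\<integral>x. s x \<partial>\<mu>) * (\<integral>x. F (window_path I k l (tail_process X I g f h 0 n x)) \<partial>\<mu>)) \<longlonglongrightarrow> 0"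
proof (rule tendstoI)
  fix e :: real assume e: "0 < e"
  interpret prob_space \<mu> by fact
  have fin: "finite I" unfolding I_def by (rule finite_coords)
  have sint: "integrable \<mu> s" and nrm: "0 \<le> nrm s" and \<delta>: "\<delta> \<longlonglongrightarrow> 0"
    using DC s unfolding decay_of_correlations_def by auto
  note [measurable] = borel_measurable_integrable[OF sint]
  define \<Phi> where "\<Phi> N n z = F (window_path I k l (tail_process (\<lambda>j z. z j) I g f h N n z))" for N n z
  define Y where "Y N n x = F (window_path I k l (tail_process X I g f h N n x))" for N n x
  have Y\<Phi>: "Y N n x = \<Phi> N n (future X N x)" for N n x
    by (simp only: Y_def \<Phi>_def tail_process_future[of X])
  \<comment> \<open>The truncated process is not assumed to be a random element of the Skorokhod
    space; measurability comes from the finitely many entries read by the step path.\<close>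
  have \<Phi>m: "\<Phi> N n \<in> borel_measurable (future_space MX N)" for N n
    unfolding \<Phi>_def window_path_def
  proof (rule measurable_step_path[OF fin zero_less_Suc F], rule window_array_measurable)
    fix c r assume "c \<in> I"
    then show "coord_value (\<lambda>j z. z j) g f h N n c r \<in> borel_measurable (future_space MX N)"
      unfolding I_def
      by (intro coord_value_measurable[where MX = MX and d = d and m = m and dims = dims and p = p and q = q]
        future_space_measurable g f h) auto
  qed
  have fut: "future X j \<in> \<mu> \<rightarrow>\<^sub>M future_space MX j" for j by (rule future_measurable[OF X])
  have Ym [measurable]: "Y N n \<in> borel_measurable \<mu>" for N n
    using measurable_compose[OF fut \<Phi>m, of N n] by (simp add: Y\<Phi>[abs_def])
  have \<Phi>b: "\<bar>\<Phi> N n z\<bar> \<le> K" for N n z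
    unfolding \<Phi>_def by (intro K window_path_in_skorokhod_space)
  have Yb: "\<bar>Y N n x\<bar> \<le> K" for N n x unfolding Y\<Phi> by (rule \<Phi>b)
  have K0: "0 \<le> K" using Yb[of 0 0 undefined] by linarith
  have Yint: "integrable \<mu> (Y N n)" for N n
    by (rule integrable_const_bound[where B = K]) (auto simp: Yb)
  have Ysint: "integrable \<mu> (\<lambda>x. Y N n x * t x)" if "integrable \<mu> t" for N n t
  proof (rule Bochner_Integration.integrable_bound)
    show "integrable \<mu> (\<lambda>x. K * t x)" using that by simp
    show "(\<lambda>x. Y N n x * t x) \<in> borel_measurable \<mu>" using that by measurable
    show "AE x in \<mu>. norm (Y N n x * t x) \<le> norm (K * t x)"
      using K0 by (intro AE_I2) (simp add: abs_mult mult_right_mono Yb)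
  qed
  have tail: "\<bar>(\<integral>x. Y N n x * s x \<partial>\<mu>) - (\<integral>x. s x \<partial>\<mu>) * (\<integral>x. Y N n x \<partial>\<mu>)\<bar> \<le> nrm s * K * \<bar>\<delta> N\<bar>" for N n
  proof -
    define \<psi> where "\<psi> z = complex_of_real (\<Phi> N n z)" for z
    have "\<psi> \<in> borel_measurable (future_space MX N)"
      using \<Phi>m[of N n] unfolding \<psi>_def by simp
    moreover have "bounded (\<psi> ` space (future_space MX N))"
      unfolding bounded_iff \<psi>_def using \<Phi>b by auto
    ultimately have "cmod ((\<integral>x. of_real (s x) * \<psi> (future X N x) \<partial>\<mu>)
              - of_real (\<integral>x. s x \<partial>\<mu>) * (\<integral>x. \<psi> (future X N x) \<partial>\<mu>))
          \<le> nrm s * enn2real (Lp_norm \<mu> \<infinity> (\<lambda>x. \<psi> (future X N x))) * \<delta> N"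
      using DC s unfolding decay_of_correlations_def by blast
    also have "(\<integral>x. of_real (s x) * \<psi> (future X N x) \<partial>\<mu>) = complex_of_real (\<integral>x. Y N n x * s x \<partial>\<mu>)"
      by (simp add: \<psi>_def Y\<Phi> mult.commute flip: of_real_mult integral_complex_of_real)
    also have "(\<integral>x. \<psi> (future X N x) \<partial>\<mu>) = complex_of_real (\<integral>x. Y N n x \<partial>\<mu>)"
      by (simp add: \<psi>_def Y\<Phi> flip: integral_complex_of_real)
    finally have "\<bar>(\<integral>x. Y N n x * s x \<partial>\<mu>) - (\<integral>x. s x \<partial>\<mu>) * (\<integral>x. Y N n x \<partial>\<mu>)\<bar>
        \<le> nrm s * enn2real (Lp_norm \<mu> \<infinity> (\<lambda>x. \<psi> (future X N x))) * \<delta> N"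
      unfolding of_real_mult[symmetric] of_real_diff[symmetric] norm_of_real .
    \<comment> \<open>The sign of \<open>\<delta> N\<close> is not prescribed, so its absolute value
      is inserted before the essential supremum is estimated by \<open>K\<close>.\<close>
    also have "\<dots> \<le> nrm s * K * \<bar>\<delta> N\<bar>"
    proof -
      have "(\<lambda>x. ennreal (norm (\<psi> (future X N x)))) \<in> borel_measurable \<mu>"
        unfolding \<psi>_def Y\<Phi>[symmetric] by measurable
      then have "Lp_norm \<mu> \<infinity> (\<lambda>x. \<psi> (future X N x)) \<le> ennreal K"
        unfolding Lp_norm_def by (auto simp: \<psi>_def \<Phi>b intro!: esssup_I ennreal_leI)
      then have "enn2real (Lp_norm \<mu> \<infinity> (\<lambda>x. \<psi> (future X N x))) \<le> K"
        by (rule enn2real_leI[OF K0])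
      then have "nrm s * enn2real (Lp_norm \<mu> \<infinity> (\<lambda>x. \<psi> (future X N x))) * \<bar>\<delta> N\<bar> \<le> nrm s * K * \<bar>\<delta> N\<bar>"
        using nrm by (intro mult_right_mono mult_left_mono) auto
      moreover have "nrm s * enn2real (Lp_norm \<mu> \<infinity> (\<lambda>x. \<psi> (future X N x))) * \<delta> N
          \<le> nrm s * enn2real (Lp_norm \<mu> \<infinity> (\<lambda>x. \<psi> (future X N x))) * \<bar>\<delta> N\<bar>"
        using nrm by (intro mult_left_mono mult_nonneg_nonneg) auto
      ultimately show ?thesis by linarith
    qed
    finally show ?thesis .
  qed
  have "(\<lambda>N. nrm s * K * \<bar>\<delta> N\<bar>) \<longlonglongrightarrow> 0"
    by (intro tendsto_mult_right_zero tendsto_rabs_zero \<delta>)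
  then have "eventually (\<lambda>N. nrm s * K * \<bar>\<delta> N\<bar> < e / 3) sequentially"
    by (rule order_tendstoD) (use e in simp)
  then obtain N where N: "nrm s * K * \<bar>\<delta> N\<bar> < e / 3" by (auto simp: eventually_sequentially)
  \<comment> \<open>This is used twice: with \<open>t = s\<close> for the mixed integral, and with
    \<open>t = 1\<close> for the mean.\<close>
  have diff: "(\<lambda>n. \<integral>x. (Y 0 n x - Y N n x) * t x \<partial>\<mu>) \<longlonglongrightarrow> 0" if "integrable \<mu> t" for t
  proof (rule integral_tendsto_0_AE_subseq[OF that, where K = "2 * K"])
    show "\<bar>Y 0 n x - Y N n x\<bar> \<le> 2 * K" for n x using Yb[of 0 n x] Yb[of N n x] by linarith
    show "\<exists>r' :: nat \<Rightarrow> nat. strict_mono r' \<and> (AE x in \<mu>. (\<lambda>n. Y 0 (r (r' n)) x - Y N (r (r' n)) x) \<longlonglongrightarrow> 0)"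
      if "strict_mono r" for r :: "nat \<Rightarrow> nat"
      unfolding Y_def by (rule window_path_diff_tendsto_0[OF fin \<epsilon> A int le F that])
  qed simp
  have E1: "eventually (\<lambda>n. dist (\<integral>x. (Y 0 n x - Y N n x) * s x \<partial>\<mu>) 0 < e / 3) sequentially"
    by (rule tendstoD[OF diff[OF sint]]) (use e in simp)
  have "(\<lambda>n. (\<integral>x. s x \<partial>\<mu>) * (\<integral>x. (Y 0 n x - Y N n x) * 1 \<partial>\<mu>)) \<longlonglongrightarrow> 0"
    by (intro tendsto_mult_right_zero diff) simp
  then have E2: "eventually (\<lambda>n. dist ((\<integral>x. s x \<partial>\<mu>) * (\<integral>x. (Y 0 n x - Y N n x) * 1 \<partial>\<mu>)) 0 < e / 3) sequentially"
    by (rule tendstoD) (use e in simp)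
  show "eventually (\<lambda>n. dist ((\<integral>x. F (window_path I k l (tail_process X I g f h 0 n x)) * s x \<partial>\<mu>)
    - (\<integral>x. s x \<partial>\<mu>) * (\<integral>x. F (window_path I k l (tail_process X I g f h 0 n x)) \<partial>\<mu>)) 0 < e) sequentially"
    unfolding Y_def[symmetric]
    using E1 E2
  proof eventually_elim
    case (elim n)
    have "(\<integral>x. (Y 0 n x - Y N n x) * s x \<partial>\<mu>) = (\<integral>x. Y 0 n x * s x \<partial>\<mu>) - (\<integral>x. Y N n x * s x \<partial>\<mu>)"
      using Ysint[OF sint] by (simp add: left_diff_distrib)
    moreover have "(\<integral>x. s x \<partial>\<mu>) * (\<integral>x. (Y 0 n x - Y N n x) * 1 \<partial>\<mu>)
        = (\<integral>x. s x \<partial>\<mu>) * (\<integral>x. Y 0 n x \<partial>\<mu>) - (\<integral>x. s x \<partial>\<mu>) * (\<integral>x. Y N n x \<partial>\<mu>)"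
      using Yint by (simp add: right_diff_distrib)
    ultimately show ?case
      using elim tail[of N n] N unfolding dist_real_def by linarith
  qed
qed

text \<open>An element \<open>s\<close> of \<open>B\<close> close to \<open>r\<close> need not have
  integral 1; its deviation is bounded by the same L^1 distance, so both replacements cost a
  multiple of that distance, uniformly in \<open>n\<close>.\<close>

lemma decorrelation_Lp_closure:
  fixes Y :: "nat \<Rightarrow> 'e \<Rightarrow> real"
  assumes "prob_space \<mu>" and s1: "1 \<le> s\<^sub>1"
    and B: "\<And>s. s \<in> B \<Longrightarrow> integrable \<mu> s"
    and Y [measurable]: "\<And>n. Y n \<in> borel_measurable \<mu>"
    and K: "\<And>n x. x \<in> space \<mu> \<Longrightarrow> \<bar>Y n x\<bar> \<le> K"
    and decor: "\<And>s. s \<in> B \<Longrightarrow>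
      (\<lambda>n. (\<integral>x. Y n x * s x \<partial>\<mu>) - (\<integral>x. s x \<partial>\<mu>) * (\<integral>x. Y n x \<partial>\<mu>)) \<longlonglongrightarrow> 0"
    and r: "integrable \<mu> r" "(\<integral>x. r x \<partial>\<mu>) = 1" "r \<in> Lp_closure \<mu> s\<^sub>1 (B \<inter> Lp_space \<mu> s\<^sub>1)"
  shows "(\<lambda>n. \<integral>x. Y n x * (r x - 1) \<partial>\<mu>) \<longlonglongrightarrow> 0"
proof (rule tendstoI)
  fix e :: real assume e: "0 < e"
  interpret prob_space \<mu> by fact
  obtain x0 where "x0 \<in> space \<mu>" using not_empty by blast
  then have K0: "0 \<le> K" using K[of x0 0] by linarith
  \<comment> \<open>The L^1 distance is at most \<open>2 * \<eta>\<close>. Replacing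
    \<open>r\<close> by \<open>s\<close> in the integral and 1 by the integral of \<open>s\<close>
    each costs \<open>2 * K * \<eta>\<close>, together at most \<open>e / 2\<close>.\<close>
  define \<eta> where "\<eta> = e / (8 * (K + 1))"
  have \<eta>: "0 < \<eta>" "4 * K * \<eta> \<le> e / 2"
    using e K0 by (auto simp: \<eta>_def field_simps)
  obtain s where s: "s \<in> B" "Lp_norm \<mu> s\<^sub>1 (\<lambda>x. r x - s x) < ennreal \<eta>"
    using r(3) \<eta>(1) unfolding Lp_closure_def by blast
  note sint = B[OF s(1)]
  note [measurable] = borel_measurable_integrable[OF sint] borel_measurable_integrable[OF r(1)]
  have L1: "(\<integral>x. \<bar>r x - s x\<bar> \<partial>\<mu>) \<le> 2 * \<eta>"
    using s(2) by (intro Lp_norm_imp_integrable(2)[OF prob_space_axioms _ s1 \<eta>(1)]) auto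
  have int: "integrable \<mu> (\<lambda>x. Y n x * t x)" if "integrable \<mu> t" for n t
  proof (rule Bochner_Integration.integrable_bound)
    show "integrable \<mu> (\<lambda>x. K * t x)" using that by simp
    show "(\<lambda>x. Y n x * t x) \<in> borel_measurable \<mu>" using that by measurable
    show "AE x in \<mu>. norm (Y n x * t x) \<le> norm (K * t x)"
      using K0 by (intro AE_I2) (simp add: abs_mult mult_right_mono K)
  qed
  have bound: "\<bar>\<integral>x. Y n x * (r x - s x) \<partial>\<mu>\<bar> \<le> 2 * K * \<eta>" for n
  proof -
    have "\<bar>\<integral>x. Y n x * (r x - s x) \<partial>\<mu>\<bar> \<le> (\<integral>x. \<bar>Y n x * (r x - s x)\<bar> \<partial>\<mu>)"
      using integral_norm_bound[of \<mu> "\<lambda>x. Y n x * (r x - s x)"] by simp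
    also have "\<dots> \<le> (\<integral>x. K * \<bar>r x - s x\<bar> \<partial>\<mu>)"
    proof (rule integral_mono)
      show "integrable \<mu> (\<lambda>x. \<bar>Y n x * (r x - s x)\<bar>)"
        using int[of "\<lambda>x. r x - s x" n] sint r(1) by (intro integrable_abs) simp
      show "integrable \<mu> (\<lambda>x. K * \<bar>r x - s x\<bar>)" using sint r(1) by simp
      show "\<bar>Y n x * (r x - s x)\<bar> \<le> K * \<bar>r x - s x\<bar>" if "x \<in> space \<mu>" for x
        using K[OF that, of n] by (simp add: abs_mult mult_right_mono)
    qed
    also have "\<dots> \<le> K * (2 * \<eta>)" using L1 K0 by (simp add: mult_left_mono)
    finally show ?thesis by simp
  qed
  have means: "\<bar>(\<integral>x. s x \<partial>\<mu>) - 1\<bar> \<le> 2 * \<eta>"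
  proof -
    have "(\<integral>x. s x \<partial>\<mu>) - 1 = - (\<integral>x. r x - s x \<partial>\<mu>)" using sint r by simp
    also have "\<bar>\<dots>\<bar> \<le> (\<integral>x. \<bar>r x - s x\<bar> \<partial>\<mu>)"
      using integral_norm_bound[of \<mu> "\<lambda>x. r x - s x"] by simp
    finally show ?thesis using L1 by linarith
  qed
  have EY: "\<bar>\<integral>x. Y n x \<partial>\<mu>\<bar> \<le> K" for n
  proof -
    have "\<bar>\<integral>x. Y n x \<partial>\<mu>\<bar> \<le> (\<integral>x. \<bar>Y n x\<bar> \<partial>\<mu>)" using integral_norm_bound[of \<mu> "Y n"] by simp
    also have "\<dots> \<le> (\<integral>x. K \<partial>\<mu>)" using int[of "\<lambda>_. 1" n] K by (intro integral_mono) auto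
    finally show ?thesis by (simp add: prob_space)
  qed
  have "eventually (\<lambda>n. dist ((\<integral>x. Y n x * s x \<partial>\<mu>) - (\<integral>x. s x \<partial>\<mu>) * (\<integral>x. Y n x \<partial>\<mu>)) 0 < e / 2) sequentially"
    by (rule tendstoD[OF decor[OF s(1)]]) (use e in simp)
  then show "eventually (\<lambda>n. dist (\<integral>x. Y n x * (r x - 1) \<partial>\<mu>) 0 < e) sequentially"
  proof eventually_elim
    case (elim n)
    have "(\<integral>x. Y n x * (r x - 1) \<partial>\<mu>) = (\<integral>x. Y n x * r x \<partial>\<mu>) - (\<integral>x. Y n x \<partial>\<mu>)"
      using int[OF r(1), of n] int[of "\<lambda>_. 1" n] by (simp add: right_diff_distrib)
    moreover have "(\<integral>x. Y n x * (r x - s x) \<partial>\<mu>) = (\<integral>x. Y n x * r x \<partial>\<mu>) - (\<integral>x. Y n x * s x \<partial>\<mu>)"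
      using int[OF r(1), of n] int[OF sint, of n] by (simp add: right_diff_distrib)
    moreover have "\<bar>((\<integral>x. s x \<partial>\<mu>) - 1) * (\<integral>x. Y n x \<partial>\<mu>)\<bar> \<le> 2 * \<eta> * K"
      unfolding abs_mult using means EY \<eta>(1) by (intro mult_mono) auto
    moreover have "((\<integral>x. s x \<partial>\<mu>) - 1) * (\<integral>x. Y n x \<partial>\<mu>)
        = (\<integral>x. s x \<partial>\<mu>) * (\<integral>x. Y n x \<partial>\<mu>) - (\<integral>x. Y n x \<partial>\<mu>)" by (simp add: left_diff_distrib)
    moreover have "2 * \<eta> * K + 2 * K * \<eta> \<le> e / 2" using \<eta>(2) by simp
    ultimately show ?case using elim bound[of n] unfolding dist_real_def by linarith
  qed
qed

section \<open>Transfer between the two measures\<close>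

theorem theorem4p5:
  fixes \<mu> :: "'e measure"
    and MX :: "nat \<Rightarrow> 'x measure"
    and X :: "nat \<Rightarrow> 'e \<Rightarrow> 'x"
    and B :: "('e \<Rightarrow> real) set" and nrm :: "('e \<Rightarrow> real) \<Rightarrow> real" and \<delta> :: "nat \<Rightarrow> real"
    and d m :: nat and dims p q :: "nat \<Rightarrow> nat"
    and g :: "nat \<Rightarrow> nat \<Rightarrow> (nat \<Rightarrow> 'x) \<Rightarrow> nat \<Rightarrow> real"
    and f h :: "nat \<Rightarrow> nat \<Rightarrow> nat \<Rightarrow> (nat \<Rightarrow> 'x) \<Rightarrow> real"
    and s\<^sub>1 :: ennreal and r :: "'e \<Rightarrow> real"
  defines "\<nu> \<equiv> density \<mu> (\<lambda>x. ennreal (r x))"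
    and "V \<equiv> V_process X d m dims p q g f h"
    and "\<D> \<equiv> skorokhod_topology (coords d m dims p q)"
  assumes "prob_space \<mu>"
    and "\<And>j. X j \<in> \<mu> \<rightarrow>\<^sub>M MX j"
    and "\<And>i. i \<in> {1..d} \<Longrightarrow> 1 \<le> dims i"
    and "\<And>i j. i \<in> {1..d} \<Longrightarrow> g i j \<in> future_space MX j \<rightarrow>\<^sub>M (\<Pi>\<^sub>M a\<in>{1..dims i}. borel)"
    and "\<And>k u j. k \<in> {d+1..d+m} \<Longrightarrow> u \<in> {1..p k} \<Longrightarrow> f k u j \<in> borel_measurable (future_space MX j)"
    and "\<And>k v j. k \<in> {d+1..d+m} \<Longrightarrow> v \<in> {1..q k} \<Longrightarrow> h k v j \<in> borel_measurable (future_space MX j)"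
    and "decay_of_correlations \<mu> MX X B nrm \<delta>"
    and "1 \<le> s\<^sub>1"
    and "moment_assumption \<mu> X d m p q f h s\<^sub>1"
    and "AE x in \<mu>. 0 \<le> r x"
    and "(\<integral>x. r x \<partial>\<mu>) = 1"
    and "r \<in> Lp_closure \<mu> s\<^sub>1 (B \<inter> Lp_space \<mu> s\<^sub>1)"
  shows "(\<forall>P. converges_in_distribution \<mu> V \<D> P \<longrightarrow> converges_in_distribution \<nu> V \<D> P) \<and>
    ((AE x in \<mu>. 0 < r x) \<longrightarrow>
      (\<forall>P. converges_in_distribution \<nu> V \<D> P \<longrightarrow> converges_in_distribution \<mu> V \<D> P))"
proof -
  define I where "I = coords d m dims p q"
  have fin: "finite I" unfolding I_def by (rule finite_coords)
  interpret prob_space \<mu> by fact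
  note X = assms(5) and g = assms(7) and f = assms(8) and h = assms(9) and DC = assms(10)
    and s1 = assms(11) and r_nonneg = assms(13) and r_mean = assms(14) and r_closure = assms(15)
  \<comment> \<open>A non-integrable function has Bochner integral 0 by convention, so the value 1
    forces integrability.\<close>
  have r_int: "integrable \<mu> r" using r_mean not_integrable_integral_eq by fastforce
  note [measurable] = borel_measurable_integrable[OF r_int]
  obtain p1 :: ennreal and \<epsilon> C :: real where p1: "1 \<le> p1" and \<epsilon>: "0 < \<epsilon>" "\<epsilon> < 1"
    and C0: "\<forall>k\<in>{d+1..d+m}. \<forall>v\<in>{1..q k}. \<forall>n\<ge>1.
      Lp_norm \<mu> p1 (birkhoff_sum X (h k v) n) \<le> ennreal (C * real n powr (1 - \<epsilon>))"
    using assms(12) unfolding moment_assumption_def by blast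
  \<comment> \<open>\<open>C\<close> could be nonpositive, while the passage to first moments asks
    for a strictly positive bound.\<close>
  define C' where "C' = max C 1"
  have C': "0 < C'" by (simp add: C'_def)
  then have A: "0 \<le> 2 * C'" by simp
  have birkhoff: "integrable \<mu> (birkhoff_sum X (h k v) n) \<and>
      (\<integral>x. \<bar>birkhoff_sum X (h k v) n x\<bar> \<partial>\<mu>) \<le> 2 * C' * real n powr (1 - \<epsilon>)"
    if kv: "k \<in> {d+1..d+m}" "v \<in> {1..q k}" for k v n
  \<comment> \<open>The moment bound starts at 1; for 0 the sum is empty and the right-hand side is
    0 as well.\<close>
  proof (cases "n = 0")
    case True
    then show ?thesis by (simp add: birkhoff_sum_def[abs_def])
  next
    case False
    have fut: "future X j \<in> \<mu> \<rightarrow>\<^sub>M future_space MX j" for j by (rule future_measurable[OF X])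
    have [measurable]: "(\<lambda>x. h k v j (future X j x)) \<in> borel_measurable \<mu>" for j
      by (rule measurable_compose[OF fut h[OF kv]])
    have meas: "birkhoff_sum X (h k v) n \<in> borel_measurable \<mu>"
      unfolding birkhoff_sum_def[abs_def] by measurable
    have "Lp_norm \<mu> p1 (birkhoff_sum X (h k v) n) \<le> ennreal (C * real n powr (1 - \<epsilon>))"
      using C0 kv False by auto
    also have "\<dots> \<le> ennreal (C' * real n powr (1 - \<epsilon>))"
      by (intro ennreal_leI mult_right_mono) (auto simp: C'_def)
    finally have "Lp_norm \<mu> p1 (birkhoff_sum X (h k v) n) \<le> ennreal (C' * real n powr (1 - \<epsilon>))" .
    moreover have "0 < C' * real n powr (1 - \<epsilon>)" using C' False by simp
    ultimately show ?thesis
      using Lp_norm_imp_integrable[OF prob_space_axioms meas p1] by (simp add: mult.assoc)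
  qed
  have int: "integrable \<mu> (second_sum X h c n)"
    and le: "(\<integral>x. second_sum X h c n x \<partial>\<mu>) \<le> 2 * C' * real n powr (1 - \<epsilon>)" if "c \<in> I" for c n
    using that birkhoff C' by (auto simp: I_def coords_def second_sum_def[abs_def])
  have V: "V n = tail_process X I g f h 0 n" for n
    by (simp only: V_def I_def tail_process_0)
  \<comment> \<open>Measurability of \<open>V n\<close> into the Skorokhod space is part of
    convergence in distribution under either measure, hence a premise here.\<close>
  have decor: "(\<lambda>n. \<integral>x. F (window_path I k l (V n x)) * (r x - 1) \<partial>\<mu>) \<longlonglongrightarrow> 0"
    if V_meas: "\<And>n. V n \<in> \<mu> \<rightarrow>\<^sub>M borel_of_topology \<D>"
      and F: "continuous_map (skorokhod_topology I) euclideanreal F" "bounded (F ` skorokhod_space I)" for F k l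
  proof -
    obtain K where K: "\<And>y. y \<in> skorokhod_space I \<Longrightarrow> \<bar>F y\<bar> \<le> K"
      using F(2) unfolding bounded_iff by auto
    show ?thesis
    proof (rule decorrelation_Lp_closure[OF prob_space_axioms s1 _ _ _ _ r_int r_mean r_closure])
      show "integrable \<mu> s" if "s \<in> B" for s using DC that by (simp add: decay_of_correlations_def)
      show "(\<lambda>x. F (window_path I k l (V n x))) \<in> borel_measurable \<mu>" for n
        using measurable_compose[OF V_meas[of n, unfolded \<D>_def, folded I_def]
            continuous_map_borel_measurable[OF continuous_map_window_path[OF fin F(1)]]] .
      show "\<bar>F (window_path I k l (V n x))\<bar> \<le> K" for n x
        by (rule K[OF window_path_in_skorokhod_space])
      show "(\<lambda>n. (\<integral>x. F (window_path I k l (V n x)) * s x \<partial>\<mu>)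
          - (\<integral>x. s x \<partial>\<mu>) * (\<integral>x. F (window_path I k l (V n x)) \<partial>\<mu>)) \<longlonglongrightarrow> 0" if s: "s \<in> B" for s
        unfolding V
        by (rule decorrelation[OF I_def prob_space_axioms X g f h DC \<epsilon> A int le F(1) K s])
    qed
  qed
  have \<nu>_meas: "V n \<in> \<nu> \<rightarrow>\<^sub>M borel_of_topology \<D> \<longleftrightarrow> V n \<in> \<mu> \<rightarrow>\<^sub>M borel_of_topology \<D>" for n
    unfolding \<nu>_def by (intro arg_cong2[where f = "(\<in>)"] measurable_cong_sets) simp_all
  have F_meas: "(\<lambda>x. F (V n x)) \<in> borel_measurable \<mu>"
    if "V n \<in> \<mu> \<rightarrow>\<^sub>M borel_of_topology \<D>" "continuous_map \<D> euclideanreal F" for F n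
    by (rule measurable_compose[OF that(1) continuous_map_borel_measurable[OF that(2)]])
  have \<nu>_int: "(\<integral>x. F (V n x) \<partial>\<nu>) = (\<integral>x. F (V n x) * r x \<partial>\<mu>)"
    if "V n \<in> \<mu> \<rightarrow>\<^sub>M borel_of_topology \<D>" "continuous_map \<D> euclideanreal F" for F n
    unfolding \<nu>_def using F_meas[OF that] r_nonneg
    by (subst integral_real_density) (auto simp: mult.commute)
  have top: "\<D> = skorokhod_topology I"
    by (simp only: \<D>_def I_def)
  show ?thesis
  proof (intro conjI impI allI)
    fix P assume "converges_in_distribution \<mu> V \<D> P"
    then have V_meas: "V n \<in> \<mu> \<rightarrow>\<^sub>M borel_of_topology \<D>" and P: "prob_space P"
        "sets P = sets (borel_of_topology \<D>)"
      and lim: "continuous_map \<D> euclideanreal F \<Longrightarrow> bounded (F ` topspace \<D>) \<Longrightarrow>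
        (\<lambda>n. \<integral>x. F (V n x) \<partial>\<mu>) \<longlonglongrightarrow> (\<integral>y. F y \<partial>P)" for n F
      unfolding converges_in_distribution_def by auto
    \<comment> \<open>The known limit has density 1, which is positive, and the target density
      \<open>r\<close> may vanish.\<close>
    have "(\<lambda>n. \<integral>x. F (V n x) \<partial>\<nu>) \<longlonglongrightarrow> (\<integral>y. F y \<partial>P)"
      if F: "continuous_map \<D> euclideanreal F" "bounded (F ` topspace \<D>)" for F
      unfolding \<nu>_int[OF V_meas F(1)]
      by (rule weak_limit_change_density[OF fin P(1) P(2)[unfolded top] V_meas[unfolded top],
          where \<alpha> = "\<lambda>_. 1" and \<beta> = r])
        (use r_int r_nonneg lim decor[OF V_meas] F in \<open>simp_all add: top topspace_skorokhod[OF fin]\<close>)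
    then show "converges_in_distribution \<nu> V \<D> P"
      using V_meas P unfolding converges_in_distribution_def \<nu>_meas by simp
  next
    fix P assume pos: "AE x in \<mu>. 0 < r x" and "converges_in_distribution \<nu> V \<D> P"
    then have V_meas: "V n \<in> \<mu> \<rightarrow>\<^sub>M borel_of_topology \<D>" and P: "prob_space P"
        "sets P = sets (borel_of_topology \<D>)"
      and lim: "continuous_map \<D> euclideanreal F \<Longrightarrow> bounded (F ` topspace \<D>) \<Longrightarrow>
        (\<lambda>n. \<integral>x. F (V n x) \<partial>\<nu>) \<longlonglongrightarrow> (\<integral>y. F y \<partial>P)" for n F
      unfolding converges_in_distribution_def \<nu>_meas by auto
    have decor': "(\<lambda>n. \<integral>x. F (window_path I k l (V n x)) * (1 - r x) \<partial>\<mu>) \<longlonglongrightarrow> 0"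
      if "continuous_map (skorokhod_topology I) euclideanreal F" "bounded (F ` skorokhod_space I)" for F k l
    proof -
      have "- (\<integral>x. F (window_path I k l (V n x)) * (r x - 1) \<partial>\<mu>)
          = (\<integral>x. F (window_path I k l (V n x)) * (1 - r x) \<partial>\<mu>)" for n
        unfolding Bochner_Integration.integral_minus[symmetric] mult_minus_right[symmetric] minus_diff_eq ..
      then show ?thesis using tendsto_minus[OF decor[OF V_meas that, of k l]] by simp
    qed
    \<comment> \<open>Now the known limit has density \<open>r\<close>. Its positivity is what
      allows the density 1 to be dominated by a multiple of \<open>r\<close> off a set of small
      measure.\<close>
    have "(\<lambda>n. \<integral>x. F (V n x) * 1 \<partial>\<mu>) \<longlonglongrightarrow> (\<integral>y. F y \<partial>P)"
      if F: "continuous_map \<D> euclideanreal F" "bounded (F ` topspace \<D>)" for F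
      by (rule weak_limit_change_density[OF fin P(1) P(2)[unfolded top] V_meas[unfolded top] r_int pos,
          where \<beta> = "\<lambda>_. 1"])
        (use lim \<nu>_int[OF V_meas] decor' F in \<open>simp_all add: top topspace_skorokhod[OF fin]\<close>)
    then show "converges_in_distribution \<mu> V \<D> P"
      using V_meas P unfolding converges_in_distribution_def by simp
  qed
qed

end
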